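(* Let $Q_0,Q_1$ be covariance operators (bounded, selfadjoint, positive semi-definite) on a separable real Hilbert space $H$, and consider the cylindrical Gaussian laws $\mathcal N_{cyl}(0,Q_0)$ and $\mathcal N_{cyl}(0,Q_1)$ in $H$. If $Q_0,Q_1$ are one-to-one and $\operatorname{im}(Q_0^{1/2})=\operatorname{im}(Q_1^{1/2})$, then $$H^2\big(\mathcal N_{cyl}(0,Q_0),\mathcal N_{cyl}(0,Q_1)\big)\le \tfrac14\big\|Q_0^{-1/2}Q_1^{1/2}-(Q_1^{-1/2}Q_0^{1/2})^\ast\big\|_{HS}^2,$$ provided the right-hand side is finite. In that case the two laws are equivalent.
   Context: $X\sim\mathcal N_{cyl}(0,Q)$ means that $(\langle X,v\rangle)_{v\in H}$ is a centred Gaussian process indexed by $v\in H$ with $\operatorname{Cov}(\langle X,v_1\rangle,\langle X,v_2\rangle)=\langle Qv_1,v_2\rangle$; $Q$ is bounded and positive semi-definite but not necessarily trace class. The law is regarded as the law of this process (on $\mathbb R^{H}$ with the product $\sigma$-algebra). $H^2(P,P')=\int(\sqrt{dP}-\sqrt{dP'})^2$ is the squared Hellinger distance (bounded by $2$). $\|\cdot\|_{HS}$ is the Hilbert-Schmidt norm on $H$. Equivalent means mutually absolutely continuous. Under $\operatorname{im}(Q_0^{1/2})=\operatorname{im}(Q_1^{1/2})$ the operators $Q_0^{-1/2}Q_1^{1/2}$ and $Q_1^{-1/2}Q_0^{1/2}$ are everywhere defined on $H$. *)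

theory Defs
  imports "HOL-Probability.Probability"
begin

section \<open>Operators on a separable real Hilbert space\<close>

text \<open>A separable real Hilbert space is a type of sort \<open>{real_inner, polish_space}\<close>: a real
  inner product space that is complete and second countable in its norm topology.\<close>

definition psd_operator :: "('h::real_inner \<Rightarrow> 'h) \<Rightarrow> bool" where
  "psd_operator T \<longleftrightarrow> bounded_linear T \<and> (\<forall>x y. T x \<bullet> y = x \<bullet> T y) \<and> (\<forall>x. 0 \<le> T x \<bullet> x)"

text \<open>On a Hilbert space the positive square root exists and is unique, so the choice below is
  the operator \<open>Q\<^sup>1\<^sup>/\<^sup>2\<close>.\<close>

definition op_sqrt :: "('h::real_inner \<Rightarrow> 'h) \<Rightarrow> 'h \<Rightarrow> 'h" where
  "op_sqrt Q = (SOME S. psd_operator S \<and> S \<circ> S = Q)"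

text \<open>\<open>Q\<^sup>-\<^sup>1\<^sup>/\<^sup>2 R\<^sup>1\<^sup>/\<^sup>2\<close> for one-to-one \<open>Q\<close> with
  \<open>im (R\<^sup>1\<^sup>/\<^sup>2) \<subseteq> im (Q\<^sup>1\<^sup>/\<^sup>2)\<close>: then \<open>inv\<close> is only
  applied to elements of the range, where it is the genuine inverse of \<open>Q\<^sup>1\<^sup>/\<^sup>2\<close>.\<close>

definition inv_sqrt_comp :: "('h::real_inner \<Rightarrow> 'h) \<Rightarrow> ('h \<Rightarrow> 'h) \<Rightarrow> 'h \<Rightarrow> 'h" where
  "inv_sqrt_comp Q R = inv (op_sqrt Q) \<circ> op_sqrt R"

definition orthonormal_basis :: "'h::real_inner set \<Rightarrow> bool" where
  "orthonormal_basis B \<longleftrightarrow>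
     pairwise orthogonal B \<and> (\<forall>e\<in>B. norm e = 1) \<and> closure (span B) = UNIV"

text \<open>The squared Hilbert-Schmidt norm, with value \<open>\<infinity>\<close> if the operator is not
  Hilbert-Schmidt. For bounded operators it does not depend on the basis.\<close>

definition hs_norm_sq :: "('h::real_inner \<Rightarrow> 'h) \<Rightarrow> ennreal" where
  "hs_norm_sq A = (\<Sum>\<^sub>\<infinity>e\<in>(SOME B. orthonormal_basis B). ennreal ((norm (A e))\<^sup>2))"

section \<open>Cylindrical Gaussian laws\<close>

text \<open>Point masses at 0 count as (degenerate) centred Gaussian laws.\<close>

definition centred_gaussian :: "'w measure \<Rightarrow> ('w \<Rightarrow> real) \<Rightarrow> bool" where
  "centred_gaussian M Y \<longleftrightarrow> Y \<in> borel_measurable M \<and>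
     ((\<exists>\<sigma>>0. distributed M lborel Y (\<lambda>x. ennreal (normal_density 0 \<sigma> x))) \<or> (AE w in M. Y w = 0))"

definition centred_gaussian_process :: "'w measure \<Rightarrow> ('i \<Rightarrow> 'w \<Rightarrow> real) \<Rightarrow> bool" where
  "centred_gaussian_process M X \<longleftrightarrow> prob_space M \<and>
     (\<forall>F c. finite F \<longrightarrow> centred_gaussian M (\<lambda>w. \<Sum>i\<in>F. c i * X i w))"

definition covariance :: "'w measure \<Rightarrow> ('w \<Rightarrow> real) \<Rightarrow> ('w \<Rightarrow> real) \<Rightarrow> real" where
  "covariance M Y Z =
     integral\<^sup>L M (\<lambda>w. (Y w - integral\<^sup>L M Y) * (Z w - integral\<^sup>L M Z))"

text \<open>\<open>X \<sim> N\<^sub>c\<^sub>y\<^sub>l(0, Q)\<close> on the probability space \<open>M\<close>, where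
  \<open>X v\<close> is the real random variable written \<open>\<langle>X, v\<rangle>\<close>.\<close>

definition cyl_gaussian ::
    "'w measure \<Rightarrow> ('h::real_inner \<Rightarrow> 'w \<Rightarrow> real) \<Rightarrow> ('h \<Rightarrow> 'h) \<Rightarrow> bool" where
  "cyl_gaussian M X Q \<longleftrightarrow> centred_gaussian_process M X \<and>
     (\<forall>v1 v2. covariance M (X v1) (X v2) = Q v1 \<bullet> v2)"

definition process_law :: "'w measure \<Rightarrow> ('i \<Rightarrow> 'w \<Rightarrow> real) \<Rightarrow> ('i \<Rightarrow> real) measure" where
  "process_law M X = distr M (\<Pi>\<^sub>M i\<in>UNIV. borel) (\<lambda>w i. X i w)"

section \<open>Comparison of laws\<close>

definition sum_of_measures :: "'a measure \<Rightarrow> 'a measure \<Rightarrow> 'a measure" where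
  "sum_of_measures P P' = measure_of (space P) (sets P) (\<lambda>A. emeasure P A + emeasure P' A)"

text \<open>The integral of \<open>(\<surd>dP - \<surd>dP')\<^sup>2\<close>, for finite measures on the same
  \<open>\<sigma>\<close>-algebra, evaluated with the dominating measure \<open>P + P'\<close>. There is no factor
  \<open>1/2\<close>, so the maximal value for probability measures is 2.\<close>

definition hellinger_sq :: "'a measure \<Rightarrow> 'a measure \<Rightarrow> ennreal" where
  "hellinger_sq P P' =
     (let \<mu> = sum_of_measures P P' in
      \<integral>\<^sup>+x. ennreal ((sqrt (enn2real (RN_deriv \<mu> P x)) - sqrt (enn2real (RN_deriv \<mu> P' x)))\<^sup>2) \<partial>\<mu>)"

definition equivalent_measures :: "'a measure \<Rightarrow> 'a measure \<Rightarrow> bool" where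
  "equivalent_measures P P' \<longleftrightarrow> absolutely_continuous P P' \<and> absolutely_continuous P' P"

end

theory Submission
  imports Defs
begin

text \<open>
  Write \<open>S0\<close>, \<open>S1\<close> for the square roots of \<open>Q0\<close>, \<open>Q1\<close>, put \<open>A = S0\<^sup>-\<^sup>1 S1\<close> and
  \<open>A' = S1\<^sup>-\<^sup>1 S0\<close>, and let \<open>D\<close> be \<open>A\<close> minus the adjoint of \<open>A'\<close>.

  The comparison of the two laws is reduced to finitely many coordinates. For a finite set \<open>F\<close> of
  vectors, diagonalising the compression of \<open>A A\<^sup>*\<close> to \<open>S0 (span F)\<close> yields a basis \<open>U\<close> of \<open>span F\<close>
  that is orthonormal for \<open>Q0\<close> and orthogonal for \<open>Q1\<close> (\<open>simultaneous_diagonalisation\<close>).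
  The coordinates \<open>X u\<close> are then independent, standard normal under the first law and centred
  normal with variance \<open>\<lambda> u = Q1 u \<bullet> u\<close> under the second one (\<open>cyl_gaussian_joint_law\<close>). The log
  likelihood ratio \<open>L\<close> is explicit, and the symmetrised relative entropy \<open>E1 L - E0 L\<close>
  equals half of the sum of \<open>\<lambda> u - 2 + 1 / \<lambda> u\<close> (\<open>jeffreys_close_gaussian_coordinates\<close>).
  The vectors \<open>w = S0 u\<close> are orthonormal, and \<open>D\<^sup>* w = S1 u - A' w\<close>. As \<open>S1 u \<bullet> A' w = 1\<close>, the
  Cauchy-Schwarz inequality gives \<open>1 / \<lambda> u \<le> A' w \<bullet> A' w\<close>, hence
  \<open>\<lambda> u - 2 + 1 / \<lambda> u \<le> (norm (D\<^sup>* w))\<^sup>2\<close>. Summation over \<open>u\<close> bounds the symmetrised entropy by half of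
  the squared Hilbert-Schmidt norm of \<open>D\<close>, for every \<open>F\<close>.

  Both conclusions follow from a bound \<open>J\<close> of the symmetrised entropy. The inequality
  \<open>exp (L / 2) \<ge> 1 + L / 2\<close>, integrated under each of the two laws with the appropriate sign of \<open>L\<close>,
  bounds the squared Hellinger distance by either relative entropy, hence by their average \<open>J / 2\<close>;
  this is where the factor \<open>1 / 4\<close> comes from. Splitting an event at the level \<open>L = K\<close> gives
  \<open>P' C \<le> exp K * P C + 2 * J / K\<close>, which forces absolute continuity as \<open>K\<close> grows.

  The predicate \<open>jeffreys_close\<close> records these two inequalities in terms of test functions and
  events only. In this form they pass to image measures, and from all finite marginals to the law on
  the product space, because cylinder functions are dense in \<open>L\<^sup>1\<close> of the sum of the two laws
  (\<open>jeffreys_close_from_marginals\<close>).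
\<close>

section \<open>Geometry of Hilbert spaces\<close>

text \<open>First-order optimality: a linear term dominated by a quadratic one for all \<open>t\<close> vanishes.\<close>

lemma linear_coeff_zero:
  fixes b c :: real
  assumes "\<And>t. 2 * t * b \<le> t\<^sup>2 * c"
  shows "b = 0"
proof -
  define k where "k = \<bar>c\<bar> + 1"
  have k: "k > 0" "c < k" by (auto simp: k_def)
  have "2 * (b / k) * b \<le> (b / k)\<^sup>2 * c" by (rule assms)
  also have "\<dots> \<le> (b / k)\<^sup>2 * k" using k by (intro mult_left_mono) auto
  also have "\<dots> = b\<^sup>2 / k" using k by (simp add: power2_eq_square)
  finally have "2 * b\<^sup>2 / k \<le> b\<^sup>2 / k" by (simp add: power2_eq_square)
  with k have "2 * b\<^sup>2 \<le> b\<^sup>2" by (simp add: field_simps)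
  then show ?thesis by simp
qed

text \<open>A minimising sequence for the distance from \<open>x\<close> to \<open>M\<close> is Cauchy by the parallelogram law, and
  its limit satisfies the first-order condition of minimality.\<close>

lemma projection_exists:
  fixes M :: "'h::{real_inner, complete_space} set"
  assumes "closed M" and "subspace M"
  obtains p where "p \<in> M" and "\<And>y. y \<in> M \<Longrightarrow> (x - p) \<bullet> y = 0"
proof -
  define d where "d = infdist x M"
  have ne: "M \<noteq> {}" using subspace_0[OF assms(2)] by auto
  have d_le: "d \<le> norm (x - y)" if "y \<in> M" for y
    using infdist_le[OF that, of x] by (simp add: d_def dist_norm)
  have d0: "d \<ge> 0" by (simp add: d_def infdist_nonneg)
  have "\<exists>y\<in>M. norm (x - y) < d + 1 / real (Suc n)" for n
  proof -
    have "infdist x M < d + 1 / real (Suc n)" by (simp add: d_def)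
    then have "(INF a\<in>M. dist x a) < d + 1 / real (Suc n)"
      using ne by (simp add: infdist_notempty)
    then show ?thesis using ne
      by (subst (asm) cINF_less_iff) (auto simp: dist_norm intro: bdd_belowI[of _ 0])
  qed
  then obtain y where yM: "\<And>n. y n \<in> M" and y: "\<And>n. norm (x - y n) < d + 1 / real (Suc n)"
    by metis
  have par: "(norm (y m - y n))\<^sup>2 \<le> 4 * ((d + 1 / real (Suc N))\<^sup>2 - d\<^sup>2)"
    if "m \<ge> N" "n \<ge> N" for m n N
  proof -
    let ?a = "d + 1 / real (Suc N)"
    have le: "(norm (x - y k))\<^sup>2 \<le> ?a\<^sup>2" if "k \<ge> N" for k
    proof (rule power_mono)
      have "1 / real (Suc k) \<le> 1 / real (Suc N)" using that by (simp add: frac_le)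
      then show "norm (x - y k) \<le> ?a" using y[of k] by linarith
    qed auto
    have "(1/2) *\<^sub>R (y m + y n) \<in> M"
      using yM assms(2) by (intro subspace_scale subspace_add)
    then have "d\<^sup>2 \<le> (norm (x - (1/2) *\<^sub>R (y m + y n)))\<^sup>2"
      using d0 d_le by (intro power_mono) auto
    moreover have "(norm (y m - y n))\<^sup>2 = 2 * (norm (x - y m))\<^sup>2 + 2 * (norm (x - y n))\<^sup>2
        - 4 * (norm (x - (1/2) *\<^sub>R (y m + y n)))\<^sup>2"
      by (simp add: power2_norm_eq_inner inner_diff inner_add inner_commute algebra_simps)
    ultimately show ?thesis using le[of m] le[of n] that by (simp add: algebra_simps)
  qed
  have lim0: "(\<lambda>N. 4 * ((d + 1 / real (Suc N))\<^sup>2 - d\<^sup>2)) \<longlonglongrightarrow> 4 * ((d + 0)\<^sup>2 - d\<^sup>2)"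
    by (intro tendsto_intros LIMSEQ_Suc[OF lim_1_over_n])
  have "Cauchy y"
  proof (rule metric_CauchyI)
    fix e :: real assume e: "e > 0"
    with lim0 have "eventually (\<lambda>N. 4 * ((d + 1 / real (Suc N))\<^sup>2 - d\<^sup>2) < e\<^sup>2) sequentially"
      by (intro order_tendstoD(2)) auto
    then obtain N where N: "4 * ((d + 1 / real (Suc N))\<^sup>2 - d\<^sup>2) < e\<^sup>2"
      by (auto simp: eventually_sequentially)
    show "\<exists>N. \<forall>m\<ge>N. \<forall>n\<ge>N. dist (y m) (y n) < e"
    proof (intro exI allI impI)
      fix m n assume "m \<ge> N" "n \<ge> N"
      then have "(norm (y m - y n))\<^sup>2 < e\<^sup>2" using par N by (meson le_less_trans)
      then show "dist (y m) (y n) < e"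
        using e by (simp add: dist_norm power_less_imp_less_base)
    qed
  qed
  then obtain p where p: "y \<longlonglongrightarrow> p" using Cauchy_convergent_iff convergent_def by blast
  have pM: "p \<in> M" using assms(1) yM p by (metis closed_sequentially)
  have "norm (x - p) \<le> d"
  proof (rule LIMSEQ_le)
    show "(\<lambda>n. norm (x - y n)) \<longlonglongrightarrow> norm (x - p)" by (intro tendsto_intros p)
    show "(\<lambda>n. d + 1 / real (Suc n)) \<longlonglongrightarrow> d"
      using tendsto_add[OF tendsto_const[of d] LIMSEQ_Suc[OF lim_1_over_n]] by simp
    show "\<exists>N. \<forall>n\<ge>N. norm (x - y n) \<le> d + 1 / real (Suc n)" using y less_imp_le by blast
  qed
  have "(x - p) \<bullet> z = 0" if "z \<in> M" for z
  proof (rule linear_coeff_zero)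
    fix t :: real
    have "p + t *\<^sub>R z \<in> M" using pM that assms(2) by (intro subspace_scale subspace_add)
    then have "norm (x - p) \<le> norm (x - (p + t *\<^sub>R z))"
      using d_le \<open>norm (x - p) \<le> d\<close> by force
    then have "(norm (x - p))\<^sup>2 \<le> (norm (x - (p + t *\<^sub>R z)))\<^sup>2" by (intro power_mono) auto
    also have "x - (p + t *\<^sub>R z) = (x - p) - t *\<^sub>R z" by simp
    also have "(norm \<dots>)\<^sup>2 = (norm (x - p))\<^sup>2 - 2 * t * ((x - p) \<bullet> z) + t\<^sup>2 * (z \<bullet> z)"
      unfolding power2_norm_eq_inner inner_diff_left[of "x - p"] inner_diff_right[of _ "x - p"]
      by (simp add: power2_eq_square inner_commute[of z "x - p"])
    finally show "2 * t * ((x - p) \<bullet> z) \<le> t\<^sup>2 * (z \<bullet> z)" by simp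
  qed
  with pM that show thesis by blast
qed

text \<open>The representing vector spans the orthogonal complement of the kernel.\<close>

lemma riesz_representation:
  fixes f :: "'h::{real_inner, complete_space} \<Rightarrow> real"
  assumes "bounded_linear f"
  obtains y where "\<And>x. f x = x \<bullet> y"
proof (cases "\<forall>x. f x = 0")
  case True
  then show ?thesis using that[of 0] by simp
next
  case False
  interpret bounded_linear f by fact
  obtain x where x: "f x \<noteq> 0" using False by blast
  let ?M = "{v. f v = 0}"
  have "closed ?M"
    by (intro closed_Collect_eq continuous_intros linear_continuous_on assms)
  moreover have "subspace ?M" by (auto simp: subspace_def zero add scaleR)
  ultimately obtain p where p: "f p = 0" "\<And>y. f y = 0 \<Longrightarrow> (x - p) \<bullet> y = 0"
    by (rule projection_exists[of ?M x]) auto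
  define z where "z = x - p"
  have fz: "f z \<noteq> 0" using x p by (simp add: z_def diff)
  then have z: "z \<bullet> z \<noteq> 0" using zero by auto
  have "f v = v \<bullet> ((f z / (z \<bullet> z)) *\<^sub>R z)" for v
  proof -
    have "f (v - (f v / f z) *\<^sub>R z) = 0" using fz by (simp add: diff scaleR)
    from p(2)[OF this] have "z \<bullet> (v - (f v / f z) *\<^sub>R z) = 0" by (simp only: z_def)
    then have "z \<bullet> v = f v / f z * (z \<bullet> z)" by (simp add: inner_diff_right)
    then have "f z * (z \<bullet> v) = f v * (z \<bullet> z)" using fz by (simp add: field_simps)
    then show ?thesis using z by (simp add: inner_commute[of v z] field_simps)
  qed
  then show ?thesis by (rule that)
qed

text \<open>By the Riesz representation the choice in the definition of \<open>adjoint\<close> ranges over a nonempty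
  set.\<close>

lemma adjoint_hilbert:
  fixes f :: "'h::{real_inner, complete_space} \<Rightarrow> 'k::real_inner"
  assumes "bounded_linear f"
  shows "f x \<bullet> y = x \<bullet> adjoint f y"
proof -
  have "\<exists>z. \<forall>x. f x \<bullet> y = x \<bullet> z" for y
  proof -
    have "bounded_linear (\<lambda>x. f x \<bullet> y)"
      using bounded_linear_compose[OF bounded_linear_inner_left assms] by simp
    from riesz_representation[OF this] show ?thesis by metis
  qed
  then have "\<exists>f'. \<forall>x y. f x \<bullet> y = x \<bullet> f' y" by metis
  then have "\<forall>x y. f x \<bullet> y = x \<bullet> adjoint f y"
    unfolding adjoint_def by (rule someI_ex)
  then show ?thesis by blast
qed

lemma bounded_linear_adjoint:
  fixes f :: "'h::{real_inner, complete_space} \<Rightarrow> 'k::real_inner"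
  assumes "bounded_linear f"
  shows "bounded_linear (adjoint f)"
proof -
  note adj = adjoint_hilbert[OF assms]
  obtain K where K: "\<And>x. norm (f x) \<le> norm x * K" "K > 0"
    using bounded_linear.pos_bounded[OF assms] by blast
  show ?thesis
  proof (rule bounded_linear_intro[where K = K])
    show "adjoint f (y + z) = adjoint f y + adjoint f z" for y z
      by (rule vector_eq_ldot[THEN iffD1]) (simp add: inner_add_right flip: adj)
    show "adjoint f (r *\<^sub>R y) = r *\<^sub>R adjoint f y" for r y
      by (rule vector_eq_ldot[THEN iffD1]) (simp flip: adj)
    show "norm (adjoint f y) \<le> norm y * K" for y
    proof -
      have "norm (adjoint f y) * norm (adjoint f y) = f (adjoint f y) \<bullet> y"
        unfolding adj by (metis power2_norm_eq_inner power2_eq_square)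
      also have "\<dots> \<le> norm (f (adjoint f y)) * norm y" by (rule norm_cauchy_schwarz)
      also have "\<dots> \<le> norm (adjoint f y) * K * norm y" by (intro mult_right_mono K) auto
      finally show ?thesis using K(2)
        by (cases "norm (adjoint f y) = 0") (auto simp: mult.assoc mult.commute)
    qed
  qed
qed

text \<open>The uniform boundedness principle for the functionals \<open>x \<mapsto> x \<bullet> a\<close>, by a gliding hump. If the
  set contains vectors \<open>a n\<close> of norm above \<open>4 ^ n\<close>, then a sum of steps of size \<open>3 ^ -(n + 1)\<close> in
  the directions \<open>\<plusminus> a n\<close>, with signs chosen one after the other, has an unbounded sequence of inner
  products with the \<open>a n\<close>: later steps undo at most half of what step \<open>n\<close> contributes.\<close>

lemma weakly_bounded_imp_bounded:
  fixes S :: "'h::{real_inner, complete_space} set"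
  assumes wb: "\<And>x. \<exists>C. \<forall>a\<in>S. \<bar>x \<bullet> a\<bar> \<le> C"
  shows "\<exists>K. \<forall>a\<in>S. norm a \<le> K"
proof (rule ccontr)
  assume "\<not> ?thesis"
  then have "\<exists>a. a \<in> S \<and> norm a > 4 ^ n" for n :: nat by (meson not_less)
  then obtain a where aS: "\<And>n::nat. a n \<in> S" and a: "\<And>n. norm (a n) > 4 ^ n" by metis
  have a0: "norm (a n) > 0" for n
    using a[of n] zero_less_power[of "4::real" n] by linarith
  \<comment> \<open>step \<open>n\<close>, up to its sign\<close>
  define h where "h n = ((1/3) ^ Suc n / norm (a n)) *\<^sub>R a n" for n
  have nh: "norm (h n) = (1/3) ^ Suc n" for n using a0[of n] by (simp add: h_def)
  have ha: "h n \<bullet> a n = (1/3) ^ Suc n * norm (a n)" for n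
    using a0[of n] by (simp add: h_def power2_eq_square flip: power2_norm_eq_inner)
  define x where "x = rec_nat 0 (\<lambda>n u.
      if \<bar>(u + h n) \<bullet> a n\<bar> \<ge> \<bar>(u - h n) \<bullet> a n\<bar> then u + h n else u - h n)"
  have xS: "x (Suc n) = (if \<bar>(x n + h n) \<bullet> a n\<bar> \<ge> \<bar>(x n - h n) \<bullet> a n\<bar>
      then x n + h n else x n - h n)" for n by (simp add: x_def)
  have big: "\<bar>x (Suc n) \<bullet> a n\<bar> \<ge> (1/3) ^ Suc n * norm (a n)" for n
  proof -
    have "(x n + h n) \<bullet> a n - (x n - h n) \<bullet> a n = 2 * ((1/3) ^ Suc n * norm (a n))"
      unfolding ha[symmetric] by (simp add: inner_diff_left inner_add_left)
    then show ?thesis unfolding xS by (simp split: if_splits) linarith+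
  qed
  have step: "norm (x (Suc n) - x n) = (1/3) ^ Suc n" for n
    unfolding xS using nh[of n] by simp
  have tail: "norm (x (n + k) - x n) \<le> (1/3) ^ n / 2 - (1/3) ^ (n + k) / 2" for n k
  proof (induction k)
    case (Suc k)
    have "norm (x (n + Suc k) - x n) \<le> norm (x (Suc (n + k)) - x (n + k)) + norm (x (n + k) - x n)"
      using norm_triangle_ineq[of "x (Suc (n + k)) - x (n + k)" "x (n + k) - x n"] by simp
    also have "\<dots> \<le> (1/3) ^ Suc (n + k) + ((1/3) ^ n / 2 - (1/3) ^ (n + k) / 2)"
      using Suc step[of "n + k"] by simp
    finally show ?case by simp
  qed simp
  have tail': "norm (x m - x n) \<le> (1/3) ^ n / 2" if "m \<ge> n" for m n
  proof -
    obtain k where k: "m = n + k" using \<open>m \<ge> n\<close> le_Suc_ex by blast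
    have "(0::real) \<le> (1/3) ^ (n + k)" by simp
    then show ?thesis using tail[of n k] unfolding k by linarith
  qed
  have "Cauchy x"
  proof (rule metric_CauchyI)
    fix e :: real assume "e > 0"
    then obtain N where N: "(1/3::real) ^ N < e" using real_arch_pow_inv[of e "1/3"] by auto
    show "\<exists>M. \<forall>m\<ge>M. \<forall>n\<ge>M. dist (x m) (x n) < e"
    proof (intro exI allI impI)
      fix m n assume "m \<ge> N" "n \<ge> N"
      then show "dist (x m) (x n) < e"
        using tail'[of N m] tail'[of N n] N norm_triangle_ineq4[of "x m - x N" "x n - x N"]
        by (simp add: dist_norm)
    qed
  qed
  then obtain l where l: "x \<longlonglongrightarrow> l" using Cauchy_convergent_iff convergent_def by blast
  \<comment> \<open>At index \<open>Suc n\<close> this is half of the step size \<open>(1/3) ^ Suc n\<close>.\<close>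
  have close: "norm (l - x n) \<le> (1/3) ^ n / 2" for n
    by (rule LIMSEQ_le_const2[of "\<lambda>m. norm (x m - x n)"])
      (use tail' in \<open>auto intro!: tendsto_intros l\<close>)
  obtain C where C: "\<And>n. \<bar>l \<bullet> a n\<bar> \<le> C" using wb[of l] aS by blast
  have "(4/3) ^ n \<le> 6 * C" for n :: nat
  proof -
    have "\<bar>(l - x (Suc n)) \<bullet> a n\<bar> \<le> norm (l - x (Suc n)) * norm (a n)"
      by (rule Cauchy_Schwarz_ineq2)
    also have "\<dots> \<le> (1/3) ^ Suc n / 2 * norm (a n)" by (intro mult_right_mono close) auto
    finally have "(1/3) ^ Suc n / 2 * norm (a n) \<le> \<bar>l \<bullet> a n\<bar>"
      using big[of n] unfolding inner_diff_left by linarith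
    then have "(1/3) ^ Suc n / 2 * norm (a n) \<le> C" using C[of n] by linarith
    moreover have "(1/3) ^ Suc n / 2 * 4 ^ n \<le> (1/3) ^ Suc n / 2 * norm (a n)"
      using a[of n] by (intro mult_left_mono) auto
    ultimately show ?thesis by (simp add: power_divide field_simps)
  qed
  moreover obtain n :: nat where "6 * C < (4/3) ^ n" using real_arch_pow[of "4/3" "6 * C"] by auto
  ultimately show False by (meson not_less)
qed

section \<open>Square roots of positive operators and their quotients\<close>

text \<open>After scaling, \<open>Q = c (1 - T)\<close> with \<open>0 \<le> T \<le> 1\<close>, and the root is \<open>sqrt c (1 - L)\<close> where \<open>L\<close> solves
  \<open>L = (T + L\<^sup>2) / 2\<close>. The iteration \<open>S (n + 1) = (T + (S n)\<^sup>2) / 2\<close> from \<open>0\<close> is dominated by the same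
  iteration \<open>s\<close> for real numbers with \<open>T\<close> replaced by \<open>1\<close>: the norms of the increments of \<open>S\<close> are at
  most the increments of \<open>s\<close>, which is increasing and bounded by \<open>1\<close>. This also covers the case that
  \<open>Q\<close> is not bounded below, in which the iteration is not a contraction.\<close>

lemma psd_operator_square_root:
  fixes Q :: "'h::{real_inner, complete_space} \<Rightarrow> 'h"
  assumes Q: "psd_operator Q"
  shows "\<exists>S. psd_operator S \<and> S \<circ> S = Q"
proof -
  have blQ: "bounded_linear Q" and symQ: "\<And>x y. Q x \<bullet> y = x \<bullet> Q y"
    and posQ: "\<And>x. 0 \<le> Q x \<bullet> x" using Q by (auto simp: psd_operator_def)
  obtain c where c: "\<And>x. norm (Q x) \<le> norm x * c" "c > 0"
    using bounded_linear.pos_bounded[OF blQ] by blast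
  define T where "T x = x - (1 / c) *\<^sub>R Q x" for x
  have blT: "bounded_linear T"
    unfolding T_def by (intro bounded_linear_sub bounded_linear_ident
        bounded_linear_compose[OF bounded_linear_scaleR_right] blQ)
  interpret T: bounded_linear T by (rule blT)
  have symT: "T x \<bullet> y = x \<bullet> T y" for x y
    by (simp add: T_def inner_diff_left inner_diff_right symQ)
  have posT: "0 \<le> T x \<bullet> x" for x
  proof -
    have "Q x \<bullet> x \<le> norm (Q x) * norm x" by (rule norm_cauchy_schwarz)
    also have "\<dots> \<le> (norm x * c) * norm x" by (intro mult_right_mono c) auto
    finally have "Q x \<bullet> x \<le> c * (x \<bullet> x)"
      by (simp add: power2_norm_eq_inner[symmetric] power2_eq_square mult_ac)
    then show ?thesis using c(2) by (simp add: T_def inner_diff_left field_simps)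
  qed
  have T1: "T x \<bullet> x \<le> x \<bullet> x" for x
    using posQ[of x] c(2) by (simp add: T_def inner_diff_left)
  have normT: "norm (T x) \<le> norm x" for x
  proof (rule power2_le_imp_le)
    \<comment> \<open>Positivity at \<open>x - T x\<close> turns the bound \<open>T \<le> 1\<close> of forms into one of norms.\<close>
    have "0 \<le> T (x - T x) \<bullet> (x - T x)" by (rule posT)
    also have "\<dots> = T x \<bullet> x - 2 * (T x \<bullet> T x) + T (T x) \<bullet> T x"
      using symT[of "T x" x] by (simp add: T.diff inner_diff_left inner_diff_right)
    finally show "(norm (T x))\<^sup>2 \<le> (norm x)\<^sup>2"
      using T1[of x] T1[of "T x"] by (simp add: power2_norm_eq_inner)
  qed auto

  define s :: "nat \<Rightarrow> real" where "s = rec_nat 0 (\<lambda>_ u. (1 + u\<^sup>2) / 2)"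
  have s0: "s 0 = 0" and sS: "s (Suc n) = (1 + (s n)\<^sup>2) / 2" for n by (simp_all add: s_def)
  have s_range: "0 \<le> s n \<and> s n \<le> 1" for n
    by (induction n) (auto simp: s0 sS power_le_one)
  define S :: "nat \<Rightarrow> 'h \<Rightarrow> 'h" where
    "S = rec_nat (\<lambda>x. 0) (\<lambda>_ U x. (1/2) *\<^sub>R (T x + U (U x)))"
  have S0: "S 0 x = 0" and SS: "S (Suc n) x = (1/2) *\<^sub>R (T x + S n (S n x))" for n x
    by (simp_all add: S_def)
  have linS: "linear (S n)" for n
  proof (induction n)
    case (Suc n)
    then interpret Sn: linear "S n" .
    show ?case
      by (rule linearI) (simp_all add: SS T.add T.scaleR Sn.add Sn.scaleR scaleR_add_right)
  qed (simp add: S0 linear_iff)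
  have S_diff: "S n (x - y) = S n x - S n y" for n x y by (rule linear_diff[OF linS])
  have symS: "S n x \<bullet> y = x \<bullet> S n y" for n x y
    by (induction n arbitrary: x y)
      (simp_all add: S0 SS inner_add_left inner_add_right symT)
  have normS: "norm (S n x) \<le> s n * norm x" for n x
  proof (induction n arbitrary: x)
    case (Suc n)
    have "norm (S n (S n x)) \<le> s n * norm (S n x)" by (rule Suc)
    also have "\<dots> \<le> s n * (s n * norm x)" using s_range[of n] Suc by (intro mult_left_mono) auto
    finally have "norm (T x + S n (S n x)) \<le> norm x + (s n)\<^sup>2 * norm x"
      using normT[of x] norm_triangle_ineq[of "T x" "S n (S n x)"]
      by (simp add: power2_eq_square mult.assoc)
    then show ?case by (simp add: SS sS algebra_simps del: scaleR_add_right)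
  qed (simp add: S0 s0)
  have step: "norm (S (Suc n) x - S n x) \<le> (s (Suc n) - s n) * norm x" for n x
  proof (induction n arbitrary: x)
    case 0
    show ?case using normT[of x] by (simp add: S0 SS s0 sS)
  next
    case (Suc n)
    let ?d = "s (Suc n) - s n"
    have nn: "0 \<le> s n" "0 \<le> s (Suc n)" using s_range by auto
    have d0: "0 \<le> ?d \<or> x = 0"
      using order_trans[OF norm_ge_zero Suc[of x]] by (auto simp: zero_le_mult_iff)
    have "norm (S (Suc n) (S (Suc n) x - S n x)) \<le> s (Suc n) * norm (S (Suc n) x - S n x)"
      by (rule normS)
    also have "\<dots> \<le> s (Suc n) * (?d * norm x)" by (intro mult_left_mono Suc nn)
    finally have 1: "norm (S (Suc n) (S (Suc n) x - S n x)) \<le> s (Suc n) * (?d * norm x)" .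
    have "norm (S (Suc n) (S n x) - S n (S n x)) \<le> ?d * norm (S n x)" by (rule Suc)
    also have "\<dots> \<le> ?d * (s n * norm x)"
      using d0 normS[of n x] by (auto intro: mult_left_mono simp: linear_0[OF linS])
    finally have 2: "norm (S (Suc n) (S n x) - S n (S n x)) \<le> ?d * (s n * norm x)" .
    \<comment> \<open>\<open>U\<^sup>2 - V\<^sup>2 = U (U - V) + (U - V) V\<close>, which holds without commutation\<close>
    have "S (Suc (Suc n)) x - S (Suc n) x =
        (1/2) *\<^sub>R (S (Suc n) (S (Suc n) x - S n x) + (S (Suc n) (S n x) - S n (S n x)))"
      unfolding S_diff SS[of "Suc n" x] SS[of n x] by (simp add: algebra_simps)
    then have "norm (S (Suc (Suc n)) x - S (Suc n) x) \<le>
        (s (Suc n) * (?d * norm x) + ?d * (s n * norm x)) / 2"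
      using 1 2 norm_triangle_ineq[of "S (Suc n) (S (Suc n) x - S n x)"
          "S (Suc n) (S n x) - S n (S n x)"] by simp
    also have "\<dots> = (s (Suc (Suc n)) - s (Suc n)) * norm x"
      unfolding sS[of "Suc n"] sS[of n] by (simp add: power2_eq_square field_simps)
    finally show ?case .
  qed
  have tail: "norm (S (n + k) x - S n x) \<le> (s (n + k) - s n) * norm x" for n k x
  proof (induction k)
    case (Suc k)
    have "norm (S (n + Suc k) x - S n x) \<le>
        norm (S (Suc (n + k)) x - S (n + k) x) + norm (S (n + k) x - S n x)"
      using norm_triangle_ineq[of "S (Suc (n + k)) x - S (n + k) x" "S (n + k) x - S n x"] by simp
    also have "\<dots> \<le> (s (Suc (n + k)) - s (n + k)) * norm x + (s (n + k) - s n) * norm x"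
      by (intro add_mono step Suc)
    finally show ?case by (simp add: algebra_simps)
  qed simp
  have s_inc: "s n \<le> s (Suc n)" for n
  proof -
    have "0 \<le> (s n - 1)\<^sup>2" by simp
    then show ?thesis by (simp add: sS power2_eq_square algebra_simps)
  qed
  have "convergent s"
    using s_inc s_range by (intro Bseq_monoseq_convergent BseqI'[of s 1] incseq_imp_monoseq incseq_SucI) auto
  then have "Cauchy s" by (simp add: convergent_Cauchy)
  have "convergent (\<lambda>n. S n x)" for x
  proof -
    have "Cauchy (\<lambda>n. S n x)"
    proof (rule metric_CauchyI)
      fix e :: real assume e: "e > 0"
      have "e / (norm x + 1) > 0" using e by (simp add: add_nonneg_pos)
      then obtain N where N: "\<And>m n. m \<ge> N \<Longrightarrow> n \<ge> N \<Longrightarrow> dist (s m) (s n) < e / (norm x + 1)"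
        using \<open>Cauchy s\<close> unfolding Cauchy_def by blast
      have *: "dist (S (n + k) x) (S n x) < e" if "n \<ge> N" for n k
      proof -
        have "s (n + k) - s n < e / (norm x + 1)"
          using N[of "n + k" n] that by (simp add: dist_real_def)
        then have "(s (n + k) - s n) * (norm x + 1) < e"
          by (simp add: pos_less_divide_eq add_nonneg_pos)
        moreover have "s n \<le> s (n + k)" by (induction k) (use s_inc order_trans in auto)
        ultimately have "(s (n + k) - s n) * norm x < e" by (simp add: algebra_simps)
        then show ?thesis using tail[of n k x] by (simp add: dist_norm)
      qed
      show "\<exists>N. \<forall>m\<ge>N. \<forall>n\<ge>N. dist (S m x) (S n x) < e"
      proof (intro exI allI impI)
        fix m n assume "m \<ge> N" "n \<ge> N"
        then show "dist (S m x) (S n x) < e"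
          using *[of n "m - n"] *[of m "n - m"] by (cases "n \<le> m") (auto simp: dist_commute)
      qed
    qed
    then show ?thesis using Cauchy_convergent_iff by blast
  qed
  then obtain L where L: "\<And>x. (\<lambda>n. S n x) \<longlonglongrightarrow> L x" unfolding convergent_def by metis
  have normL: "norm (L x) \<le> norm x" for x
  proof (rule LIMSEQ_le_const2[OF tendsto_norm[OF L]])
    have "norm (S n x) \<le> norm x" for n
      using normS[of n x] s_range[of n] mult_right_mono[of "s n" 1 "norm x"] by auto
    then show "\<exists>N. \<forall>n\<ge>N. norm (S n x) \<le> norm x" by blast
  qed
  have normS1: "norm (S n x) \<le> norm x" for n x
    using normS[of n x] s_range[of n] mult_right_mono[of "s n" 1 "norm x"] by auto
  have addL: "L (x + y) = L x + L y" for x y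
    by (rule LIMSEQ_unique[OF L]) (simp add: linear_add[OF linS] tendsto_add L)
  have scaleL: "L (r *\<^sub>R x) = r *\<^sub>R L x" for r x
    by (rule LIMSEQ_unique[OF L]) (simp add: linear_scale[OF linS] tendsto_scaleR L)
  have blL: "bounded_linear L"
    by (rule bounded_linear_intro[where K = 1]) (simp_all add: addL scaleL normL)
  have symL: "L x \<bullet> y = x \<bullet> L y" for x y
    by (rule LIMSEQ_unique[OF tendsto_inner[OF L tendsto_const]])
      (simp add: symS tendsto_inner L)
  have LL: "2 *\<^sub>R L x = T x + L (L x)" for x
  proof -
    have "(\<lambda>n. S n (S n x - L x)) \<longlonglongrightarrow> 0"
    proof (rule Lim_null_comparison)
      show "eventually (\<lambda>n. norm (S n (S n x - L x)) \<le> norm (S n x - L x)) sequentially"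
        using normS1 by simp
      show "(\<lambda>n. norm (S n x - L x)) \<longlonglongrightarrow> 0"
        using L by (simp add: LIM_zero_iff tendsto_norm_zero_iff)
    qed
    then have "(\<lambda>n. S n (S n x - L x) + S n (L x)) \<longlonglongrightarrow> 0 + L (L x)"
      by (intro tendsto_add L)
    then have "(\<lambda>n. S n (S n x)) \<longlonglongrightarrow> L (L x)" by (simp add: S_diff)
    then have "(\<lambda>n. (1/2) *\<^sub>R (T x + S n (S n x))) \<longlonglongrightarrow> (1/2) *\<^sub>R (T x + L (L x))"
      by (intro tendsto_intros)
    then have "(\<lambda>n. S (Suc n) x) \<longlonglongrightarrow> (1/2) *\<^sub>R (T x + L (L x))" by (simp add: SS)
    then have "L x = (1/2) *\<^sub>R (T x + L (L x))" by (rule LIMSEQ_unique[OF LIMSEQ_Suc[OF L]])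
    then show ?thesis by (metis field_sum_of_halves scaleR_2 scaleR_half_double scaleR_right_distrib)
  qed
  define R where "R x = sqrt c *\<^sub>R (x - L x)" for x
  interpret L: bounded_linear L by (rule blL)
  have "bounded_linear R"
    unfolding R_def by (intro bounded_linear_sub bounded_linear_ident
        bounded_linear_compose[OF bounded_linear_scaleR_right] blL)
  moreover have "R x \<bullet> y = x \<bullet> R y" for x y
    by (simp add: R_def inner_diff_left inner_diff_right symL)
  moreover have "0 \<le> R x \<bullet> x" for x
  proof -
    have "L x \<bullet> x \<le> norm (L x) * norm x" by (rule norm_cauchy_schwarz)
    also have "\<dots> \<le> norm x * norm x" by (intro mult_right_mono normL) auto
    finally have "L x \<bullet> x \<le> x \<bullet> x"
      by (simp add: power2_norm_eq_inner[symmetric] power2_eq_square)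
    then show ?thesis using c(2) by (simp add: R_def inner_diff_left)
  qed
  moreover have "R (R x) = Q x" for x
  proof -
    have "R (R x) = (sqrt c * sqrt c) *\<^sub>R (x - 2 *\<^sub>R L x + L (L x))"
      by (simp add: R_def L.diff L.scaleR scaleR_2 algebra_simps)
    also have "\<dots> = c *\<^sub>R (x - T x)" using c(2) by (simp add: LL)
    also have "\<dots> = Q x" using c(2) by (simp add: T_def)
    finally show ?thesis .
  qed
  ultimately show ?thesis unfolding psd_operator_def by (intro exI[of _ R]) (auto simp: fun_eq_iff)
qed

lemma op_sqrt_works:
  fixes Q :: "'h::{real_inner, complete_space} \<Rightarrow> 'h"
  assumes "psd_operator Q"
  shows "psd_operator (op_sqrt Q)" "op_sqrt Q (op_sqrt Q x) = Q x"
proof -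
  have "psd_operator (op_sqrt Q) \<and> op_sqrt Q \<circ> op_sqrt Q = Q"
    unfolding op_sqrt_def by (rule someI_ex[OF psd_operator_square_root[OF assms]])
  then show "psd_operator (op_sqrt Q)" "op_sqrt Q (op_sqrt Q x) = Q x"
    by (auto simp: fun_eq_iff)
qed

lemma subspace_closure:
  fixes M :: "'a::real_normed_vector set"
  assumes "subspace M"
  shows "subspace (closure M)"
  unfolding subspace_def
proof (intro conjI ballI allI)
  show "0 \<in> closure M" using subspace_0[OF assms] closure_subset by blast
next
  fix x y assume "x \<in> closure M" "y \<in> closure M"
  then obtain u v where "\<And>n. u n \<in> M" "u \<longlonglongrightarrow> x" "\<And>n. v n \<in> M" "v \<longlonglongrightarrow> y"
    unfolding closure_sequential by blast
  then show "x + y \<in> closure M"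
    unfolding closure_sequential
    by (intro exI[of _ "\<lambda>n. u n + v n"]) (auto intro: tendsto_add subspace_add[OF assms])
next
  fix c :: real and x assume "x \<in> closure M"
  then obtain u where "\<And>n. u n \<in> M" "u \<longlonglongrightarrow> x" unfolding closure_sequential by blast
  then show "c *\<^sub>R x \<in> closure M"
    unfolding closure_sequential
    by (intro exI[of _ "\<lambda>n. c *\<^sub>R u n"])
      (auto intro: tendsto_scaleR tendsto_const subspace_scale[OF assms])
qed

text \<open>The component of a vector orthogonal to the range lies in the kernel.\<close>

lemma dense_range_injective_symmetric:
  fixes S :: "'h::{real_inner, complete_space} \<Rightarrow> 'h"
  assumes "bounded_linear S" and sym: "\<And>x y. S x \<bullet> y = x \<bullet> S y" and "inj S"
  shows "closure (range S) = UNIV"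
proof -
  interpret bounded_linear S by fact
  have "subspace (range S)"
    by (rule linear_subspace_image[OF linear_axioms subspace_UNIV])
  then have sub: "subspace (closure (range S))" by (rule subspace_closure)
  have "x \<in> closure (range S)" for x
  proof -
    obtain p where p: "p \<in> closure (range S)" "\<And>y. y \<in> closure (range S) \<Longrightarrow> (x - p) \<bullet> y = 0"
      by (rule projection_exists[OF closed_closure sub, of x]) (rule that)
    have "S (S (x - p)) \<in> closure (range S)" using closure_subset[of "range S"] by auto
    from p(2)[OF this] have "S (x - p) \<bullet> S (x - p) = 0" by (simp only: sym)
    then have "S (x - p) = S 0" by (simp add: zero)
    then have "x - p = 0" by (rule injD[OF \<open>inj S\<close>])
    then show ?thesis using p(1) by simp
  qed
  then show ?thesis by auto
qed

text \<open>A Hellinger-Toeplitz argument: \<open>A = inv S \<circ> R\<close> is defined everywhere and has the formal adjoint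
  \<open>S z \<mapsto> R z\<close> on the dense range of \<open>S\<close>. The image of the unit ball under the formal adjoint is weakly
  bounded because \<open>A\<close> is defined everywhere, so it is bounded, and this bound is one for \<open>A\<close>.\<close>

lemma bounded_linear_inv_comp:
  fixes S R :: "'h::{real_inner, complete_space} \<Rightarrow> 'h"
  assumes blS: "bounded_linear S" and symS: "\<And>x y. S x \<bullet> y = x \<bullet> S y" and injS: "inj S"
    and blR: "bounded_linear R" and symR: "\<And>x y. R x \<bullet> y = x \<bullet> R y"
    and range: "range R \<subseteq> range S"
  shows "bounded_linear (inv S \<circ> R)" and "S ((inv S \<circ> R) x) = R x"
proof -
  interpret S: bounded_linear S by fact
  interpret R: bounded_linear R by fact
  define A where "A = inv S \<circ> R"
  have SA: "S (A x) = R x" for x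
    unfolding A_def comp_apply using range by (intro f_inv_into_f) auto
  have dense: "closure (range S) = UNIV"
    using blS symS injS by (rule dense_range_injective_symmetric)
  have pair: "A x \<bullet> S z = x \<bullet> R z" for x z by (metis SA symS symR)
  have eqI: "a = b" if "S a = S b" for a b using injS that by (rule injD)
  have A_add: "A (x + y) = A x + A y" for x y
    by (rule eqI) (simp add: SA S.add R.add)
  have A_scale: "A (r *\<^sub>R x) = r *\<^sub>R A x" for r x
    by (rule eqI) (simp add: SA S.scaleR R.scaleR)
  have "\<exists>K. \<forall>a \<in> R ` {z. norm (S z) \<le> 1}. norm a \<le> K"
  proof (rule weakly_bounded_imp_bounded)
    fix x
    have "\<bar>x \<bullet> R z\<bar> \<le> norm (A x)" if "norm (S z) \<le> 1" for z
    proof -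
      have "\<bar>x \<bullet> R z\<bar> \<le> norm (A x) * norm (S z)"
        unfolding pair[symmetric] by (rule Cauchy_Schwarz_ineq2)
      also have "\<dots> \<le> norm (A x) * 1" using that by (intro mult_left_mono) auto
      finally show ?thesis by simp
    qed
    then show "\<exists>C. \<forall>a\<in>R ` {z. norm (S z) \<le> 1}. \<bar>x \<bullet> a\<bar> \<le> C"
      by (intro exI[of _ "norm (A x)"] ballI) (elim imageE, simp)
  qed
  then obtain K where "\<forall>a \<in> R ` {z. norm (S z) \<le> 1}. norm a \<le> K" by (rule exE)
  note K' = bspec[OF this]
  have K: "norm (R z) \<le> K" if "norm (S z) \<le> 1" for z
    by (rule K', rule imageI, rule CollectI, rule that)
  have K2: "norm (R z) \<le> K * norm (S z)" for z
  proof (cases "S z = 0")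
    case True
    then have "S z = S 0" by (simp add: S.zero)
    then have "z = 0" by (rule eqI)
    then show ?thesis by (simp add: R.zero S.zero)
  next
    case False
    have "norm (R ((1 / norm (S z)) *\<^sub>R z)) \<le> K"
      by (rule K) (use False in \<open>simp add: S.scaleR\<close>)
    then show ?thesis using False by (simp add: R.scaleR field_simps)
  qed
  have "norm (A x) \<le> norm x * K" for x
  proof (cases "A x = 0")
    case True
    have "0 \<le> K" using K[of 0] by (simp add: S.zero R.zero)
    then show ?thesis by (simp add: True)
  next
    case False
    have "A x \<in> closure (range S)" by (simp add: dense)
    then obtain u where u: "\<And>n. u n \<in> range S" "u \<longlonglongrightarrow> A x" unfolding closure_sequential by blast
    have "A x \<bullet> A x \<le> norm x * K * norm (A x)"
    proof (rule LIMSEQ_le)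
      show "(\<lambda>n. A x \<bullet> u n) \<longlonglongrightarrow> A x \<bullet> A x" by (intro tendsto_intros u)
      show "(\<lambda>n. norm x * K * norm (u n)) \<longlonglongrightarrow> norm x * K * norm (A x)"
        by (intro tendsto_intros u)
      have "A x \<bullet> u n \<le> norm x * K * norm (u n)" for n
      proof -
        obtain z where z: "u n = S z" using u(1) by blast
        have "A x \<bullet> u n \<le> norm x * norm (R z)" unfolding z pair by (rule norm_cauchy_schwarz)
        also have "\<dots> \<le> norm x * (K * norm (S z))" by (intro mult_left_mono K2) auto
        finally show ?thesis by (simp add: z mult_ac)
      qed
      then show "\<exists>N. \<forall>n\<ge>N. A x \<bullet> u n \<le> norm x * K * norm (u n)" by blast
    qed
    then show ?thesis
      using False by (simp add: power2_norm_eq_inner[symmetric] power2_eq_square)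
  qed
  then show "bounded_linear (inv S \<circ> R)"
    unfolding A_def[symmetric] by (intro bounded_linear_intro[where K = K]) (auto simp: A_add A_scale)
  show "S ((inv S \<circ> R) x) = R x" using SA unfolding A_def .
qed

text \<open>A maximal orthonormal set is total, since otherwise a unit vector orthogonal to it could be added.\<close>

lemma orthonormal_basis_exists: "\<exists>B :: 'h::{real_inner, complete_space} set. orthonormal_basis B"
proof -
  define \<A> where "\<A> = {B :: 'h set. pairwise orthogonal B \<and> (\<forall>e\<in>B. norm e = 1)}"
  have "\<exists>M\<in>\<A>. \<forall>X\<in>\<A>. M \<subseteq> X \<longrightarrow> X = M"
  proof (rule subset_Zorn_nonempty)
    have "{} \<in> \<A>" by (simp add: \<A>_def pairwise_def)
    then show "\<A> \<noteq> {}" by blast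
    fix \<C> assume ne: "\<C> \<noteq> {}" and ch: "subset.chain \<A> \<C>"
    have \<C>\<A>: "X \<in> \<A>" if "X \<in> \<C>" for X
      using ch that by (auto simp: subset_chain_def)
    have "pairwise orthogonal (\<Union>\<C>)"
    proof (rule pairwiseI)
      fix x y assume "x \<in> \<Union>\<C>" "y \<in> \<Union>\<C>" and xy: "x \<noteq> y"
      then obtain X Y where XY: "x \<in> X" "X \<in> \<C>" "y \<in> Y" "Y \<in> \<C>" by (elim UnionE)
      then have "X \<subseteq> Y \<or> Y \<subseteq> X" using ch by (simp add: subset_chain_def)
      then obtain Z where "Z \<in> \<C>" "x \<in> Z" "y \<in> Z" using XY by auto
      then show "orthogonal x y" using \<C>\<A>[of Z] xy by (simp add: \<A>_def pairwise_def)
    qed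
    moreover have "\<forall>e\<in>\<Union>\<C>. norm e = 1"
      using \<C>\<A> by (auto simp: \<A>_def)
    ultimately show "\<Union>\<C> \<in> \<A>" by (simp add: \<A>_def)
  qed
  then obtain M where M: "M \<in> \<A>" and max: "\<And>X. X \<in> \<A> \<Longrightarrow> M \<subseteq> X \<Longrightarrow> X = M" by auto
  have "x \<in> closure (span M)" for x
  proof (rule ccontr)
    assume x: "x \<notin> closure (span M)"
    obtain p where p: "p \<in> closure (span M)" "\<And>y. y \<in> closure (span M) \<Longrightarrow> (x - p) \<bullet> y = 0"
      by (rule projection_exists[OF closed_closure subspace_closure[OF subspace_span], of _ x])
        (rule that)
    define z where "z = x - p"
    have z0: "z \<noteq> 0" using p x by (auto simp: z_def)
    define e where "e = (1 / norm z) *\<^sub>R z"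
    have orth: "e \<bullet> y = 0" if "y \<in> M" for y
    proof -
      have "y \<in> closure (span M)" using that closure_subset span_superset by blast
      from p(2)[OF this] show ?thesis by (simp add: e_def z_def)
    qed
    have ne: "norm e = 1" using z0 by (simp add: e_def)
    have "insert e M \<in> \<A>"
      using M ne orth unfolding \<A>_def
      by (simp add: pairwise_insert orthogonal_def inner_commute[of _ e])
    then have "e \<in> M" using max by blast
    from orth[OF this] show False using ne by simp
  qed
  then have "closure (span M) = UNIV" by blast
  then show ?thesis
    using M by (intro exI[of _ M]) (simp add: orthonormal_basis_def \<A>_def)
qed

section \<open>Orthonormal systems and the Hilbert-Schmidt norm\<close>

lemma norm_sub_projection:
  fixes B :: "'a::real_inner set"
  assumes "finite B" "pairwise orthogonal B" "\<And>e. e \<in> B \<Longrightarrow> norm e = 1"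
  shows "(norm (x - (\<Sum>e\<in>B. (x \<bullet> e) *\<^sub>R e)))\<^sup>2 = (norm x)\<^sup>2 - (\<Sum>e\<in>B. (x \<bullet> e)\<^sup>2)"
    and "e \<in> B \<Longrightarrow> (x - (\<Sum>e\<in>B. (x \<bullet> e) *\<^sub>R e)) \<bullet> e = 0"
proof -
  let ?p = "\<Sum>e\<in>B. (x \<bullet> e) *\<^sub>R e"
  have pe: "?p \<bullet> e = x \<bullet> e" if "e \<in> B" for e
  proof -
    have "?p \<bullet> e = (\<Sum>i\<in>B. if i = e then x \<bullet> e else 0)"
      unfolding inner_sum_left
    proof (rule sum.cong)
      fix i assume i: "i \<in> B"
      have "i \<bullet> e = (if i = e then 1 else 0)"
        using assms(2,3) that i
        by (auto simp: pairwise_def orthogonal_def power2_norm_eq_inner[symmetric])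
      then show "(x \<bullet> i) *\<^sub>R i \<bullet> e = (if i = e then x \<bullet> e else 0)" by simp
    qed simp
    then show ?thesis using that assms(1) by simp
  qed
  then show "e \<in> B \<Longrightarrow> (x - ?p) \<bullet> e = 0" by (simp add: inner_diff_left)
  have xp: "x \<bullet> ?p = (\<Sum>e\<in>B. (x \<bullet> e)\<^sup>2)" by (simp add: inner_sum_right power2_eq_square)
  have pp: "?p \<bullet> ?p = (\<Sum>e\<in>B. (x \<bullet> e)\<^sup>2)"
    by (subst inner_sum_right) (simp add: pe power2_eq_square)
  show "(norm (x - ?p))\<^sup>2 = (norm x)\<^sup>2 - (\<Sum>e\<in>B. (x \<bullet> e)\<^sup>2)"
    unfolding power2_norm_eq_inner
    by (simp add: inner_diff_left inner_diff_right xp pp inner_commute[of ?p x])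
qed

lemma bessel_inequality:
  fixes B :: "'a::real_inner set"
  assumes "finite B" "pairwise orthogonal B" "\<And>e. e \<in> B \<Longrightarrow> norm e = 1"
  shows "(\<Sum>e\<in>B. (x \<bullet> e)\<^sup>2) \<le> (norm x)\<^sup>2"
  using norm_sub_projection(1)[OF assms, of x] by (metis diff_ge_0_iff_ge zero_le_power2)

text \<open>The nontrivial half of Parseval's identity, up to \<open>\<epsilon>\<^sup>2\<close> and with a finite part of the basis. That the
  bound persists for larger finite parts allows finitely many vectors to be treated at once.\<close>

lemma norm_le_coefficients:
  fixes B :: "'a::real_inner set"
  assumes B: "orthonormal_basis B" and "\<epsilon> > 0"
  obtains E where "finite E" "E \<subseteq> B"
    and "\<And>E'. finite E' \<Longrightarrow> E \<subseteq> E' \<Longrightarrow> E' \<subseteq> B \<Longrightarrow> (norm x)\<^sup>2 \<le> (\<Sum>e\<in>E'. (x \<bullet> e)\<^sup>2) + \<epsilon>\<^sup>2"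
proof -
  have "x \<in> closure (span B)" using B by (simp add: orthonormal_basis_def)
  then obtain z where z: "z \<in> span B" "dist z x < \<epsilon>"
    using \<open>\<epsilon> > 0\<close> by (auto simp: closure_approachable)
  then obtain E r where E: "finite E" "E \<subseteq> B" and zE: "z = (\<Sum>a\<in>E. r a *\<^sub>R a)"
    by (auto simp: span_explicit)
  have "(norm x)\<^sup>2 \<le> (\<Sum>e\<in>E'. (x \<bullet> e)\<^sup>2) + \<epsilon>\<^sup>2" if E': "finite E'" "E \<subseteq> E'" "E' \<subseteq> B" for E'
  proof -
    have on: "pairwise orthogonal E'" "\<And>e. e \<in> E' \<Longrightarrow> norm e = 1"
      using B E'(3) unfolding orthonormal_basis_def by (auto intro: pairwise_mono)
    let ?p = "\<Sum>e\<in>E'. (x \<bullet> e) *\<^sub>R e"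
    have sp: "?p - z \<in> span E'"
      unfolding zE using E'(2) by (intro span_diff span_sum span_scale span_base) auto
    have "orthogonal (x - ?p) (?p - z)"
      using norm_sub_projection(2)[OF E'(1) on]
      by (intro orthogonal_to_span[OF sp]) (simp add: orthogonal_def)
    from norm_add_Pythagorean[OF this]
    have "(norm (x - ?p))\<^sup>2 \<le> (norm (x - z))\<^sup>2" by simp
    also have "\<dots> \<le> \<epsilon>\<^sup>2" using z(2) by (intro power_mono) (auto simp: dist_norm norm_minus_commute)
    finally show ?thesis using norm_sub_projection(1)[OF E'(1) on, of x] by simp
  qed
  then show ?thesis using E that by blast
qed

text \<open>Here \<open>y w\<close> plays the role of \<open>D\<^sup>* w\<close>, so this says that the Hilbert-Schmidt norm of the adjoint is
  at most that of \<open>D\<close>. Expand each \<open>y w\<close> in the basis, exchange the two sums, and apply Bessel's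
  inequality to \<open>D e\<close> and the orthonormal system \<open>W\<close>.\<close>

lemma sum_norm_le_hs_norm_sq:
  fixes D :: "'h::{real_inner, complete_space} \<Rightarrow> 'h"
  assumes W: "finite W" "pairwise orthogonal W" "\<And>w. w \<in> W \<Longrightarrow> norm w = 1"
    and y: "\<And>w e. w \<in> W \<Longrightarrow> y w \<bullet> e = w \<bullet> D e"
  shows "ennreal (\<Sum>w\<in>W. (norm (y w))\<^sup>2) \<le> hs_norm_sq D"
proof -
  define B where "B = (SOME B :: 'h set. orthonormal_basis B)"
  have B: "orthonormal_basis B" unfolding B_def by (rule someI_ex[OF orthonormal_basis_exists])
  have hs: "hs_norm_sq D = (\<Sum>\<^sub>\<infinity>e\<in>B. ennreal ((norm (D e))\<^sup>2))"
    by (simp add: hs_norm_sq_def B_def)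
  show ?thesis
  proof (rule ennreal_le_epsilon)
    fix \<delta> :: real assume \<delta>: "\<delta> > 0"
    define \<epsilon> where "\<epsilon> = sqrt (\<delta> / (real (card W) + 1))"
    have \<epsilon>: "\<epsilon> > 0" "\<epsilon>\<^sup>2 = \<delta> / (real (card W) + 1)" using \<delta> by (simp_all add: \<epsilon>_def)
    have "\<exists>E. finite E \<and> E \<subseteq> B \<and> (\<forall>E'. finite E' \<longrightarrow> E \<subseteq> E' \<longrightarrow> E' \<subseteq> B \<longrightarrow>
        (norm (y w))\<^sup>2 \<le> (\<Sum>e\<in>E'. (y w \<bullet> e)\<^sup>2) + \<epsilon>\<^sup>2)" for w
      by (rule norm_le_coefficients[OF B \<epsilon>(1), of "y w"]) blast
    then obtain E where E: "\<And>w. finite (E w)" "\<And>w. E w \<subseteq> B"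
      and le: "\<And>w E'. finite E' \<Longrightarrow> E w \<subseteq> E' \<Longrightarrow> E' \<subseteq> B \<Longrightarrow>
        (norm (y w))\<^sup>2 \<le> (\<Sum>e\<in>E'. (y w \<bullet> e)\<^sup>2) + \<epsilon>\<^sup>2"
      by metis
    define F where "F = (\<Union>w\<in>W. E w)"
    have F: "finite F" "F \<subseteq> B" using E W(1) by (auto simp: F_def)
    have "(\<Sum>w\<in>W. (norm (y w))\<^sup>2) \<le> (\<Sum>w\<in>W. (\<Sum>e\<in>F. (y w \<bullet> e)\<^sup>2) + \<epsilon>\<^sup>2)"
      by (intro sum_mono le F) (auto simp: F_def)
    also have "\<dots> = (\<Sum>e\<in>F. \<Sum>w\<in>W. (D e \<bullet> w)\<^sup>2) + real (card W) * \<epsilon>\<^sup>2"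
      unfolding sum.distrib by (subst sum.swap) (simp add: y inner_commute[of "D _"])
    also have "\<dots> \<le> (\<Sum>e\<in>F. (norm (D e))\<^sup>2) + \<delta>"
    proof (rule add_mono)
      show "(\<Sum>e\<in>F. \<Sum>w\<in>W. (D e \<bullet> w)\<^sup>2) \<le> (\<Sum>e\<in>F. (norm (D e))\<^sup>2)"
        by (intro sum_mono bessel_inequality W)
      show "real (card W) * \<epsilon>\<^sup>2 \<le> \<delta>" using \<delta> by (simp add: \<epsilon>(2) field_simps)
    qed
    finally have "ennreal (\<Sum>w\<in>W. (norm (y w))\<^sup>2) \<le> ennreal ((\<Sum>e\<in>F. (norm (D e))\<^sup>2) + \<delta>)"
      by (rule ennreal_leI)
    also have "\<dots> = (\<Sum>e\<in>F. ennreal ((norm (D e))\<^sup>2)) + ennreal \<delta>"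
      using \<delta> by (simp add: sum_nonneg sum_ennreal)
    also have "(\<Sum>e\<in>F. ennreal ((norm (D e))\<^sup>2)) = (\<Sum>\<^sub>\<infinity>e\<in>F. ennreal ((norm (D e))\<^sup>2))"
      using F by simp
    also have "\<dots> \<le> hs_norm_sq D"
      unfolding hs using F
      by (intro infsum_mono_neutral) (auto intro: nonneg_summable_on_complete)
    finally show "ennreal (\<Sum>w\<in>W. (norm (y w))\<^sup>2) \<le> hs_norm_sq D + ennreal \<delta>"
      by (simp add: add_right_mono)
  qed
qed

text \<open>In terms of an orthonormal basis of the span, the unit sphere lies in the convex hull of the
  finitely many points \<open>\<plusminus> n e\<close>, which is compact even though balls of the ambient space need not be.\<close>

lemma compact_sphere_span:
  fixes S :: "'h::real_inner set"
  assumes "finite S"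
  shows "compact (sphere 0 1 \<inter> span S)"
proof -
  obtain C where C: "finite C" "span C = span S" "pairwise orthogonal C"
    using basis_orthogonal[OF assms] by metis
  define B where "B = (\<lambda>c. (1 / norm c) *\<^sub>R c) ` (C - {0})"
  have finB: "finite B" using C by (simp add: B_def)
  have nB: "norm e = 1" if "e \<in> B" for e
    using that by (auto simp: B_def split: if_splits)
  have oB: "pairwise orthogonal B"
    using C(3) by (auto simp: B_def pairwise_def orthogonal_def)
  have spB: "span B = span S"
  proof -
    have "B \<subseteq> span C" by (auto simp: B_def intro: span_scale span_base)
    moreover have "c \<in> span B" if "c \<in> C" for c
    proof (cases "c = 0")
      case False
      then have "norm c *\<^sub>R ((1 / norm c) *\<^sub>R c) \<in> span B"
        using that by (intro span_scale span_base) (auto simp: B_def)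
      then show ?thesis using False by simp
    qed (simp add: span_0)
    ultimately show ?thesis unfolding C(2)[symmetric] by (simp add: span_eq subset_iff)
  qed
  define n where "n = real (card B)"
  \<comment> \<open>A unit vector \<open>x\<close> is the average over \<open>e \<in> B\<close> of \<open>n (x \<bullet> e) e\<close>, and each of these points lies on
    the segment from \<open>0\<close> to \<open>\<plusminus> n e\<close>.\<close>
  define K where "K = insert 0 ((\<lambda>e. n *\<^sub>R e) ` B \<union> (\<lambda>e. (-n) *\<^sub>R e) ` B)"
  have cK: "compact (convex hull K)"
    by (rule finite_imp_compact_convex_hull) (simp add: K_def finB)
  have "K \<subseteq> span S"
    unfolding K_def spB[symmetric] by (auto intro: span_scale span_base span_0 span_neg)
  then have KS: "convex hull K \<subseteq> span S" by (intro hull_minimal) (simp_all add: subspace_imp_convex)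
  have "x \<in> convex hull K" if x: "x \<in> span S" "norm x = 1" for x
  proof -
    have ex: "(\<Sum>e\<in>B. (x \<bullet> e) *\<^sub>R e) = x"
      using x(1) spB by (intro orthonormal_basis_expand oB nB finB) auto
    have Bne: "B \<noteq> {}" using ex x(2) by auto
    then have n: "n > 0" using finB by (simp add: n_def card_gt_0_iff)
    have mem: "(n * (x \<bullet> e)) *\<^sub>R e \<in> convex hull K" if e: "e \<in> B" for e
    proof -
      have "\<bar>x \<bullet> e\<bar> \<le> norm x * norm e" by (rule Cauchy_Schwarz_ineq2)
      then have le: "\<bar>x \<bullet> e\<bar> \<le> 1" using x(2) nB[OF e] by simp
      define v where "v = (if x \<bullet> e \<ge> 0 then n *\<^sub>R e else (-n) *\<^sub>R e)"
      have "v \<in> convex hull K" using e by (intro hull_inc) (auto simp: v_def K_def)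
      moreover have "0 \<in> convex hull K" by (intro hull_inc) (simp add: K_def)
      ultimately have "\<bar>x \<bullet> e\<bar> *\<^sub>R v + (1 - \<bar>x \<bullet> e\<bar>) *\<^sub>R 0 \<in> convex hull K"
        using le by (intro convexD convex_convex_hull) auto
      moreover have "\<bar>x \<bullet> e\<bar> *\<^sub>R v = (n * (x \<bullet> e)) *\<^sub>R e" by (auto simp: v_def mult.commute)
      ultimately show ?thesis by simp
    qed
    have "(\<Sum>e\<in>B. (1 / n) *\<^sub>R ((n * (x \<bullet> e)) *\<^sub>R e)) \<in> convex hull K"
      using n by (intro convex_sum finB convex_convex_hull mem) (auto simp: n_def)
    then show ?thesis using ex n by simp
  qed
  then have "sphere 0 1 \<inter> span S = sphere 0 1 \<inter> convex hull K" using KS by auto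
  moreover have "closed (sphere (0::'h) 1)"
    by (simp add: sphere_def dist_norm closed_Collect_eq continuous_intros)
  ultimately show ?thesis using closed_Int_compact[OF _ cK] by simp
qed

text \<open>The spectral theorem for the compression of \<open>T\<close> to the span of \<open>S\<close>. Take an orthonormal system
  \<open>B\<close> of eigenvectors of the compression, in the weak form that \<open>T e\<close> is orthogonal to everything in
  the span that is orthogonal to \<open>e\<close>, with as many elements as possible. If it did not span, a
  maximiser of the quadratic form on the unit sphere of the remaining subspace would be a further
  such vector.\<close>

lemma orthonormal_diagonalisation:
  fixes T :: "'h::real_inner \<Rightarrow> 'h"
  assumes T: "bounded_linear T" and sym: "\<And>x y. T x \<bullet> y = x \<bullet> T y" and S: "finite S"
  obtains B where "finite B" "span B = span S" "pairwise orthogonal B"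
    "\<And>e. e \<in> B \<Longrightarrow> norm e = 1" "\<And>e e'. e \<in> B \<Longrightarrow> e' \<in> B \<Longrightarrow> e \<noteq> e' \<Longrightarrow> T e \<bullet> e' = 0"
proof -
  interpret T: bounded_linear T by fact
  define good where "good B \<longleftrightarrow> B \<subseteq> span S \<and> pairwise orthogonal B \<and> (\<forall>e\<in>B. norm e = 1) \<and>
     (\<forall>e\<in>B. \<forall>v\<in>span S. e \<bullet> v = 0 \<longrightarrow> T e \<bullet> v = 0)" for B
  have bound: "finite B \<and> card B \<le> card S" if "good B" for B
  proof (rule independent_span_bound[OF S])
    have "0 \<notin> B" using that by (auto simp: good_def)
    then show "independent B"
      using that by (intro pairwise_orthogonal_independent) (auto simp: good_def)
    show "B \<subseteq> span S" using that by (simp add: good_def)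
  qed
  have "good {}" by (simp add: good_def)
  then have "\<exists>B. good B \<and> (\<forall>B'. good B' \<longrightarrow> card B' \<le> card B)"
    using bound by (intro ex_has_greatest_nat[where b = "Suc (card S)"]) (auto simp: less_Suc_eq_le)
  then obtain B where B: "good B" and max: "\<And>B'. good B' \<Longrightarrow> card B' \<le> card B" by auto
  have finB: "finite B" using bound B by auto
  have BS: "B \<subseteq> span S" and oB: "pairwise orthogonal B" and nB: "\<And>e. e \<in> B \<Longrightarrow> norm e = 1"
    and eig: "\<And>e v. e \<in> B \<Longrightarrow> v \<in> span S \<Longrightarrow> e \<bullet> v = 0 \<Longrightarrow> T e \<bullet> v = 0"
    using B by (auto simp: good_def)
  have "span S \<subseteq> span B"
  proof (rule ccontr)
    assume "\<not> span S \<subseteq> span B"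
    then obtain x where x: "x \<in> span S" "x \<notin> span B" by auto
    define P where "P = (\<lambda>x. \<Sum>e\<in>B. (x \<bullet> e) *\<^sub>R e)"
    have P_span: "P v \<in> span B" for v
      unfolding P_def by (intro span_sum span_scale span_base)
    have P_S: "P v \<in> span S" for v
      using P_span[of v] span_mono[OF BS] by (auto simp: span_span)
    have P_orth: "e \<in> B \<Longrightarrow> (v - P v) \<bullet> e = 0" for v e
      unfolding P_def by (rule norm_sub_projection(2)[OF finB oB nB])
    define V where "V = span S \<inter> {v. \<forall>e\<in>B. v \<bullet> e = 0}"
    have subV: "subspace V"
      unfolding V_def by (intro subspace_inter subspace_span) (auto simp: subspace_def inner_add_left)
    define z where "z = x - P x"
    have zV: "z \<in> V" using x P_S P_orth by (auto simp: V_def z_def intro: span_diff)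
    have z0: "z \<noteq> 0"
    proof
      assume "z = 0"
      then have "x = P x" by (simp add: z_def)
      then show False using P_span[of x] x(2) by simp
    qed
    have "V \<inter> sphere 0 1 = (sphere 0 1 \<inter> span S) \<inter> (\<Inter>e\<in>B. {v. v \<bullet> e = 0})"
      by (auto simp: V_def)
    moreover have "closed (\<Inter>e\<in>B. {v. v \<bullet> e = 0})"
      by (intro closed_INT ballI closed_Collect_eq continuous_intros)
    ultimately have comp: "compact (V \<inter> sphere 0 1)"
      using compact_sphere_span[OF S] by (simp add: compact_Int_closed)
    have "(1 / norm z) *\<^sub>R z \<in> V \<inter> sphere 0 1"
      using zV z0 subspace_scale[OF subV] by simp
    then have "V \<inter> sphere 0 1 \<noteq> {}" by blast
    moreover have "continuous_on (V \<inter> sphere 0 1) (\<lambda>v. T v \<bullet> v)"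
      by (intro continuous_intros linear_continuous_on T)
    ultimately have "\<exists>w\<in>V \<inter> sphere 0 1. \<forall>v\<in>V \<inter> sphere 0 1. T v \<bullet> v \<le> T w \<bullet> w"
      by (rule continuous_attains_sup[OF comp])
    then obtain w where w: "w \<in> V" "norm w = 1"
      and wmax: "\<And>v. v \<in> V \<Longrightarrow> norm v = 1 \<Longrightarrow> T v \<bullet> v \<le> T w \<bullet> w"
      by auto
    have ww: "w \<bullet> w = 1" using w(2) by (simp add: power2_norm_eq_inner[symmetric])
    have wmax': "T v \<bullet> v \<le> (T w \<bullet> w) * (v \<bullet> v)" if "v \<in> V" for v
    proof (cases "v = 0")
      case False
      have "T ((1 / norm v) *\<^sub>R v) \<bullet> ((1 / norm v) *\<^sub>R v) \<le> T w \<bullet> w"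
        using False that by (intro wmax subspace_scale[OF subV]) auto
      then have "T v \<bullet> v / (norm v)\<^sup>2 \<le> T w \<bullet> w"
        by (simp add: T.scaleR power2_eq_square)
      then show ?thesis using False
        by (simp add: power2_norm_eq_inner[symmetric] pos_divide_le_eq)
    qed (simp add: T.zero)
    have stat: "T w \<bullet> v = 0" if v: "v \<in> V" "w \<bullet> v = 0" for v
    proof (rule linear_coeff_zero)
      fix t :: real
      have "w + t *\<^sub>R v \<in> V" using w v by (intro subspace_add subspace_scale subV)
      then have "T (w + t *\<^sub>R v) \<bullet> (w + t *\<^sub>R v) \<le>
          (T w \<bullet> w) * ((w + t *\<^sub>R v) \<bullet> (w + t *\<^sub>R v))" by (rule wmax')
      moreover have "T v \<bullet> w = T w \<bullet> v" using sym[of v w] by (simp add: inner_commute)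
      moreover have "v \<bullet> w = 0" using v(2) by (simp add: inner_commute)
      ultimately have "T w \<bullet> w + t * (T w \<bullet> v) + (t * (T w \<bullet> v) + t * (t * (T v \<bullet> v))) \<le>
          (T w \<bullet> w) * (1 + t * (t * (v \<bullet> v)))"
        by (simp add: T.add T.scaleR inner_add_left inner_add_right v(2) ww algebra_simps)
      then show "2 * t * (T w \<bullet> v) \<le> t\<^sup>2 * ((T w \<bullet> w) * (v \<bullet> v) - T v \<bullet> v)"
        by (simp add: power2_eq_square algebra_simps)
    qed
    have w_orth: "\<And>e. e \<in> B \<Longrightarrow> w \<bullet> e = 0" and wS: "w \<in> span S" using w by (auto simp: V_def)
    have wB: "w \<notin> B" using w_orth ww by force
    have "T w \<bullet> v = 0" if v: "v \<in> span S" "w \<bullet> v = 0" for v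
    proof -
      have "T w \<bullet> P v = (\<Sum>e\<in>B. (v \<bullet> e) * (T w \<bullet> e))" by (simp add: P_def inner_sum_right)
      also have "\<dots> = 0"
      proof (intro sum.neutral ballI)
        fix e assume e: "e \<in> B"
        have "T e \<bullet> w = 0" by (rule eig[OF e wS]) (simp add: inner_commute[of e w] w_orth[OF e])
        then have "T w \<bullet> e = 0" using sym[of w e] by (simp add: inner_commute)
        then show "(v \<bullet> e) * (T w \<bullet> e) = 0" by simp
      qed
      finally have 1: "T w \<bullet> P v = 0" .
      have "w \<bullet> P v = (\<Sum>e\<in>B. (v \<bullet> e) * (w \<bullet> e))" by (simp add: P_def inner_sum_right)
      also have "\<dots> = 0" by (intro sum.neutral) (simp add: w_orth)
      finally have "w \<bullet> (v - P v) = 0" using v by (simp add: inner_diff_right)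
      moreover have "v - P v \<in> V" using v P_S P_orth by (auto simp: V_def intro: span_diff)
      ultimately have "T w \<bullet> (v - P v) = 0" by (intro stat)
      then show ?thesis using 1 by (simp add: inner_diff_right)
    qed
    then have "good (insert w B)"
      using BS oB nB eig wS w(2) w_orth
      unfolding good_def by (auto simp: pairwise_insert orthogonal_def inner_commute)
    from max[OF this] show False using finB wB by simp
  qed
  moreover have "span B \<subseteq> span S" using span_mono[OF BS] by (simp add: span_span)
  ultimately have eq: "span B = span S" by auto
  have "T e \<bullet> e' = 0" if "e \<in> B" "e' \<in> B" "e \<noteq> e'" for e e'
    using that oB BS by (intro eig) (auto simp: pairwise_def orthogonal_def)
  from that[OF finB eq oB nB this] show ?thesis .
qed

section \<open>Joint laws determined by characteristic functions\<close>

lemma char_uminus: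
  assumes "real_distribution N"
  shows "char N (- s) = cnj (char N s)"
  unfolding char_def by (subst Bochner_Integration.integral_cnj[symmetric]) (simp add: exp_cnj)

context prob_space
begin

text \<open>Normalising the weight \<open>r\<close> turns this into the uniqueness of a law with given characteristic
  function.\<close>

lemma weighted_law_unique:
  fixes Y :: "'a \<Rightarrow> real" and r :: "'a \<Rightarrow> real"
  assumes Y[measurable]: "Y \<in> borel_measurable M" and r[measurable]: "r \<in> borel_measurable M"
    and r_range: "\<And>\<omega>. 0 \<le> r \<omega>" "\<And>\<omega>. r \<omega> \<le> C"
    and N: "real_distribution N"
    and eq: "\<And>s. (CLINT \<omega>|M. of_real (r \<omega>) * iexp (s * Y \<omega>)) = of_real m * char N s"
    and B[measurable]: "B \<in> sets borel"
  shows "(LINT \<omega>|M. r \<omega> * indicator B (Y \<omega>)) = m * measure N B"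
proof -
  interpret N: real_distribution N by fact
  have int_r: "integrable M r"
    using r_range by (intro integrable_const_bound[of _ C]) auto
  have m: "(LINT \<omega>|M. r \<omega>) = m"
  proof -
    have "(CLINT \<omega>|M. of_real (r \<omega>)) = of_real m" using eq[of 0] by (simp add: N.char_zero)
    then show ?thesis by (simp only: integral_complex_of_real of_real_eq_iff)
  qed
  have m0: "0 \<le> m" unfolding m[symmetric] using r_range by simp
  show ?thesis
  proof (cases "m = 0")
    case True
    then have "AE \<omega> in M. r \<omega> = 0"
      using m integral_nonneg_eq_0_iff_AE[OF int_r] r_range by simp
    then have "(LINT \<omega>|M. r \<omega> * indicator B (Y \<omega>)) = (LINT \<omega>|M. 0)"
      by (intro integral_cong_AE) auto
    then show ?thesis using True by simp
  next
    case False
    then have mpos: "m > 0" using m0 by simp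
    define D where "D = density M (\<lambda>\<omega>. ennreal (r \<omega> / m))"
    have "emeasure D (space D) = ennreal (LINT \<omega>|M. r \<omega> / m)"
      unfolding D_def using r_range mpos int_r
      by (subst emeasure_density) (auto simp: nn_integral_eq_integral cong: nn_integral_cong)
    also have "\<dots> = 1" using m mpos by simp
    finally interpret D: prob_space D by (rule prob_spaceI)
    have YD[measurable]: "Y \<in> borel_measurable D" by (simp add: D_def)
    have rd: "real_distribution (distr D borel Y)" by (rule D.real_distribution_distr) simp
    have "distr D borel Y = N"
    proof (rule Levy_uniqueness[OF rd N], rule ext)
      fix s
      have "char (distr D borel Y) s = (CLINT \<omega>|D. iexp (s * Y \<omega>))"
        unfolding char_def by (subst integral_distr) auto
      also have "\<dots> = (CLINT \<omega>|M. (r \<omega> / m) *\<^sub>R iexp (s * Y \<omega>))"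
        unfolding D_def using r_range mpos by (subst integral_density) auto
      also have "\<dots> = (CLINT \<omega>|M. (of_real (r \<omega>) * iexp (s * Y \<omega>)) / of_real m)"
        by (simp add: scaleR_conv_of_real)
      also have "\<dots> = (CLINT \<omega>|M. of_real (r \<omega>) * iexp (s * Y \<omega>)) / of_real m"
        by (rule integral_divide_zero)
      also have "\<dots> = char N s" unfolding eq using mpos by simp
      finally show "char (distr D borel Y) s = char N s" .
    qed
    then have "measure N B = measure D (Y -` B \<inter> space D)"
      using measure_distr[OF YD, of B] by simp
    also have "\<dots> = (LINT \<omega>|D. indicator (Y -` B \<inter> space D) \<omega>)" by simp
    also have "\<dots> = (LINT \<omega>|D. indicator B (Y \<omega>))"
      by (intro Bochner_Integration.integral_cong) (auto simp: indicator_def)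
    also have "\<dots> = (LINT \<omega>|M. (r \<omega> / m) *\<^sub>R indicator B (Y \<omega>))"
      unfolding D_def using r_range mpos by (subst integral_density) auto
    also have "\<dots> = (LINT \<omega>|M. r \<omega> * indicator B (Y \<omega>)) / m" by simp
    finally show ?thesis using mpos by simp
  qed
qed

text \<open>Uniqueness for the complex measure with density \<open>w\<close>, reduced to positive weights: \<open>1 + Re w\<close>
  and \<open>1 + Re (- \<i> w)\<close> are nonnegative, and the transform of the conjugate weight is obtained from
  \<open>char N (- s) = cnj (char N s)\<close>.\<close>

lemma complex_weighted_law_unique:
  fixes Y :: "'a \<Rightarrow> real" and w :: "'a \<Rightarrow> complex"
  assumes Y[measurable]: "Y \<in> borel_measurable M" and w[measurable]: "w \<in> borel_measurable M"
    and w_le: "\<And>\<omega>. norm (w \<omega>) \<le> 1"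
    and N: "real_distribution N"
    and eq1: "\<And>s. (CLINT \<omega>|M. iexp (s * Y \<omega>)) = char N s"
    and eq: "\<And>s. (CLINT \<omega>|M. w \<omega> * iexp (s * Y \<omega>)) = m * char N s"
    and B[measurable]: "B \<in> sets borel"
  shows "(CLINT \<omega>|M. w \<omega> * indicator B (Y \<omega>)) = m * measure N B"
proof -
  have key: "(LINT \<omega>|M. Re (v \<omega>) * indicator B (Y \<omega>)) = Re k * measure N B"
    if v[measurable]: "v \<in> borel_measurable M" and v_le: "\<And>\<omega>. norm (v \<omega>) \<le> 1"
      and eqv: "\<And>s. (CLINT \<omega>|M. v \<omega> * iexp (s * Y \<omega>)) = k * char N s" for v k
  proof -
    have re: "\<bar>Re (v \<omega>)\<bar> \<le> 1" for \<omega> using abs_Re_le_cmod[of "v \<omega>"] v_le[of \<omega>] by linarith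
    have int_v: "integrable M (\<lambda>\<omega>. v \<omega> * iexp (s * Y \<omega>))" for s
      using v_le by (intro integrable_const_bound[of _ 1]) (auto simp: norm_mult)
    have int_vc: "integrable M (\<lambda>\<omega>. cnj (v \<omega> * iexp (- s * Y \<omega>)))" for s
      by (rule integrable_cnj[OF int_v])
    have int_1: "integrable M (\<lambda>\<omega>. iexp (s * Y \<omega>))" for s
      by (intro integrable_const_bound[of _ 1]) auto
    have split: "of_real (1 + Re (v \<omega>)) * iexp (s * Y \<omega>) =
        iexp (s * Y \<omega>) + (v \<omega> * iexp (s * Y \<omega>) + cnj (v \<omega> * iexp (- s * Y \<omega>))) / 2" for s \<omega>
    proof -
      have "cnj (iexp (- s * Y \<omega>)) = iexp (s * Y \<omega>)" by (simp add: exp_cnj)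
      moreover have "of_real (Re (v \<omega>)) = (v \<omega> + cnj (v \<omega>)) / 2"
        by (simp add: complex_add_cnj)
      ultimately have "of_real (Re (v \<omega>)) * iexp (s * Y \<omega>) =
          (v \<omega> * iexp (s * Y \<omega>) + cnj (v \<omega> * iexp (- s * Y \<omega>))) / 2"
        by (simp only: complex_cnj_mult) (simp only: distrib_right times_divide_eq_left)
      then show ?thesis by (simp only: of_real_add of_real_1 distrib_right mult_1_left)
    qed
    have "(LINT \<omega>|M. (1 + Re (v \<omega>)) * indicator B (Y \<omega>)) = (1 + Re k) * measure N B"
    proof (rule weighted_law_unique[OF Y _ _ _ N _ B, where C = 2])
      fix s
      have "(CLINT \<omega>|M. of_real (1 + Re (v \<omega>)) * iexp (s * Y \<omega>)) =
          (CLINT \<omega>|M. iexp (s * Y \<omega>)) +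
          ((CLINT \<omega>|M. v \<omega> * iexp (s * Y \<omega>)) + (CLINT \<omega>|M. cnj (v \<omega> * iexp (- s * Y \<omega>)))) / 2"
        unfolding split using int_1 int_v int_vc by simp
      also have "(CLINT \<omega>|M. cnj (v \<omega> * iexp (- s * Y \<omega>))) = cnj (k * char N (- s))"
        using eqv[of "- s"] by (simp only: Bochner_Integration.integral_cnj)
      also have "\<dots> = cnj k * char N s" by (simp add: char_uminus[OF N])
      finally show "(CLINT \<omega>|M. of_real (1 + Re (v \<omega>)) * iexp (s * Y \<omega>)) = of_real (1 + Re k) * char N s"
        unfolding eq1 eqv
        by (simp only: distrib_right[symmetric] complex_add_cnj of_real_add of_real_1)
          (simp add: distrib_right)
    next
      show "0 \<le> 1 + Re (v \<omega>)" "1 + Re (v \<omega>) \<le> 2" for \<omega> using re[of \<omega>] by linarith+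
    qed simp
    moreover have "(LINT \<omega>|M. 1 * indicator B (Y \<omega>)) = 1 * measure N B"
      by (rule weighted_law_unique[OF Y _ _ _ N _ B, where C = 1])
        (use eq1 in simp_all)
    moreover have "integrable M (\<lambda>\<omega>. 1 * indicator B (Y \<omega>) :: real)"
      by (intro integrable_const_bound[of _ 1]) (auto simp: indicator_def)
    moreover have "integrable M (\<lambda>\<omega>. Re (v \<omega>) * indicator B (Y \<omega>))"
      using re by (intro integrable_const_bound[of _ 1]) (auto simp: indicator_def)
    ultimately show ?thesis by (simp add: distrib_right)
  qed
  have int: "integrable M (\<lambda>\<omega>. w \<omega> * indicator B (Y \<omega>))"
    using w_le by (intro integrable_const_bound[of _ 1]) (auto simp: norm_mult indicator_def)
  show ?thesis
  proof (rule complex_eqI)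
    have "Re (w \<omega> * indicator B (Y \<omega>)) = Re (w \<omega>) * indicator B (Y \<omega>)" for \<omega>
      by (simp add: indicator_def)
    then show "Re (CLINT \<omega>|M. w \<omega> * indicator B (Y \<omega>)) = Re (m * measure N B)"
      using key[OF w w_le eq] integral_Re[OF int] by simp
    have "(LINT \<omega>|M. Re (- \<i> * w \<omega>) * indicator B (Y \<omega>)) = Re (- \<i> * m) * measure N B"
    proof (rule key)
      have "(CLINT \<omega>|M. - \<i> * w \<omega> * iexp (s * Y \<omega>)) = - \<i> * (CLINT \<omega>|M. w \<omega> * iexp (s * Y \<omega>))" for s
        by (simp only: mult.assoc integral_mult_right_zero)
      then show "(CLINT \<omega>|M. - \<i> * w \<omega> * iexp (s * Y \<omega>)) = - \<i> * m * char N s" for s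
        by (simp only: eq mult.assoc)
    qed (simp_all add: norm_mult w_le)
    moreover have "Im (w \<omega> * indicator B (Y \<omega>)) = Re (- \<i> * w \<omega>) * indicator B (Y \<omega>)" for \<omega>
      by (simp add: indicator_def)
    ultimately show "Im (CLINT \<omega>|M. w \<omega> * indicator B (Y \<omega>)) = Im (m * measure N B)"
      using integral_Im[OF int] by simp
  qed
qed

text \<open>A joint characteristic function that factorises determines the joint law. The exponentials
  \<open>exp (\<i> c u Y u)\<close> are replaced by indicators \<open>Y u \<in> A u\<close> one coordinate after the other; each
  replacement is an application of one-dimensional uniqueness with the other factors as a
  complex weight.\<close>

lemma joint_law_eq_PiM:
  fixes Y :: "'i \<Rightarrow> 'a \<Rightarrow> real"
  assumes U: "finite U"
    and Y[measurable]: "\<And>u. u \<in> U \<Longrightarrow> Y u \<in> borel_measurable M"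
    and N: "\<And>u. real_distribution (N u)"
    and eq: "\<And>c. (CLINT \<omega>|M. iexp (\<Sum>u\<in>U. c u * Y u \<omega>)) = (\<Prod>u\<in>U. char (N u) (c u))"
  shows "distr M (PiM U (\<lambda>_. borel)) (\<lambda>\<omega>. \<lambda>u\<in>U. Y u \<omega>) = PiM U N"
proof -
  have N0: "char (N u) 0 = 1" for u
    using real_distribution.char_zero[OF N] by simp
  have claim: "(CLINT \<omega>|M. (\<Prod>u\<in>K. indicator (A u) (Y u \<omega>)) * iexp (\<Sum>u\<in>U - K. c u * Y u \<omega>)) =
      (\<Prod>u\<in>K. of_real (measure (N u) (A u))) * (\<Prod>u\<in>U - K. char (N u) (c u))"
    if "finite K" "K \<subseteq> U" "\<And>u. A u \<in> sets borel" for K A c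
    using that
  proof (induction K arbitrary: c rule: finite_induct)
    case empty
    then show ?case using eq by simp
  next
    case (insert k K)
    note A[measurable] = insert.prems(2)
    have kU: "k \<in> U" and KU: "K \<subseteq> U" and UK: "U - K = insert k (U - insert k K)"
      using insert by auto
    have fin: "finite (U - insert k K)" using U by simp
    have [measurable]: "u \<in> K \<Longrightarrow> Y u \<in> borel_measurable M" "u \<in> U - insert k K \<Longrightarrow> Y u \<in> borel_measurable M" for u
      using Y KU by auto
    define w where "w \<omega> = (\<Prod>u\<in>K. indicator (A u) (Y u \<omega>)) * iexp (\<Sum>u\<in>U - insert k K. c u * Y u \<omega>)" for \<omega>
    define m where "m = (\<Prod>u\<in>K. of_real (measure (N u) (A u))) * (\<Prod>u\<in>U - insert k K. char (N u) (c u))"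
    have "(CLINT \<omega>|M. w \<omega> * indicator (A k) (Y k \<omega>)) = m * measure (N k) (A k)"
    proof (rule complex_weighted_law_unique[OF Y[OF kU] _ _ N])
      show "w \<in> borel_measurable M" unfolding w_def by measurable
      show "norm (w \<omega>) \<le> 1" for \<omega>
        unfolding w_def norm_mult norm_exp_i_times prod_norm[symmetric]
        by (auto intro!: prod_le_1 simp: indicator_def)
      show "(CLINT \<omega>|M. iexp (s * Y k \<omega>)) = char (N k) s" for s
      proof -
        have "(\<Sum>u\<in>U. (if u = k then s else 0) * Y u \<omega>) = s * Y k \<omega>" for \<omega>
          using U kU by (simp add: if_distrib[of "\<lambda>x. x * _"] cong: if_cong)
        moreover have "(\<Prod>u\<in>U. char (N u) (if u = k then s else 0)) = char (N k) s"
        proof -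
          have "(\<Prod>u\<in>U. char (N u) (if u = k then s else 0)) = (\<Prod>u\<in>U. if u = k then char (N k) s else 1)"
            by (intro prod.cong) (auto simp: N0)
          then show ?thesis using U kU by simp
        qed
        ultimately show ?thesis using eq[of "\<lambda>u. if u = k then s else 0"] by simp
      qed
      show "(CLINT \<omega>|M. w \<omega> * iexp (s * Y k \<omega>)) = m * char (N k) s" for s
      proof -
        have 1: "(\<Sum>u\<in>U - K. (c(k := s)) u * Y u \<omega>) = s * Y k \<omega> + (\<Sum>u\<in>U - insert k K. c u * Y u \<omega>)" for \<omega>
          unfolding UK using fin by (auto intro!: sum.cong)
        have 2: "(\<Prod>u\<in>U - K. char (N u) ((c(k := s)) u)) = char (N k) s * (\<Prod>u\<in>U - insert k K. char (N u) (c u))"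
          unfolding UK using fin by (auto intro!: prod.cong)
        have "w \<omega> * iexp (s * Y k \<omega>) =
            (\<Prod>u\<in>K. indicator (A u) (Y u \<omega>)) * iexp (\<Sum>u\<in>U - K. (c(k := s)) u * Y u \<omega>)" for \<omega>
          unfolding 1 w_def by (simp add: exp_add distrib_left mult_ac)
        then show ?thesis
          using insert.IH[OF KU A, of "c(k := s)"] unfolding 2 m_def by (simp add: mult_ac)
      qed
    qed simp
    moreover have "w \<omega> * indicator (A k) (Y k \<omega>) =
       (\<Prod>u\<in>insert k K. indicator (A u) (Y u \<omega>)) * iexp (\<Sum>u\<in>U - insert k K. c u * Y u \<omega>)" for \<omega>
      unfolding w_def using insert.hyps by (simp add: mult_ac)
    ultimately show ?case using insert.hyps unfolding m_def by (simp add: mult_ac)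
  qed
  interpret P: product_prob_space N UNIV
    using N by (intro product_prob_spaceI) (auto simp: real_distribution_def)
  have setsN: "sets (N u) = sets borel" for u
    using N by (simp add: real_distribution_def real_distribution_axioms_def)
  have meas[measurable]: "(\<lambda>\<omega>. \<lambda>u\<in>U. Y u \<omega>) \<in> M \<rightarrow>\<^sub>M PiM U (\<lambda>_. borel)"
    by (intro measurable_restrict Y)
  show ?thesis
  proof (rule P.PiM_eqI[OF U])
    show "sets (distr M (PiM U (\<lambda>_. borel)) (\<lambda>\<omega>. \<lambda>u\<in>U. Y u \<omega>)) = sets (PiM U N)"
      by (simp cong: sets_PiM_cong add: setsN)
    fix A assume A: "\<And>u. u \<in> U \<Longrightarrow> A u \<in> sets (N u)"
    \<comment> \<open>The factors outside \<open>U\<close> are arbitrary and need not be measurable.\<close>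
    define A' where "A' u = (if u \<in> U then A u else {})" for u
    have A': "A' u \<in> sets borel" for u using A setsN by (auto simp: A'_def)
    let ?Z = "\<lambda>\<omega>. \<lambda>u\<in>U. Y u \<omega>"
    have rect: "Pi\<^sub>E U A' \<in> sets (PiM U (\<lambda>_. borel))" using A' U by (intro sets_PiM_I_finite) auto
    have eqA: "Pi\<^sub>E U A = Pi\<^sub>E U A'" by (intro PiE_cong) (simp add: A'_def)
    have "of_real (measure M (?Z -` Pi\<^sub>E U A' \<inter> space M)) =
        (CLINT \<omega>|M. of_real (indicator (?Z -` Pi\<^sub>E U A' \<inter> space M) \<omega>))"
      using measurable_sets[OF meas rect] by (subst integral_complex_of_real) simp
    also have "\<dots> = (CLINT \<omega>|M. (\<Prod>u\<in>U. indicator (A' u) (Y u \<omega>)))"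
    proof (intro Bochner_Integration.integral_cong refl)
      fix \<omega> assume "\<omega> \<in> space M"
      then show "complex_of_real (indicator (?Z -` Pi\<^sub>E U A' \<inter> space M) \<omega>) = (\<Prod>u\<in>U. indicator (A' u) (Y u \<omega>))"
        using U by (auto simp: indicator_def PiE_iff prod_zero_iff)
    qed
    also have "\<dots> = (CLINT \<omega>|M. (\<Prod>u\<in>U. indicator (A' u) (Y u \<omega>)) *
        iexp (\<Sum>u\<in>U - U. (\<lambda>_. 0) u * Y u \<omega>))"
      by simp
    also have "\<dots> = of_real (\<Prod>u\<in>U. measure (N u) (A' u))"
      by (subst claim[OF U subset_refl A']) simp
    finally have "measure M (?Z -` Pi\<^sub>E U A' \<inter> space M) = (\<Prod>u\<in>U. measure (N u) (A' u))"
      by (simp only: of_real_eq_iff)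
    then have "emeasure (distr M (PiM U (\<lambda>_. borel)) ?Z) (Pi\<^sub>E U A') = ennreal (\<Prod>u\<in>U. measure (N u) (A' u))"
      by (simp add: emeasure_distr[OF meas rect] emeasure_eq_measure)
    also have "\<dots> = (\<Prod>u\<in>U. emeasure (N u) (A' u))"
      by (subst prod_ennreal[symmetric]) (auto simp: P.M.emeasure_eq_measure)
    finally show "emeasure (distr M (PiM U (\<lambda>_. borel)) ?Z) (Pi\<^sub>E U A) = (\<Prod>u\<in>U. emeasure (N u) (A u))"
      unfolding eqA by (simp add: A'_def)
  qed
qed

end

section \<open>Cylindrical Gaussian processes\<close>

abbreviation normal_law :: "real \<Rightarrow> real measure" where
  "normal_law \<sigma> \<equiv> density lborel (\<lambda>x. ennreal (normal_density 0 \<sigma> x))"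

lemma real_distribution_normal_law: "0 < \<sigma> \<Longrightarrow> real_distribution (normal_law \<sigma>)"
  using prob_space_normal_density[of \<sigma> 0]
  by (simp add: real_distribution_def real_distribution_axioms_def)

lemma (in prob_space) normal_iexp_expectation:
  assumes \<sigma>: "0 < \<sigma>" and Y: "distributed M lborel Y (\<lambda>x. ennreal (normal_density 0 \<sigma> x))"
  shows "(CLINT \<omega>|M. iexp (t * Y \<omega>)) = of_real (exp (- (\<sigma> * t)\<^sup>2 / 2))"
proof -
  have Z: "distributed M lborel (\<lambda>\<omega>. Y \<omega> / \<sigma>) std_normal_density"
    using Y normal_standard_normal_convert[OF \<sigma>, of Y 0] by simp
  then have Zm[measurable]: "(\<lambda>\<omega>. Y \<omega> / \<sigma>) \<in> borel_measurable M"
    using distributed_measurable by fastforce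
  have "(CLINT \<omega>|M. iexp (t * Y \<omega>)) = (CLINT \<omega>|M. iexp ((\<sigma> * t) * (Y \<omega> / \<sigma>)))"
    using \<sigma> by simp
  also have "\<dots> = (CLINT x|distr M lborel (\<lambda>\<omega>. Y \<omega> / \<sigma>). iexp ((\<sigma> * t) * x))"
    by (subst integral_distr) auto
  also have "distr M lborel (\<lambda>\<omega>. Y \<omega> / \<sigma>) = std_normal_distribution"
    by (rule distributed_distr_eq_density[OF Z])
  also have "(CLINT x|std_normal_distribution. iexp ((\<sigma> * t) * x)) = char std_normal_distribution (\<sigma> * t)"
    by (simp add: char_def)
  finally show ?thesis by (simp add: char_std_normal_distribution)
qed

lemma char_normal_law:
  assumes \<sigma>: "0 < \<sigma>"
  shows "char (normal_law \<sigma>) t = of_real (exp (- (\<sigma> * t)\<^sup>2 / 2))"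
proof -
  interpret prob_space "normal_law \<sigma>" by (rule prob_space_normal_density[OF \<sigma>])
  have "distributed (normal_law \<sigma>) lborel (\<lambda>x. x) (\<lambda>x. ennreal (normal_density 0 \<sigma> x))"
    by (auto simp: distributed_def distr_id2)
  from normal_iexp_expectation[OF \<sigma> this, of t] show ?thesis by (simp add: char_def)
qed

text \<open>The formula for the characteristic function holds for point masses as well, which makes the two
  cases of \<open>centred_gaussian\<close> uniform.\<close>

lemma (in prob_space) centred_gaussian_moments:
  assumes "centred_gaussian M Y"
  shows "integrable M Y" "integrable M (\<lambda>\<omega>. (Y \<omega>)\<^sup>2)" "(LINT \<omega>|M. Y \<omega>) = 0"
    "(CLINT \<omega>|M. iexp (Y \<omega>)) = of_real (exp (- (LINT \<omega>|M. (Y \<omega>)\<^sup>2) / 2))"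
proof -
  have [measurable]: "Y \<in> borel_measurable M" using assms by (simp add: centred_gaussian_def)
  consider (normal) \<sigma> where "\<sigma> > 0" "distributed M lborel Y (\<lambda>x. ennreal (normal_density 0 \<sigma> x))"
    | (zero) "AE \<omega> in M. Y \<omega> = 0"
    using assms by (auto simp: centred_gaussian_def)
  then have "integrable M Y \<and> integrable M (\<lambda>\<omega>. (Y \<omega>)\<^sup>2) \<and> (LINT \<omega>|M. Y \<omega>) = 0 \<and>
    (CLINT \<omega>|M. iexp (Y \<omega>)) = of_real (exp (- (LINT \<omega>|M. (Y \<omega>)\<^sup>2) / 2))"
  proof cases
    case normal
    have int: "integrable M (\<lambda>\<omega>. (Y \<omega>) ^ k)" for k
      using integrable_normal_moment[OF normal(1), of 0 k]
      by (subst distributed_integrable[OF normal(2), symmetric]) simp_all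
    have E: "(LINT \<omega>|M. Y \<omega>) = 0" using normal_distributed_expectation[OF normal] .
    have V: "(LINT \<omega>|M. (Y \<omega>)\<^sup>2) = \<sigma>\<^sup>2"
      using normal_distributed_variance[OF normal] by (simp add: E)
    show ?thesis
      using int[of 1] int[of 2] E V normal_iexp_expectation[OF normal, of 1] by simp
  next
    case zero
    have "integrable M Y" "(LINT \<omega>|M. Y \<omega>) = 0"
      using zero by (auto intro: integral_eq_zero_AE simp: integrable_cong_AE[of Y M "\<lambda>_. 0"])
    moreover have "AE \<omega> in M. (Y \<omega>)\<^sup>2 = 0" using zero by auto
    then have "integrable M (\<lambda>\<omega>. (Y \<omega>)\<^sup>2)" "(LINT \<omega>|M. (Y \<omega>)\<^sup>2) = 0"
      by (auto intro: integral_eq_zero_AE simp: integrable_cong_AE[of "\<lambda>\<omega>. (Y \<omega>)\<^sup>2" M "\<lambda>_. 0"])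
    moreover have "(CLINT \<omega>|M. iexp (Y \<omega>)) = (CLINT \<omega>|M. 1)"
      using zero by (intro integral_cong_AE) auto
    ultimately show ?thesis by (simp add: prob_space)
  qed
  then show "integrable M Y" "integrable M (\<lambda>\<omega>. (Y \<omega>)\<^sup>2)" "(LINT \<omega>|M. Y \<omega>) = 0"
    "(CLINT \<omega>|M. iexp (Y \<omega>)) = of_real (exp (- (LINT \<omega>|M. (Y \<omega>)\<^sup>2) / 2))" by auto
qed

context
  fixes M :: "'w measure" and X :: "'h::real_inner \<Rightarrow> 'w \<Rightarrow> real" and Q :: "'h \<Rightarrow> 'h"
  assumes cyl: "cyl_gaussian M X Q"
begin

lemma cyl_gaussian_prob_space: "prob_space M"
  using cyl by (simp add: cyl_gaussian_def centred_gaussian_process_def)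

interpretation prob_space M by (rule cyl_gaussian_prob_space)

lemma cyl_gaussian_combination:
  "finite F \<Longrightarrow> centred_gaussian M (\<lambda>\<omega>. \<Sum>v\<in>F. c v * X v \<omega>)"
  using cyl by (simp add: cyl_gaussian_def centred_gaussian_process_def)

lemma cyl_gaussian_coordinate: "centred_gaussian M (X v)"
  using cyl_gaussian_combination[of "{v}" "\<lambda>_. 1"] by simp

lemma cyl_gaussian_measurable: "X v \<in> borel_measurable M"
  using cyl_gaussian_coordinate[of v] by (simp add: centred_gaussian_def)

lemma cyl_gaussian_product:
  "integrable M (\<lambda>\<omega>. X v \<omega> * X w \<omega>)" "(LINT \<omega>|M. X v \<omega> * X w \<omega>) = Q v \<bullet> w"
proof -
  note [measurable] = cyl_gaussian_measurable
  note mom = centred_gaussian_moments[OF cyl_gaussian_coordinate]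
  show "integrable M (\<lambda>\<omega>. X v \<omega> * X w \<omega>)"
  proof (rule Bochner_Integration.integrable_bound)
    show "integrable M (\<lambda>\<omega>. (X v \<omega>)\<^sup>2 + (X w \<omega>)\<^sup>2)" using mom by auto
    have "\<bar>a * b\<bar> \<le> a\<^sup>2 + b\<^sup>2" for a b :: real
    proof -
      have "0 \<le> (\<bar>a\<bar> - \<bar>b\<bar>)\<^sup>2 + a\<^sup>2 + b\<^sup>2" by simp
      then show ?thesis by (simp add: power2_diff abs_mult)
    qed
    then show "AE \<omega> in M. norm (X v \<omega> * X w \<omega>) \<le> norm ((X v \<omega>)\<^sup>2 + (X w \<omega>)\<^sup>2)" by simp
  qed simp
  have "covariance M (X v) (X w) = Q v \<bullet> w" using cyl by (simp add: cyl_gaussian_def)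
  then show "(LINT \<omega>|M. X v \<omega> * X w \<omega>) = Q v \<bullet> w" by (simp add: covariance_def mom)
qed

text \<open>The difference of the two sides has second moment zero, by bilinearity of the covariance.\<close>

lemma cyl_gaussian_linear:
  assumes "linear Q" and U: "finite U"
  shows "AE \<omega> in M. X (\<Sum>u\<in>U. a u *\<^sub>R u) \<omega> = (\<Sum>u\<in>U. a u * X u \<omega>)"
proof -
  interpret Q: linear Q by fact
  note [measurable] = cyl_gaussian_measurable
  define v where "v = (\<Sum>u\<in>U. a u *\<^sub>R u)"
  define d where "d \<omega> = (X v \<omega> - (\<Sum>u\<in>U. a u * X u \<omega>))\<^sup>2" for \<omega>
  have d: "d = (\<lambda>\<omega>. X v \<omega> * X v \<omega> - 2 * (\<Sum>u\<in>U. a u * (X v \<omega> * X u \<omega>)) +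
      (\<Sum>u\<in>U. \<Sum>u'\<in>U. (a u * a u') * (X u \<omega> * X u' \<omega>)))"
    unfolding d_def power2_diff
    by (simp add: fun_eq_iff power2_eq_square sum_product sum_distrib_left mult_ac)
  have int: "integrable M d"
    unfolding d using cyl_gaussian_product(1) by auto
  have "(LINT \<omega>|M. d \<omega>) = Q v \<bullet> v - 2 * (\<Sum>u\<in>U. a u * (Q v \<bullet> u)) +
      (\<Sum>u\<in>U. \<Sum>u'\<in>U. (a u * a u') * (Q u \<bullet> u'))"
    unfolding d using cyl_gaussian_product by simp
  also have "(\<Sum>u\<in>U. a u * (Q v \<bullet> u)) = Q v \<bullet> v"
    by (simp add: v_def inner_sum_right)
  also have "(\<Sum>u\<in>U. \<Sum>u'\<in>U. (a u * a u') * (Q u \<bullet> u')) = Q v \<bullet> v"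
    by (subst sum.swap)
      (simp add: v_def inner_sum_right inner_sum_left Q.sum Q.scale sum_distrib_left mult_ac)
  finally have "(LINT \<omega>|M. d \<omega>) = 0" by simp
  moreover have "AE \<omega> in M. 0 \<le> d \<omega>" by (simp add: d_def)
  ultimately have "AE \<omega> in M. d \<omega> = 0"
    using integral_nonneg_eq_0_iff_AE[OF int] by blast
  then show ?thesis by (auto simp: d_def v_def)
qed

lemma cyl_gaussian_joint_law:
  assumes U: "finite U" and orth: "\<And>u u'. u \<in> U \<Longrightarrow> u' \<in> U \<Longrightarrow> u \<noteq> u' \<Longrightarrow> Q u \<bullet> u' = 0"
    and \<sigma>: "\<And>u. 0 < \<sigma> u" "\<And>u. u \<in> U \<Longrightarrow> Q u \<bullet> u = (\<sigma> u)\<^sup>2"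
  shows "distr M (PiM U (\<lambda>_. borel)) (\<lambda>\<omega>. \<lambda>u\<in>U. X u \<omega>) = PiM U (\<lambda>u. normal_law (\<sigma> u))"
proof (rule joint_law_eq_PiM[OF U])
  show "X u \<in> borel_measurable M" for u by (rule cyl_gaussian_measurable)
  show "real_distribution (normal_law (\<sigma> u))" for u
    by (rule real_distribution_normal_law[OF \<sigma>(1)])
  fix c :: "'h \<Rightarrow> real"
  have "(LINT \<omega>|M. (\<Sum>u\<in>U. c u * X u \<omega>)\<^sup>2) =
      (LINT \<omega>|M. (\<Sum>u\<in>U. \<Sum>u'\<in>U. (c u * c u') * (X u \<omega> * X u' \<omega>)))"
    by (simp add: power2_eq_square sum_product mult_ac)
  also have "\<dots> = (\<Sum>u\<in>U. \<Sum>u'\<in>U. (c u * c u') * (Q u \<bullet> u'))"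
    using cyl_gaussian_product by simp
  also have "\<dots> = (\<Sum>u\<in>U. \<Sum>u'\<in>U. if u' = u then (\<sigma> u * c u)\<^sup>2 else 0)"
    by (intro sum.cong refl) (auto simp: orth \<sigma>(2) power2_eq_square)
  also have "\<dots> = (\<Sum>u\<in>U. (\<sigma> u * c u)\<^sup>2)" using U by simp
  finally have "(CLINT \<omega>|M. iexp (\<Sum>u\<in>U. c u * X u \<omega>)) = of_real (exp (\<Sum>u\<in>U. - (\<sigma> u * c u)\<^sup>2 / 2))"
    using centred_gaussian_moments(4)[OF cyl_gaussian_combination[OF U]]
    by (simp add: sum_negf sum_divide_distrib)
  then show "(CLINT \<omega>|M. iexp (\<Sum>u\<in>U. c u * X u \<omega>)) = (\<Prod>u\<in>U. char (normal_law (\<sigma> u)) (c u))"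
    using U by (simp add: exp_sum char_normal_law[OF \<sigma>(1)])
qed

end

section \<open>Comparison of laws by the symmetrised relative entropy\<close>

text \<open>The consequences of a bound \<open>J\<close> on the symmetrised relative entropy of two probability measures
  that survive a passage to the limit. The first inequality bounds the Hellinger distance: the
  supremum of the left-hand side over \<open>g\<close> is its square, approached as \<open>g\<close> tends to
  \<open>sqrt (dP' / dP)\<close>. The second is a quantitative form of mutual absolute
  continuity.\<close>

definition jeffreys_close :: "real \<Rightarrow> 'a measure \<Rightarrow> 'a measure \<Rightarrow> bool" where
  "jeffreys_close J P P' \<longleftrightarrow>
     (\<forall>g a. g \<in> borel_measurable P \<longrightarrow> 0 < a \<longrightarrow> (\<forall>x. a \<le> g x \<and> g x \<le> 1 / a) \<longrightarrow>
        2 - (LINT x|P. g x) - (LINT x|P'. 1 / g x) \<le> J / 2) \<and>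
     (\<forall>C K. C \<in> sets P \<longrightarrow> 1 \<le> K \<longrightarrow>
        measure P' C \<le> exp K * measure P C + 2 * J / K \<and>
        measure P C \<le> exp K * measure P' C + 2 * J / K)"

lemma jeffreys_close_test:
  assumes "jeffreys_close J P P'" "g \<in> borel_measurable P" "0 < a" "\<And>x. a \<le> g x \<and> g x \<le> 1 / a"
  shows "2 - (LINT x|P. g x) - (LINT x|P'. 1 / g x) \<le> J / 2"
  using assms unfolding jeffreys_close_def by blast

text \<open>Pointwise \<open>g + exp L / g \<ge> 2 exp (L / 2) \<ge> 2 + L\<close>.\<close>

lemma expectation_log_likelihood_le:
  fixes L g :: "'a \<Rightarrow> real"
  assumes P: "prob_space P" and P': "prob_space (density P (\<lambda>x. ennreal (exp (L x))))"
    and L: "integrable P L"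
    and g[measurable]: "g \<in> borel_measurable P" and a: "0 < a" "\<And>x. a \<le> g x" "\<And>x. g x \<le> 1 / a"
  shows "2 + (LINT x|P. L x) \<le>
    (LINT x|P. g x) + (LINT x|density P (\<lambda>x. ennreal (exp (L x))). 1 / g x)"
proof -
  interpret P: prob_space P by fact
  let ?D = "density P (\<lambda>x. ennreal (exp (L x)))"
  interpret P': prob_space ?D by fact
  have [measurable]: "L \<in> borel_measurable P" using L by simp
  have gpos: "0 < g x" for x using a(1) a(2)[of x] by linarith
  have inv: "1 / g x \<le> 1 / a" for x using a gpos[of x] by (simp add: frac_le)
  have int_g: "integrable P g"
    using a gpos by (intro P.integrable_const_bound[of _ "1 / a"]) (auto simp: less_imp_le)
  have int_i: "integrable ?D (\<lambda>x. 1 / g x)"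
    using inv gpos by (intro P'.integrable_const_bound[of _ "1 / a"]) (auto simp: less_imp_le)
  have eq: "(LINT x|?D. 1 / g x) = (LINT x|P. exp (L x) / g x)"
    by (subst integral_density) auto
  have int_e: "integrable P (\<lambda>x. exp (L x) / g x)"
    using int_i by (subst (asm) integrable_density) auto
  have "2 + (LINT x|P. L x) = (LINT x|P. 2 + L x)"
    using L by (simp add: P.prob_space)
  also have "\<dots> \<le> (LINT x|P. g x + exp (L x) / g x)"
  proof (rule integral_mono)
    fix x
    have "0 \<le> (sqrt (g x) - exp (L x / 2) / sqrt (g x))\<^sup>2" by simp
    also have "\<dots> = g x + exp (L x) / g x - 2 * exp (L x / 2)"
      using gpos[of x]
      by (simp add: power2_diff power_divide real_sqrt_pow2 less_imp_le exp_double[symmetric])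
    finally have "2 * exp (L x / 2) \<le> g x + exp (L x) / g x" by simp
    moreover have "1 + L x / 2 \<le> exp (L x / 2)" by (rule exp_ge_add_one_self)
    ultimately show "2 + L x \<le> g x + exp (L x) / g x" by linarith
  qed (use L int_g int_e in auto)
  also have "\<dots> = (LINT x|P. g x) + (LINT x|?D. 1 / g x)"
    unfolding eq using int_g int_e by simp
  finally show ?thesis .
qed

text \<open>The integrand \<open>(exp L - 1) L\<close> of the symmetrised entropy is nonnegative, and where \<open>L > K\<close> it
  is at least \<open>K exp L / 2\<close>. This controls the part of \<open>C\<close> on which the density exceeds \<open>exp K\<close>.\<close>

lemma density_exp_le:
  fixes L :: "'a \<Rightarrow> real"
  assumes P: "prob_space P" and P': "prob_space (density P (\<lambda>x. ennreal (exp (L x))))"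
    and L: "integrable P L" "integrable (density P (\<lambda>x. ennreal (exp (L x)))) L"
    and J: "(LINT x|density P (\<lambda>x. ennreal (exp (L x))). L x) - (LINT x|P. L x) \<le> J"
    and C[measurable]: "C \<in> sets P" and K: "1 \<le> K"
  shows "measure (density P (\<lambda>x. ennreal (exp (L x)))) C \<le> exp K * measure P C + 2 * J / K"
proof -
  interpret P: prob_space P by fact
  let ?D = "density P (\<lambda>x. ennreal (exp (L x)))"
  interpret P': prob_space ?D by fact
  have [measurable]: "L \<in> borel_measurable P" using L by simp
  have int_eL: "integrable P (\<lambda>x. exp (L x) * L x)"
    using L(2) by (subst (asm) integrable_density) auto
  have eL: "(LINT x|?D. L x) = (LINT x|P. exp (L x) * L x)"
    by (subst integral_density) auto
  have "integrable ?D (indicator C :: 'a \<Rightarrow> real)"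
    by (intro P'.integrable_const_bound[of _ 1]) (auto simp: indicator_def)
  then have int_C: "integrable P (\<lambda>x. exp (L x) * indicator C x)"
    by (subst (asm) integrable_density) auto
  have "measure ?D C = (LINT x|?D. indicator C x)" by simp
  also have "\<dots> = (LINT x|P. exp (L x) * indicator C x)" by (subst integral_density) auto
  also have "\<dots> \<le> (LINT x|P. exp K * indicator C x + 2 / K * (exp (L x) * L x - L x))"
  proof (rule integral_mono)
    show "integrable P (\<lambda>x. exp K * indicator C x + 2 / K * (exp (L x) * L x - L x))"
      using L(1) int_eL by (auto simp: less_top[symmetric])
    fix x
    have nonneg: "0 \<le> exp (L x) * L x - L x"
    proof (cases "0 \<le> L x")
      case True
      then have "1 * L x \<le> exp (L x) * L x" by (intro mult_right_mono) auto
      then show ?thesis by simp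
    next
      case False
      then have "1 * L x \<le> exp (L x) * L x" by (intro mult_right_mono_neg) auto
      then show ?thesis by simp
    qed
    show "exp (L x) * indicator C x \<le> exp K * indicator C x + 2 / K * (exp (L x) * L x - L x)"
    proof (cases "L x \<le> K")
      case True
      then show ?thesis using nonneg K by (intro add_increasing2) (auto simp: indicator_def)
    next
      case False
      have "2 \<le> exp (L x)" using exp_ge_add_one_self[of "L x"] False K by linarith
      then have "exp (L x) / 2 * K \<le> (exp (L x) - 1) * L x"
        using False K by (intro mult_mono) auto
      then have "exp (L x) \<le> 2 / K * (exp (L x) * L x - L x)"
        using K by (simp add: field_simps)
      moreover have "0 \<le> 2 / K * (exp (L x) * L x - L x)"
        using nonneg K by (intro mult_nonneg_nonneg) auto
      ultimately show ?thesis by (cases "x \<in> C") (simp_all only: indicator_simps, simp_all add: add_increasing)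
    qed
  qed (rule int_C)
  also have "\<dots> = exp K * measure P C + 2 / K * ((LINT x|?D. L x) - (LINT x|P. L x))"
    unfolding eL using L(1) int_eL by (simp add: less_top[symmetric])
  also have "\<dots> \<le> exp K * measure P C + 2 / K * J"
    using J K by (intro add_left_mono mult_left_mono) auto
  finally show ?thesis by simp
qed

text \<open>The bound on test functions uses the inequality for the pair \<open>(P, P')\<close> with \<open>L\<close>, \<open>g\<close> and for
  the pair \<open>(P', P)\<close> with \<open>- L\<close>, \<open>1 / g\<close>; adding the two produces the difference of the two
  expectations of \<open>L\<close>.\<close>

lemma jeffreys_close_likelihood:
  fixes L :: "'a \<Rightarrow> real"
  assumes P: "prob_space P" and P': "prob_space P'"
    and L: "P' = density P (\<lambda>x. ennreal (exp (L x)))" "integrable P L" "integrable P' L"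
    and J: "(LINT x|P'. L x) - (LINT x|P. L x) \<le> J"
  shows "jeffreys_close J P P'"
proof -
  have [measurable]: "L \<in> borel_measurable P" using L by simp
  have sets: "sets P' = sets P" using L by simp
  have P_eq: "P = density P' (\<lambda>x. ennreal (exp (- L x)))"
  proof -
    have "density P' (\<lambda>x. ennreal (exp (- L x))) = density P (\<lambda>x. 1)"
      unfolding L(1) by (subst density_density_eq)
        (auto intro!: density_cong simp: ennreal_mult'[symmetric] exp_minus_inverse)
    then show ?thesis by (simp add: density_1)
  qed
  have Lm: "integrable P' (\<lambda>x. - L x)" "integrable P (\<lambda>x. - L x)"
    and Jm: "(LINT x|P. - L x) - (LINT x|P'. - L x) \<le> J" using L J by auto
  have "2 - (LINT x|P. g x) - (LINT x|P'. 1 / g x) \<le> J / 2"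
    if g: "g \<in> borel_measurable P" and a: "0 < a" "\<And>x. a \<le> g x \<and> g x \<le> 1 / a" for g a
  proof -
    have gpos: "0 < g x" for x using a(1) a(2)[of x] by linarith
    have "2 + (LINT x|P. L x) \<le> (LINT x|P. g x) + (LINT x|P'. 1 / g x)"
      unfolding L(1) using a P' by (intro expectation_log_likelihood_le[OF P _ L(2) g a(1)]) (auto simp: L(1))
    moreover have "2 + (LINT x|P'. - L x) \<le> (LINT x|P'. 1 / g x) +
        (LINT x|density P' (\<lambda>x. ennreal (exp (- L x))). 1 / (1 / g x))"
    proof (rule expectation_log_likelihood_le[OF P' _ Lm(1) _ a(1)])
      show "prob_space (density P' (\<lambda>x. ennreal (exp (- L x))))" using P P_eq by simp
      show "(\<lambda>x. 1 / g x) \<in> borel_measurable P'"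
        using g by (simp add: measurable_cong_sets[OF sets refl])
      show "a \<le> 1 / g x" "1 / g x \<le> 1 / a" for x
        using a(1) a(2)[of x] gpos[of x] by (auto simp: field_simps)
    qed
    then have "2 - (LINT x|P'. L x) \<le> (LINT x|P'. 1 / g x) + (LINT x|P. g x)"
      unfolding P_eq[symmetric] by simp
    ultimately show ?thesis using J by linarith
  qed
  moreover have "measure P' C \<le> exp K * measure P C + 2 * J / K"
    if "C \<in> sets P" "1 \<le> K" for C K
    using density_exp_le[OF P _ L(2) _ _ that, of J] P' L J by simp
  moreover have "measure P C \<le> exp K * measure P' C + 2 * J / K"
    if "C \<in> sets P" "1 \<le> K" for C K
    using density_exp_le[OF P' _ Lm(1), of J C K] P Lm Jm that by (simp add: P_eq[symmetric] sets)
  ultimately show ?thesis unfolding jeffreys_close_def by auto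
qed

lemma jeffreys_close_distr:
  assumes close: "jeffreys_close J P P'" and sets: "sets P' = sets P" and f: "f \<in> P \<rightarrow>\<^sub>M N"
  shows "jeffreys_close J (distr P N f) (distr P' N f)"
proof -
  have f': "f \<in> P' \<rightarrow>\<^sub>M N" using f by (simp add: measurable_cong_sets[OF sets refl])
  have "2 - (LINT x|distr P N f. g x) - (LINT x|distr P' N f. 1 / g x) \<le> J / 2"
    if g: "g \<in> borel_measurable N" and a: "0 < a" "\<And>x. a \<le> g x \<and> g x \<le> 1 / a" for g :: "'b \<Rightarrow> real" and a
  proof -
    have "2 - (LINT x|P. g (f x)) - (LINT x|P'. 1 / g (f x)) \<le> J / 2"
      using close measurable_compose[OF f g] a unfolding jeffreys_close_def by auto
    then show ?thesis using g by (simp add: integral_distr[OF f] integral_distr[OF f'])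
  qed
  moreover have "measure (distr P' N f) C \<le> exp K * measure (distr P N f) C + 2 * J / K \<and>
      measure (distr P N f) C \<le> exp K * measure (distr P' N f) C + 2 * J / K"
    if "C \<in> sets N" "1 \<le> K" for C K
  proof -
    have "f -` C \<inter> space P \<in> sets P" using f that(1) by (rule measurable_sets)
    moreover have "space P' = space P" using sets by (rule sets_eq_imp_space_eq)
    ultimately show ?thesis
      using close that unfolding jeffreys_close_def by (simp add: measure_distr[OF f] measure_distr[OF f'])
  qed
  ultimately show ?thesis unfolding jeffreys_close_def by simp
qed

lemma PiM_density_eq:
  fixes N :: "'i \<Rightarrow> 'a measure"
  assumes U: "finite U" and N: "\<And>u. prob_space (N u)" and N': "\<And>u. prob_space (density (N u) (f u))"
    and f[measurable]: "\<And>u. f u \<in> borel_measurable (N u)"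
  shows "PiM U (\<lambda>u. density (N u) (f u)) = density (PiM U N) (\<lambda>y. \<Prod>u\<in>U. f u (y u))"
proof -
  interpret P: product_prob_space N UNIV using N by (rule product_prob_spaceI)
  interpret P': product_prob_space "\<lambda>u. density (N u) (f u)" UNIV using N' by (rule product_prob_spaceI)
  show ?thesis
  proof (rule P'.PiM_eqI[OF U, symmetric])
    show "sets (density (PiM U N) (\<lambda>y. \<Prod>u\<in>U. f u (y u))) = sets (PiM U (\<lambda>u. density (N u) (f u)))"
      by (simp cong: sets_PiM_cong)
    fix A assume "\<And>u. u \<in> U \<Longrightarrow> A u \<in> sets (density (N u) (f u))"
    then have A[measurable]: "\<And>u. u \<in> U \<Longrightarrow> A u \<in> sets (N u)" by simp
    have fm: "u \<in> U \<Longrightarrow> (\<lambda>y. f u (y u)) \<in> borel_measurable (PiM U N)" for u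
      by measurable
    have "emeasure (density (PiM U N) (\<lambda>y. \<Prod>u\<in>U. f u (y u))) (Pi\<^sub>E U A) =
        (\<integral>\<^sup>+y. (\<Prod>u\<in>U. f u (y u)) * indicator (Pi\<^sub>E U A) y \<partial>PiM U N)"
      using U fm by (intro emeasure_density sets_PiM_I_finite A) auto
    also have "\<dots> = (\<integral>\<^sup>+y. (\<Prod>u\<in>U. f u (y u) * indicator (A u) (y u)) \<partial>PiM U N)"
    proof (rule nn_integral_cong)
      fix y assume "y \<in> space (PiM U N)"
      then have "(indicator (Pi\<^sub>E U A) y :: ennreal) = (\<Prod>u\<in>U. indicator (A u) (y u))"
        using U by (auto simp: indicator_def PiE_iff space_PiM prod_zero_iff)
      then show "(\<Prod>u\<in>U. f u (y u)) * indicator (Pi\<^sub>E U A) y = (\<Prod>u\<in>U. f u (y u) * indicator (A u) (y u))"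
        by (simp add: prod.distrib)
    qed
    also have "\<dots> = (\<Prod>u\<in>U. \<integral>\<^sup>+x. f u x * indicator (A u) x \<partial>N u)"
      by (intro P.product_nn_integral_prod[OF U]) measurable
    also have "\<dots> = (\<Prod>u\<in>U. emeasure (density (N u) (f u)) (A u))"
      by (intro prod.cong refl) (simp add: emeasure_density)
    finally show "emeasure (density (PiM U N) (\<lambda>y. \<Prod>u\<in>U. f u (y u))) (Pi\<^sub>E U A) =
        (\<Prod>u\<in>U. emeasure (density (N u) (f u)) (A u))" .
  qed
qed

text \<open>The exponent is the log likelihood ratio of the centred normal laws with variances \<open>\<sigma>\<^sup>2\<close> and \<open>1\<close>.\<close>

lemma normal_law_likelihood:
  assumes "0 < \<sigma>"
  shows "normal_law \<sigma> = density (normal_law 1) (\<lambda>x. ennreal (exp (x\<^sup>2 / 2 - x\<^sup>2 / (2 * \<sigma>\<^sup>2) - ln \<sigma>)))"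
proof -
  have "normal_density 0 \<sigma> x = normal_density 0 1 x * exp (x\<^sup>2 / 2 - x\<^sup>2 / (2 * \<sigma>\<^sup>2) - ln \<sigma>)" for x
  proof -
    have "exp (- x\<^sup>2 / 2) * exp (x\<^sup>2 / 2 - x\<^sup>2 / (2 * \<sigma>\<^sup>2) - ln \<sigma>) = exp (- x\<^sup>2 / (2 * \<sigma>\<^sup>2) - ln \<sigma>)"
      by (simp add: exp_add[symmetric])
    also have "\<dots> = exp (- x\<^sup>2 / (2 * \<sigma>\<^sup>2)) / \<sigma>" using assms by (simp add: exp_diff)
    finally show ?thesis
      using assms by (simp add: normal_density_def real_sqrt_mult mult.assoc)
  qed
  then show ?thesis
    by (subst density_density_eq) (auto intro!: density_cong simp: ennreal_mult'[symmetric])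
qed

section \<open>Approximation by cylinder sets and cylinder functions\<close>

definition cylinder :: "('i \<Rightarrow> real) set \<Rightarrow> bool" where
  "cylinder E \<longleftrightarrow> (\<exists>F C. finite F \<and> C \<in> sets (PiM F (\<lambda>_. borel)) \<and> E = (\<lambda>x. restrict x F) -` C)"

lemma space_PiM_UNIV_borel [simp]: "space (PiM UNIV (\<lambda>_. borel :: real measure)) = UNIV"
  by (simp add: space_PiM)

lemma restrict_measurable_PiM [measurable]:
  "(\<lambda>x. restrict x F) \<in> PiM UNIV (\<lambda>_. borel :: real measure) \<rightarrow>\<^sub>M PiM F (\<lambda>_. borel)"
  by (rule measurable_restrict_subset) simp

lemma cylinder_sets: "cylinder E \<Longrightarrow> E \<in> sets (PiM UNIV (\<lambda>_. borel))"
  unfolding cylinder_def using measurable_sets[OF restrict_measurable_PiM] by fastforce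

lemma cylinder_extend:
  assumes "C \<in> sets (PiM F (\<lambda>_. borel :: real measure))" "F \<subseteq> F'"
  obtains C' where "C' \<in> sets (PiM F' (\<lambda>_. borel))"
    "(\<lambda>x. restrict x F') -` C' = (\<lambda>x. restrict x F) -` C"
proof
  let ?C' = "(\<lambda>y. restrict y F) -` C \<inter> space (PiM F' (\<lambda>_. borel :: real measure))"
  show "?C' \<in> sets (PiM F' (\<lambda>_. borel))"
    using measurable_sets[OF measurable_restrict_subset[OF assms(2)] assms(1)] .
  have "restrict (restrict x F') F = restrict x F" for x :: "'a \<Rightarrow> real"
    using assms(2) by (simp add: restrict_restrict Int_absorb1)
  then show "(\<lambda>x. restrict x F') -` ?C' = (\<lambda>x. restrict x F) -` C"
    by (auto simp: space_PiM)
qed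

lemma cylinder_empty: "cylinder {}"
  unfolding cylinder_def by (intro exI[of _ "{}"]) auto

lemma cylinder_Compl: "cylinder E \<Longrightarrow> cylinder (- E)"
proof -
  assume "cylinder E"
  then obtain F C where F: "finite F" "C \<in> sets (PiM F (\<lambda>_. borel))" "E = (\<lambda>x. restrict x F) -` C"
    by (auto simp: cylinder_def)
  then have "- E = (\<lambda>x. restrict x F) -` (space (PiM F (\<lambda>_. borel)) - C)"
    by (auto simp: space_PiM)
  then show ?thesis using F unfolding cylinder_def by blast
qed

lemma cylinder_Un:
  assumes "cylinder E" "cylinder E'"
  shows "cylinder (E \<union> E')"
proof -
  obtain F C where F: "finite F" "C \<in> sets (PiM F (\<lambda>_. borel))" "E = (\<lambda>x. restrict x F) -` C"
    using assms(1) by (auto simp: cylinder_def)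
  obtain F' C' where F': "finite F'" "C' \<in> sets (PiM F' (\<lambda>_. borel))" "E' = (\<lambda>x. restrict x F') -` C'"
    using assms(2) by (auto simp: cylinder_def)
  obtain D where D: "D \<in> sets (PiM (F \<union> F') (\<lambda>_. borel))" "(\<lambda>x. restrict x (F \<union> F')) -` D = E"
    using cylinder_extend[OF F(2), of "F \<union> F'"] F(3) by auto
  obtain D' where D': "D' \<in> sets (PiM (F \<union> F') (\<lambda>_. borel))" "(\<lambda>x. restrict x (F \<union> F')) -` D' = E'"
    using cylinder_extend[OF F'(2), of "F \<union> F'"] F'(3) by auto
  have "D \<union> D' \<in> sets (PiM (F \<union> F') (\<lambda>_. borel))" using D D' by auto
  moreover have "E \<union> E' = (\<lambda>x. restrict x (F \<union> F')) -` (D \<union> D')" using D D' by auto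
  ultimately show ?thesis unfolding cylinder_def using F(1) F'(1) by blast
qed

lemma cylinder_UN:
  fixes E :: "nat \<Rightarrow> ('i \<Rightarrow> real) set"
  assumes "\<And>i. cylinder (E i)"
  shows "cylinder (\<Union>i<n. E i)"
  by (induction n) (auto simp: cylinder_empty lessThan_Suc intro: cylinder_Un assms)

lemma measure_sym_diff_sum_bound:
  assumes "finite_measure \<mu>" "\<And>i::nat. A i \<in> sets \<mu>" "\<And>i. E i \<in> sets \<mu>"
  shows "measure \<mu> (sym_diff (\<Union>i<n. A i) (\<Union>i<n. E i)) \<le> (\<Sum>i<n. measure \<mu> (sym_diff (A i) (E i)))"
proof -
  interpret finite_measure \<mu> by fact
  have "measure \<mu> (sym_diff (\<Union>i<n. A i) (\<Union>i<n. E i)) \<le> measure \<mu> (\<Union>i<n. sym_diff (A i) (E i))"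
    using assms by (intro finite_measure_mono) auto
  also have "\<dots> \<le> (\<Sum>i<n. measure \<mu> (sym_diff (A i) (E i)))"
    using assms by (intro finite_measure_subadditive_finite) auto
  finally show ?thesis .
qed

text \<open>The sets that can be approximated in measure by cylinders form a \<open>\<sigma>\<close>-algebra.\<close>

lemma cylinder_approximation:
  fixes \<mu> :: "('i \<Rightarrow> real) measure"
  assumes fin: "finite_measure \<mu>" and sets: "sets \<mu> = sets (PiM UNIV (\<lambda>_. borel))"
    and A: "A \<in> sets \<mu>"
  shows "\<forall>\<epsilon>>0. \<exists>E. cylinder E \<and> measure \<mu> (sym_diff A E) < \<epsilon>"
proof -
  interpret finite_measure \<mu> by fact
  have space: "space \<mu> = UNIV" using sets_eq_imp_space_eq[OF sets] by simp
  have cyl: "cylinder E \<Longrightarrow> E \<in> sets \<mu>" for E using cylinder_sets sets by auto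
  have sets': "sets \<mu> = sigma_sets (\<Pi>\<^sub>E i\<in>UNIV. space borel) (prod_algebra UNIV (\<lambda>_. borel :: real measure))"
    by (simp add: sets sets_PiM)
  from A[unfolded this] show ?thesis
  proof (induction rule: sigma_sets.induct)
    case (Basic a)
    then obtain J X where J: "finite J" "a = prod_emb UNIV (\<lambda>_. borel) J (\<Pi>\<^sub>E j\<in>J. X j)"
        "\<And>j. j \<in> J \<Longrightarrow> X j \<in> sets (borel :: real measure)"
      by (elim prod_algebraE) auto
    have "a = (\<lambda>x. restrict x J) -` (\<Pi>\<^sub>E j\<in>J. X j)" unfolding J(2) by (auto simp: prod_emb_def)
    then have "cylinder a"
      unfolding cylinder_def using J by (intro exI conjI[OF J(1)] conjI) (auto intro: sets_PiM_I_finite)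
    then show ?case by (intro allI impI exI[of _ a]) simp
  next
    case Empty
    then show ?case by (intro allI impI exI[of _ "{}"]) (simp add: cylinder_empty)
  next
    case (Compl a)
    show ?case
    proof (intro allI impI)
      fix \<epsilon> :: real assume "\<epsilon> > 0"
      then obtain E where E: "cylinder E" "measure \<mu> (sym_diff a E) < \<epsilon>" using Compl.IH by blast
      have "sym_diff ((\<Pi>\<^sub>E i\<in>UNIV. space (borel :: real measure)) - a) (- E) = sym_diff a E" by auto
      then show "\<exists>E. cylinder E \<and> measure \<mu> (sym_diff ((\<Pi>\<^sub>E i\<in>UNIV. space borel) - a) E) < \<epsilon>"
        using E cylinder_Compl by (intro exI[of _ "- E"]) auto
    qed
  next
    case (Union a)
    have am: "a i \<in> sets \<mu>" for i using Union.hyps sets' by simp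
    show ?case
    proof (intro allI impI)
      fix \<epsilon> :: real assume e: "\<epsilon> > 0"
      have "(\<lambda>n. measure \<mu> (\<Union>i<n. a i)) \<longlonglongrightarrow> measure \<mu> (\<Union>n. \<Union>i<n. a i)"
        using am by (intro finite_Lim_measure_incseq incseq_SucI) (auto simp: less_Suc_eq)
      moreover have "(\<Union>n. \<Union>i<n. a i) = (\<Union>i. a i)" by auto
      ultimately have "(\<lambda>n. measure \<mu> (\<Union>i<n. a i)) \<longlonglongrightarrow> measure \<mu> (\<Union>i. a i)" by simp
      then have "eventually (\<lambda>n. measure \<mu> (\<Union>i. a i) - \<epsilon> / 2 < measure \<mu> (\<Union>i<n. a i)) sequentially"
        using e by (intro order_tendstoD(1)) auto
      then obtain n where n: "measure \<mu> (\<Union>i. a i) - \<epsilon> / 2 < measure \<mu> (\<Union>i<n. a i)"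
        by (auto simp: eventually_sequentially)
      \<comment> \<open>Half of \<open>\<epsilon>\<close> is spent on the tail of the union, the rest on the first \<open>n\<close> sets.\<close>
      have "\<epsilon> / (2 * (real n + 1)) > 0" using e by simp
      then have "\<forall>i. \<exists>E. cylinder E \<and> measure \<mu> (sym_diff (a i) E) < \<epsilon> / (2 * (real n + 1))"
        using Union.IH by blast
      then obtain E where E: "\<And>i. cylinder (E i)"
        "\<And>i. measure \<mu> (sym_diff (a i) (E i)) < \<epsilon> / (2 * (real n + 1))"
        by metis
      have Em: "E i \<in> sets \<mu>" for i using E cyl by blast
      have "measure \<mu> (sym_diff (\<Union>i. a i) (\<Union>i<n. E i)) \<le>
          measure \<mu> (((\<Union>i. a i) - (\<Union>i<n. a i)) \<union> sym_diff (\<Union>i<n. a i) (\<Union>i<n. E i))"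
        using am Em by (intro finite_measure_mono) auto
      also have "\<dots> \<le> measure \<mu> ((\<Union>i. a i) - (\<Union>i<n. a i)) +
          measure \<mu> (sym_diff (\<Union>i<n. a i) (\<Union>i<n. E i))"
        using am Em by (intro measure_Un_le) auto
      also have "measure \<mu> ((\<Union>i. a i) - (\<Union>i<n. a i)) = measure \<mu> (\<Union>i. a i) - measure \<mu> (\<Union>i<n. a i)"
        using am by (intro finite_measure_Diff) auto
      also have "measure \<mu> (sym_diff (\<Union>i<n. a i) (\<Union>i<n. E i)) \<le> (\<Sum>i<n. measure \<mu> (sym_diff (a i) (E i)))"
        by (rule measure_sym_diff_sum_bound[OF fin am Em])
      also have "(\<Sum>i<n. measure \<mu> (sym_diff (a i) (E i))) \<le> (\<Sum>i<n. \<epsilon> / (2 * (real n + 1)))"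
        using E(2) by (intro sum_mono) (simp add: less_imp_le)
      also have "\<dots> \<le> \<epsilon> / 2" using e by (simp add: field_simps)
      finally have "measure \<mu> (sym_diff (\<Union>i. a i) (\<Union>i<n. E i)) < \<epsilon>" using n by linarith
      then show "\<exists>E. cylinder E \<and> measure \<mu> (sym_diff (\<Union>i. a i) E) < \<epsilon>"
        using cylinder_UN[of E n] E(1) by blast
    qed
  qed
qed

text \<open>Density of cylinder functions in \<open>L\<^sup>1\<close>: indicators are covered by the approximation of sets, and
  the approximable functions are closed under sums and dominated limits.\<close>

lemma cylinder_function_approximation:
  fixes \<mu> :: "('i \<Rightarrow> real) measure" and f :: "('i \<Rightarrow> real) \<Rightarrow> real"
  assumes fin: "finite_measure \<mu>" and sets: "sets \<mu> = sets (PiM UNIV (\<lambda>_. borel))"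
    and f: "integrable \<mu> f"
  shows "\<forall>\<epsilon>>0. \<exists>F h. finite F \<and> h \<in> borel_measurable (PiM F (\<lambda>_. borel)) \<and>
    integrable \<mu> (\<lambda>x. h (restrict x F)) \<and> (LINT x|\<mu>. \<bar>f x - h (restrict x F)\<bar>) < \<epsilon>"
  using f
proof (induction rule: integrable_induct)
  interpret finite_measure \<mu> by fact
  have R[measurable]: "(\<lambda>x. restrict x F) \<in> \<mu> \<rightarrow>\<^sub>M PiM F (\<lambda>_. borel :: real measure)" for F
    using restrict_measurable_PiM by (simp add: measurable_cong_sets[OF sets refl])
  {
    case (base A c)
    show ?case
    proof (intro allI impI)
      fix \<epsilon> :: real assume e: "\<epsilon> > 0"
      have "\<epsilon> / (\<bar>c\<bar> + 1) > 0" using e by simp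
      then obtain E where E: "cylinder E" "measure \<mu> (sym_diff A E) < \<epsilon> / (\<bar>c\<bar> + 1)"
        using cylinder_approximation[OF fin sets base(1)] by blast
      obtain F C where F: "finite F" and C[measurable]: "C \<in> sets (PiM F (\<lambda>_. borel))"
        and EC: "E = (\<lambda>x. restrict x F) -` C" using E(1) by (auto simp: cylinder_def)
      have Em[measurable]: "E \<in> sets \<mu>" using cylinder_sets[OF E(1)] sets by simp
      note [measurable] = base(1)
      define h where "h y = indicator C y * c" for y
      have hm: "h \<in> borel_measurable (PiM F (\<lambda>_. borel))" unfolding h_def by measurable
      have hE: "h (restrict x F) = indicator E x * c" for x by (simp add: h_def EC indicator_def)
      have hi: "integrable \<mu> (\<lambda>x. h (restrict x F))" unfolding hE by (simp add: less_top[symmetric])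
      have "(LINT x|\<mu>. \<bar>indicator A x *\<^sub>R c - h (restrict x F)\<bar>) = (LINT x|\<mu>. indicator (sym_diff A E) x * \<bar>c\<bar>)"
        unfolding hE by (intro Bochner_Integration.integral_cong) (auto simp: indicator_def)
      also have "\<dots> = measure \<mu> (sym_diff A E) * \<bar>c\<bar>" by simp
      also have "\<dots> \<le> \<epsilon> / (\<bar>c\<bar> + 1) * \<bar>c\<bar>" using E(2) by (intro mult_right_mono) auto
      also have "\<dots> < \<epsilon>" using e by (simp add: field_simps)
      finally show "\<exists>F h. finite F \<and> h \<in> borel_measurable (PiM F (\<lambda>_. borel)) \<and>
          integrable \<mu> (\<lambda>x. h (restrict x F)) \<and> (LINT x|\<mu>. \<bar>indicator A x *\<^sub>R c - h (restrict x F)\<bar>) < \<epsilon>"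
        using F hm hi by blast
    qed
  next
    case (add f g)
    show ?case
    proof (intro allI impI)
      fix \<epsilon> :: real assume e: "\<epsilon> > 0"
      then have e2: "\<epsilon> / 2 > 0" by simp
      obtain F h where F: "finite F" and h[measurable]: "h \<in> borel_measurable (PiM F (\<lambda>_. borel))"
        and hi: "integrable \<mu> (\<lambda>x. h (restrict x F))" and hl: "(LINT x|\<mu>. \<bar>f x - h (restrict x F)\<bar>) < \<epsilon> / 2"
        using add.IH(1) e2 by blast
      obtain F' h' where F': "finite F'" and h'[measurable]: "h' \<in> borel_measurable (PiM F' (\<lambda>_. borel))"
        and hi': "integrable \<mu> (\<lambda>x. h' (restrict x F'))" and hl': "(LINT x|\<mu>. \<bar>g x - h' (restrict x F')\<bar>) < \<epsilon> / 2"
        using add.IH(2) e2 by blast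
      define k where "k y = h (restrict y F) + h' (restrict y F')" for y
      have rm[measurable]: "(\<lambda>y. restrict y F) \<in> PiM (F \<union> F') (\<lambda>_. borel :: real measure) \<rightarrow>\<^sub>M PiM F (\<lambda>_. borel)"
        "(\<lambda>y. restrict y F') \<in> PiM (F \<union> F') (\<lambda>_. borel :: real measure) \<rightarrow>\<^sub>M PiM F' (\<lambda>_. borel)"
        by (auto intro!: measurable_restrict_subset)
      have km: "k \<in> borel_measurable (PiM (F \<union> F') (\<lambda>_. borel))" unfolding k_def by measurable
      have kr: "k (restrict x (F \<union> F')) = h (restrict x F) + h' (restrict x F')" for x
        by (simp add: k_def restrict_restrict Int_absorb1)
      have ki: "integrable \<mu> (\<lambda>x. k (restrict x (F \<union> F')))" unfolding kr using hi hi' by simp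
      have "(LINT x|\<mu>. \<bar>(f x + g x) - k (restrict x (F \<union> F'))\<bar>) \<le>
          (LINT x|\<mu>. \<bar>f x - h (restrict x F)\<bar> + \<bar>g x - h' (restrict x F')\<bar>)"
        unfolding kr using add.hyps hi hi' by (intro integral_mono) auto
      also have "\<dots> = (LINT x|\<mu>. \<bar>f x - h (restrict x F)\<bar>) + (LINT x|\<mu>. \<bar>g x - h' (restrict x F')\<bar>)"
        using add.hyps hi hi' by (intro Bochner_Integration.integral_add) auto
      finally have "(LINT x|\<mu>. \<bar>(f x + g x) - k (restrict x (F \<union> F'))\<bar>) < \<epsilon>" using hl hl' by linarith
      then show "\<exists>F h. finite F \<and> h \<in> borel_measurable (PiM F (\<lambda>_. borel)) \<and>
          integrable \<mu> (\<lambda>x. h (restrict x F)) \<and> (LINT x|\<mu>. \<bar>f x + g x - h (restrict x F)\<bar>) < \<epsilon>"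
        using F F' km ki by (intro exI[of _ "F \<union> F'"] exI[of _ k]) simp
    qed
  next
    case (lim f s)
    show ?case
    proof (intro allI impI)
      fix \<epsilon> :: real assume e: "\<epsilon> > 0"
      then have e2: "\<epsilon> / 2 > 0" by simp
      have "(\<lambda>i. LINT x|\<mu>. \<bar>f x - s i x\<bar>) \<longlonglongrightarrow> (LINT x|\<mu>. 0)"
      proof (rule integral_dominated_convergence[where w = "\<lambda>x. 3 * \<bar>f x\<bar>"])
        show "(\<lambda>x. \<bar>f x - s i x\<bar>) \<in> borel_measurable \<mu>" for i using lim.hyps(1,4) by simp
        show "integrable \<mu> (\<lambda>x. 3 * \<bar>f x\<bar>)" using lim.hyps(4) by simp
        show "AE x in \<mu>. (\<lambda>i. \<bar>f x - s i x\<bar>) \<longlonglongrightarrow> 0"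
        proof (rule AE_I2)
          fix x assume "x \<in> space \<mu>"
          then have "(\<lambda>i. f x - s i x) \<longlonglongrightarrow> f x - f x" by (intro tendsto_intros lim.hyps(2))
          then show "(\<lambda>i. \<bar>f x - s i x\<bar>) \<longlonglongrightarrow> 0" by (simp add: tendsto_rabs_zero)
        qed
        show "AE x in \<mu>. norm \<bar>f x - s i x\<bar> \<le> 3 * \<bar>f x\<bar>" for i
        proof (rule AE_I2)
          fix x assume "x \<in> space \<mu>"
          then show "norm \<bar>f x - s i x\<bar> \<le> 3 * \<bar>f x\<bar>" using lim.hyps(3)[of x i] by (simp add: abs_if split: if_splits)
        qed
      qed simp
      then have "eventually (\<lambda>i. (LINT x|\<mu>. \<bar>f x - s i x\<bar>) < \<epsilon> / 2) sequentially"
        using e2 by (intro order_tendstoD(2)) auto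
      then obtain i where i: "(LINT x|\<mu>. \<bar>f x - s i x\<bar>) < \<epsilon> / 2" by (auto simp: eventually_sequentially)
      obtain F h where F: "finite F" and h[measurable]: "h \<in> borel_measurable (PiM F (\<lambda>_. borel))"
        and hi: "integrable \<mu> (\<lambda>x. h (restrict x F))" and hl: "(LINT x|\<mu>. \<bar>s i x - h (restrict x F)\<bar>) < \<epsilon> / 2"
        using lim.IH[of i] e2 by blast
      have "(LINT x|\<mu>. \<bar>f x - h (restrict x F)\<bar>) \<le> (LINT x|\<mu>. \<bar>f x - s i x\<bar> + \<bar>s i x - h (restrict x F)\<bar>)"
        using lim.hyps(1,4) hi by (intro integral_mono) auto
      also have "\<dots> = (LINT x|\<mu>. \<bar>f x - s i x\<bar>) + (LINT x|\<mu>. \<bar>s i x - h (restrict x F)\<bar>)"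
        using lim.hyps(1,4) hi by (intro Bochner_Integration.integral_add) auto
      finally have "(LINT x|\<mu>. \<bar>f x - h (restrict x F)\<bar>) < \<epsilon>" using i hl by linarith
      then show "\<exists>F h. finite F \<and> h \<in> borel_measurable (PiM F (\<lambda>_. borel)) \<and>
          integrable \<mu> (\<lambda>x. h (restrict x F)) \<and> (LINT x|\<mu>. \<bar>f x - h (restrict x F)\<bar>) < \<epsilon>"
        using F h hi by blast
    qed
  }
qed

section \<open>From finite marginals to laws on the product space\<close>

lemma sets_sum_of_measures [simp]: "sets (sum_of_measures P P') = sets P"
  and space_sum_of_measures [simp]: "space (sum_of_measures P P') = space P"
  by (simp_all add: sum_of_measures_def sets.sigma_sets_eq sets.space_closed)

lemma emeasure_sum_of_measures:
  assumes sets: "sets P' = sets P" and A: "A \<in> sets P"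
  shows "emeasure (sum_of_measures P P') A = emeasure P A + emeasure P' A"
proof (rule emeasure_measure_of[OF sum_of_measures_def sets.space_closed])
  show "A \<in> sets (sum_of_measures P P')" using A by simp
  show "positive (sets (sum_of_measures P P')) (\<lambda>A. emeasure P A + emeasure P' A)"
    by (simp add: positive_def)
  show "countably_additive (sets (sum_of_measures P P')) (\<lambda>A. emeasure P A + emeasure P' A)"
  proof (rule countably_additiveI)
    fix B :: "nat \<Rightarrow> _" assume "range B \<subseteq> sets (sum_of_measures P P')" "disjoint_family B"
    then have "(\<Sum>i. emeasure P (B i)) = emeasure P (\<Union>i. B i)" "(\<Sum>i. emeasure P' (B i)) = emeasure P' (\<Union>i. B i)"
      using sets by (auto intro!: suminf_emeasure)
    then show "(\<Sum>i. emeasure P (B i) + emeasure P' (B i)) = emeasure P (\<Union>i. B i) + emeasure P' (\<Union>i. B i)"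
      by (subst suminf_add[symmetric]) auto
  qed
qed

lemma integral_abs_mono_measure:
  assumes sets: "sets P = sets \<mu>" and le: "\<And>A. A \<in> sets \<mu> \<Longrightarrow> emeasure P A \<le> emeasure \<mu> A"
    and d: "integrable \<mu> d"
  shows "integrable P d" "(LINT x|P. \<bar>d x\<bar>) \<le> (LINT x|\<mu>. \<bar>d x :: real\<bar>)"
proof -
  have "P \<le> \<mu>" using le by (subst le_measure[OF sets]) (simp add: sets)
  then have nn: "(\<integral>\<^sup>+x. ennreal \<bar>d x\<bar> \<partial>P) \<le> (\<integral>\<^sup>+x. ennreal \<bar>d x\<bar> \<partial>\<mu>)"
    by (intro nn_integral_mono_measure sets)
  have dm: "d \<in> borel_measurable P" using d by (simp add: measurable_cong_sets[OF sets refl])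
  have fin: "(\<integral>\<^sup>+x. ennreal \<bar>d x\<bar> \<partial>\<mu>) < \<infinity>" using d by (simp add: integrable_iff_bounded)
  show i: "integrable P d" using dm nn fin by (simp add: integrable_iff_bounded le_less_trans)
  have "ennreal (LINT x|P. \<bar>d x\<bar>) \<le> ennreal (LINT x|\<mu>. \<bar>d x\<bar>)"
    using nn d i by (simp add: nn_integral_eq_integral)
  then show "(LINT x|P. \<bar>d x\<bar>) \<le> (LINT x|\<mu>. \<bar>d x\<bar>)" by (simp add: ennreal_le_iff)
qed

context
  fixes P P' \<mu> :: "'a measure"
  assumes P: "prob_space P" and P': "prob_space P'" and sets: "sets P' = sets P"
  defines "\<mu> \<equiv> sum_of_measures P P'"
begin

interpretation P: prob_space P by (rule P)
interpretation P': prob_space P' by (rule P')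

lemma le_sum_of_measures:
  shows "A \<in> sets \<mu> \<Longrightarrow> emeasure P A \<le> emeasure \<mu> A" "A \<in> sets \<mu> \<Longrightarrow> emeasure P' A \<le> emeasure \<mu> A"
  unfolding \<mu>_def by (simp_all add: emeasure_sum_of_measures[OF sets])

lemma sets_eq_sum_of_measures: "sets P = sets \<mu>" "sets P' = sets \<mu>"
  by (simp_all add: \<mu>_def sets)

lemma mass_sum_of_measures: "emeasure \<mu> (space \<mu>) = 2"
proof -
  have "space P' = space P" using sets by (rule sets_eq_imp_space_eq)
  then show ?thesis
    unfolding \<mu>_def using P.emeasure_space_1 P'.emeasure_space_1
    by (simp add: emeasure_sum_of_measures[OF sets])
qed

lemma finite_sum_of_measures: "finite_measure \<mu>"
  by (rule finite_measureI) (simp add: mass_sum_of_measures)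

end

text \<open>Both inequalities are continuous with respect to approximation in \<open>L\<^sup>1\<close> of the sum \<open>P + P'\<close>,
  which dominates both laws. A cylinder function approximating \<open>g\<close> is truncated to the range of
  \<open>g\<close>; this keeps \<open>1 / g\<close> under control and does not increase the error.\<close>

lemma jeffreys_close_from_marginals:
  fixes P P' :: "('i \<Rightarrow> real) measure"
  assumes P: "prob_space P" and P': "prob_space P'"
    and sP: "sets P = sets (PiM UNIV (\<lambda>_. borel))" and sP': "sets P' = sets (PiM UNIV (\<lambda>_. borel))"
    and marg: "\<And>F. finite F \<Longrightarrow> jeffreys_close J (distr P (PiM F (\<lambda>_. borel)) (\<lambda>x. restrict x F))
        (distr P' (PiM F (\<lambda>_. borel)) (\<lambda>x. restrict x F))"
  shows "jeffreys_close J P P'"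
proof -
  interpret P: prob_space P by (rule P)
  interpret P': prob_space P' by (rule P')
  have sets: "sets P' = sets P" using sP sP' by simp
  define \<mu> where "\<mu> = sum_of_measures P P'"
  note sm = sets_eq_sum_of_measures[OF P P' sets, folded \<mu>_def] finite_sum_of_measures[OF P P' sets, folded \<mu>_def]
    and dom = le_sum_of_measures[OF P P' sets, folded \<mu>_def]
  interpret \<mu>: finite_measure \<mu> by (rule sm(3))
  have s\<mu>: "sets \<mu> = sets (PiM UNIV (\<lambda>_. borel))" using sm sP by simp
  have R[measurable]: "(\<lambda>x. restrict x F) \<in> P \<rightarrow>\<^sub>M PiM F (\<lambda>_. borel :: real measure)"
    "(\<lambda>x. restrict x F) \<in> P' \<rightarrow>\<^sub>M PiM F (\<lambda>_. borel :: real measure)"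
    "(\<lambda>x. restrict x F) \<in> \<mu> \<rightarrow>\<^sub>M PiM F (\<lambda>_. borel :: real measure)" for F
    using restrict_measurable_PiM
    by (simp_all add: measurable_cong_sets[OF sP refl] measurable_cong_sets[OF sP' refl]
        measurable_cong_sets[OF s\<mu> refl])
  have meas_le: "measure P A \<le> measure \<mu> A" "measure P' A \<le> measure \<mu> A" if "A \<in> sets \<mu>" for A
    using dom[OF that] by (simp_all add: P.emeasure_eq_measure P'.emeasure_eq_measure \<mu>.emeasure_eq_measure)
  have test: "2 - (LINT x|P. g x) - (LINT x|P'. 1 / g x) \<le> J / 2"
    if g: "g \<in> borel_measurable P" and a: "0 < a" "\<And>x. a \<le> g x \<and> g x \<le> 1 / a" for g a
  proof (rule field_le_epsilon)
    fix \<epsilon> :: real assume e: "\<epsilon> > 0"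
    have gm[measurable]: "g \<in> borel_measurable P" "g \<in> borel_measurable P'" "g \<in> borel_measurable \<mu>"
      using g by (simp_all add: measurable_cong_sets[OF sP refl] measurable_cong_sets[OF sP' refl]
          measurable_cong_sets[OF s\<mu> refl])
    have gpos: "0 < g x" for x using a(1) a(2)[of x] by linarith
    have aa: "a \<le> 1 / a" using a(2)[of undefined] by linarith
    \<comment> \<open>\<open>\<delta>\<close> for the integral of \<open>g\<close> and \<open>\<delta> / a\<^sup>2\<close> for that of \<open>1 / g\<close>\<close>
    define \<delta> where "\<delta> = \<epsilon> / (1 + 1 / a\<^sup>2)"
    have den: "0 < 1 + 1 / a\<^sup>2" using a(1) by (simp add: add_pos_pos)
    have d: "\<delta> > 0" using e den by (simp add: \<delta>_def)
    have gi: "integrable \<mu> g"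
      using a gpos by (intro \<mu>.integrable_const_bound[of _ "1 / a"]) (auto simp: less_imp_le)
    obtain F h where F: "finite F" and h[measurable]: "h \<in> borel_measurable (PiM F (\<lambda>_. borel))"
      and hi: "integrable \<mu> (\<lambda>x. h (restrict x F))" and hl: "(LINT x|\<mu>. \<bar>g x - h (restrict x F)\<bar>) < \<delta>"
      using cylinder_function_approximation[OF sm(3) s\<mu> gi] d by blast
    define \<gamma> where "\<gamma> y = min (1 / a) (max a (h y))" for y
    have \<gamma>m[measurable]: "\<gamma> \<in> borel_measurable (PiM F (\<lambda>_. borel))" unfolding \<gamma>_def by measurable
    have \<gamma>_range: "a \<le> \<gamma> y \<and> \<gamma> y \<le> 1 / a" for y using aa by (auto simp: \<gamma>_def)
    have \<gamma>pos: "0 < \<gamma> y" for y using a(1) \<gamma>_range[of y] by linarith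
    let ?\<gamma> = "\<lambda>x. \<gamma> (restrict x F)"
    have \<gamma>i: "integrable \<mu> ?\<gamma>"
      using \<gamma>_range \<gamma>pos by (intro \<mu>.integrable_const_bound[of _ "1 / a"]) (auto simp: less_imp_le)
    have closer: "\<bar>g x - ?\<gamma> x\<bar> \<le> \<bar>g x - h (restrict x F)\<bar>" for x
      using a(2)[of x] aa by (auto simp: \<gamma>_def min_def max_def)
    have "(LINT x|\<mu>. \<bar>g x - ?\<gamma> x\<bar>) \<le> (LINT x|\<mu>. \<bar>g x - h (restrict x F)\<bar>)"
      using gi \<gamma>i hi closer by (intro integral_mono) auto
    then have d\<mu>: "(LINT x|\<mu>. \<bar>g x - ?\<gamma> x\<bar>) < \<delta>" using hl by linarith
    have di: "integrable \<mu> (\<lambda>x. g x - ?\<gamma> x)" using gi \<gamma>i by simp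
    note dP = integral_abs_mono_measure[OF sm(1) dom(1) di] and dP' = integral_abs_mono_measure[OF sm(2) dom(2) di]
    note iP = integral_abs_mono_measure(1)[OF sm(1) dom(1)]
    have inv_i: "integrable P' (\<lambda>x. 1 / g x)" "integrable P' (\<lambda>x. 1 / ?\<gamma> x)"
    proof -
      have "1 / g x \<le> 1 / a" "1 / ?\<gamma> x \<le> 1 / a" for x
        using a gpos[of x] \<gamma>_range[of "restrict x F"] \<gamma>pos by (auto intro!: frac_le)
      then show "integrable P' (\<lambda>x. 1 / g x)" "integrable P' (\<lambda>x. 1 / ?\<gamma> x)"
        using gpos \<gamma>pos
        by (auto intro!: P'.integrable_const_bound[of _ "1 / a"] simp: less_imp_le)
    qed
    have 1: "(LINT x|P. ?\<gamma> x) - (LINT x|P. g x) \<le> \<delta>"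
    proof -
      have "(LINT x|P. ?\<gamma> x) - (LINT x|P. g x) = (LINT x|P. ?\<gamma> x - g x)"
        using iP gi \<gamma>i by simp
      also have "\<dots> \<le> (LINT x|P. \<bar>g x - ?\<gamma> x\<bar>)"
        using iP gi \<gamma>i by (intro integral_mono) auto
      finally show ?thesis using dP(2) d\<mu> by linarith
    qed
    have 2: "(LINT x|P'. 1 / ?\<gamma> x) - (LINT x|P'. 1 / g x) \<le> \<delta> / a\<^sup>2"
    proof -
      have "(LINT x|P'. 1 / ?\<gamma> x) - (LINT x|P'. 1 / g x) = (LINT x|P'. 1 / ?\<gamma> x - 1 / g x)"
        using inv_i by simp
      also have "\<dots> \<le> (LINT x|P'. \<bar>g x - ?\<gamma> x\<bar> / a\<^sup>2)"
      proof (rule integral_mono)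
        fix x
        have "1 / ?\<gamma> x - 1 / g x = (g x - ?\<gamma> x) / (?\<gamma> x * g x)"
          using gpos[of x] \<gamma>pos[of "restrict x F"] by (simp add: field_simps)
        also have "\<dots> \<le> \<bar>g x - ?\<gamma> x\<bar> / (?\<gamma> x * g x)"
          using gpos[of x] \<gamma>pos[of "restrict x F"] by (intro divide_right_mono) auto
        also have "\<dots> \<le> \<bar>g x - ?\<gamma> x\<bar> / a\<^sup>2"
          using a \<gamma>_range[of "restrict x F"] gpos[of x] \<gamma>pos[of "restrict x F"]
          by (intro divide_left_mono) (auto simp: power2_eq_square intro!: mult_mono mult_pos_pos)
        finally show "1 / ?\<gamma> x - 1 / g x \<le> \<bar>g x - ?\<gamma> x\<bar> / a\<^sup>2" .
      qed (use inv_i dP'(1) in auto)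
      also have "\<dots> = (LINT x|P'. \<bar>g x - ?\<gamma> x\<bar>) / a\<^sup>2" by simp
      also have "\<dots> \<le> \<delta> / a\<^sup>2" using dP'(2) d\<mu> by (intro divide_right_mono) auto
      finally show ?thesis .
    qed
    have "2 - (LINT x|distr P (PiM F (\<lambda>_. borel)) (\<lambda>x. restrict x F). \<gamma> x) -
        (LINT x|distr P' (PiM F (\<lambda>_. borel)) (\<lambda>x. restrict x F). 1 / \<gamma> x) \<le> J / 2"
      using marg[OF F] \<gamma>_range a(1) \<gamma>m unfolding jeffreys_close_def by auto
    then have "2 - (LINT x|P. ?\<gamma> x) - (LINT x|P'. 1 / ?\<gamma> x) \<le> J / 2"
      by (simp add: integral_distr)
    then have "2 - (LINT x|P. g x) - (LINT x|P'. 1 / g x) \<le> J / 2 + (\<delta> + \<delta> / a\<^sup>2)"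
      using 1 2 by linarith
    also have "\<delta> + \<delta> / a\<^sup>2 = \<epsilon>"
    proof -
      have "\<delta> + \<delta> / a\<^sup>2 = \<delta> * (1 + 1 / a\<^sup>2)" by (simp add: algebra_simps)
      also have "\<dots> = \<epsilon>" using den unfolding \<delta>_def by simp
      finally show ?thesis .
    qed
    finally show "2 - (LINT x|P. g x) - (LINT x|P'. 1 / g x) \<le> J / 2 + \<epsilon>" .
  qed
  have setb: "measure P' C \<le> exp K * measure P C + 2 * J / K \<and> measure P C \<le> exp K * measure P' C + 2 * J / K"
    if C: "C \<in> sets P" and K: "1 \<le> K" for C K
  proof -
    have C\<mu>: "C \<in> sets \<mu>" using C sm by simp
    have C': "C \<in> sets P'" using C sets by simp
    have approx: "measure P' C \<le> (exp K * measure P C + 2 * J / K) + \<epsilon> \<and>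
        measure P C \<le> (exp K * measure P' C + 2 * J / K) + \<epsilon>" if e: "\<epsilon> > 0" for \<epsilon>
    proof -
      define \<delta> where "\<delta> = \<epsilon> / (1 + exp K)"
      have d: "\<delta> > 0" using e by (simp add: \<delta>_def add_pos_pos)
      have d': "\<delta> + exp K * \<delta> = \<epsilon>"
      proof -
        have "1 + exp K \<noteq> 0" using exp_gt_zero[of K] by linarith
        moreover have "\<delta> + exp K * \<delta> = \<delta> * (1 + exp K)" by (simp add: algebra_simps)
        ultimately show ?thesis by (simp add: \<delta>_def)
      qed
      obtain E where E: "cylinder E" "measure \<mu> (sym_diff C E) < \<delta>"
        using cylinder_approximation[OF sm(3) s\<mu> C\<mu>] d by blast
      have Es: "E \<in> sets \<mu>" "E \<in> sets P" "E \<in> sets P'" using cylinder_sets[OF E(1)] s\<mu> sP sP' by auto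
      obtain F B where F: "finite F" "B \<in> sets (PiM F (\<lambda>_. borel))" and EB: "E = (\<lambda>x. restrict x F) -` B"
        using E(1) by (auto simp: cylinder_def)
      have spaces: "space P = UNIV" "space P' = UNIV"
        using sets_eq_imp_space_eq[OF sP] sets_eq_imp_space_eq[OF sP'] by auto
      have "measure P' E \<le> exp K * measure P E + 2 * J / K \<and> measure P E \<le> exp K * measure P' E + 2 * J / K"
        using marg[OF F(1)] F(2) K unfolding jeffreys_close_def
        by (auto simp: measure_distr[OF R(1) F(2)] measure_distr[OF R(2) F(2)] EB spaces)
      moreover have nearP: "measure P C \<le> measure P E + \<delta> \<and> measure P E \<le> measure P C + \<delta>"
      proof -
        have "measure P (sym_diff C E) \<le> \<delta>" using meas_le(1)[of "sym_diff C E"] C\<mu> Es E(2) by auto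
        moreover have "measure P C \<le> measure P (E \<union> sym_diff C E)" "measure P E \<le> measure P (C \<union> sym_diff C E)"
          using C Es by (auto intro!: P.finite_measure_mono)
        moreover have "measure P (E \<union> sym_diff C E) \<le> measure P E + measure P (sym_diff C E)"
          "measure P (C \<union> sym_diff C E) \<le> measure P C + measure P (sym_diff C E)"
          using C Es by (auto intro!: measure_Un_le)
        ultimately show ?thesis by linarith
      qed
      moreover have nearP': "measure P' C \<le> measure P' E + \<delta> \<and> measure P' E \<le> measure P' C + \<delta>"
      proof -
        have "measure P' (sym_diff C E) \<le> \<delta>" using meas_le(2)[of "sym_diff C E"] C\<mu> Es E(2) by auto
        moreover have "measure P' C \<le> measure P' (E \<union> sym_diff C E)" "measure P' E \<le> measure P' (C \<union> sym_diff C E)"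
          using C' Es by (auto intro!: P'.finite_measure_mono)
        moreover have "measure P' (E \<union> sym_diff C E) \<le> measure P' E + measure P' (sym_diff C E)"
          "measure P' (C \<union> sym_diff C E) \<le> measure P' C + measure P' (sym_diff C E)"
          using C' Es by (auto intro!: measure_Un_le)
        ultimately show ?thesis by linarith
      qed
      moreover have "exp K * measure P E \<le> exp K * measure P C + exp K * \<delta>"
        "exp K * measure P' E \<le> exp K * measure P' C + exp K * \<delta>"
        using mult_left_mono[of "measure P E" "measure P C + \<delta>" "exp K"] nearP
          mult_left_mono[of "measure P' E" "measure P' C + \<delta>" "exp K"] nearP'
        by (simp_all add: distrib_left)
      ultimately show ?thesis using d' by linarith
    qed
    show ?thesis
      by (rule conjI; rule field_le_epsilon) (use approx in simp_all)
  qed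
  show ?thesis
    unfolding jeffreys_close_def by (intro conjI allI impI) (use test setb in simp_all)
qed

text \<open>On a null set of one law the other law is at most \<open>2 * J / K\<close> for every \<open>K \<ge> 1\<close>.\<close>

lemma jeffreys_close_imp_equivalent:
  assumes close: "jeffreys_close J P P'" and P: "prob_space P" and P': "prob_space P'"
    and sets: "sets P' = sets P"
  shows "equivalent_measures P P'"
proof -
  interpret P: prob_space P by (rule P)
  interpret P': prob_space P' by (rule P')
  have J0: "x = 0" if x: "0 \<le> x" and le: "\<And>K. 1 \<le> K \<Longrightarrow> x \<le> 2 * J / K" for x :: real
  proof (rule ccontr)
    assume "x \<noteq> 0"
    then have "x > 0" using x by simp
    define K where "K = 1 + \<bar>2 * J / x\<bar>"
    have K: "1 \<le> K" by (simp add: K_def)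
    have "x * K \<le> 2 * J" using le[OF K] K by (simp add: pos_le_divide_eq)
    moreover have "x * K = x + \<bar>2 * J\<bar>" using \<open>x > 0\<close> by (simp add: K_def distrib_left abs_mult)
    ultimately show False using \<open>x > 0\<close> by linarith
  qed
  have "A \<in> null_sets P'" if A: "A \<in> null_sets P" for A
  proof -
    have AP: "A \<in> sets P" "measure P A = 0" using A by (auto simp: null_sets_def measure_def)
    have "measure P' A = 0"
      using close AP unfolding jeffreys_close_def by (intro J0) force+
    then show ?thesis using AP sets by (intro null_setsI) (auto simp: P'.emeasure_eq_measure)
  qed
  moreover have "A \<in> null_sets P" if A: "A \<in> null_sets P'" for A
  proof -
    have AP: "A \<in> sets P" "measure P' A = 0" using A sets by (auto simp: null_sets_def measure_def)
    have "measure P A = 0"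
      using close AP unfolding jeffreys_close_def by (intro J0) force+
    then show ?thesis using AP by (intro null_setsI) (auto simp: P.emeasure_eq_measure)
  qed
  ultimately show ?thesis unfolding equivalent_measures_def absolutely_continuous_def by blast
qed

text \<open>With densities \<open>s\<^sup>2\<close>, \<open>s'\<^sup>2\<close> with respect to \<open>\<mu> = P + P'\<close> the squared Hellinger distance is \<open>2\<close> minus
  twice the integral of \<open>s s'\<close>. The optimal test function would be \<open>s' / s\<close>; the regularised function
  \<open>(s' + d) / (s + d)\<close> is bounded away from \<open>0\<close> and infinity, and loses at most \<open>4 d\<close>.\<close>

lemma jeffreys_close_imp_hellinger:
  assumes close: "jeffreys_close J P P'" and P: "prob_space P" and P': "prob_space P'"
    and sets: "sets P' = sets P"
  shows "hellinger_sq P P' \<le> ennreal (J / 2)"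
proof -
  interpret P: prob_space P by (rule P)
  interpret P': prob_space P' by (rule P')
  define \<mu> where "\<mu> = sum_of_measures P P'"
  note sm = sets_eq_sum_of_measures[OF P P' sets, folded \<mu>_def] finite_sum_of_measures[OF P P' sets, folded \<mu>_def]
    mass_sum_of_measures[OF P P' sets, folded \<mu>_def]
    and dom = le_sum_of_measures[OF P P' sets, folded \<mu>_def]
  interpret \<mu>: finite_measure \<mu> by (rule sm(3))
  have mass: "measure \<mu> (space \<mu>) = 2" using sm(4) by (simp add: measure_def)
  define f where "f = RN_deriv \<mu> P"
  define f' where "f' = RN_deriv \<mu> P'"
  have fm[measurable]: "f \<in> borel_measurable \<mu>" "f' \<in> borel_measurable \<mu>" by (simp_all add: f_def f'_def)
  have ac: "absolutely_continuous \<mu> P" "absolutely_continuous \<mu> P'"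
  proof -
    have "emeasure P A = 0 \<and> emeasure P' A = 0" if "A \<in> sets \<mu>" "emeasure \<mu> A = 0" for A
      using dom(1)[OF that(1)] dom(2)[OF that(1)] that(2) by simp
    then show "absolutely_continuous \<mu> P" "absolutely_continuous \<mu> P'"
      unfolding absolutely_continuous_def null_sets_def sm(1,2) by auto
  qed
  have dens: "density \<mu> f = P" "density \<mu> f' = P'"
    unfolding f_def f'_def using ac sm by (auto intro!: \<mu>.density_RN_deriv)
  have "density \<mu> (\<lambda>x. f x + f' x) = density \<mu> (\<lambda>_. 1)"
  proof (rule measure_eqI)
    fix A assume "A \<in> sets (density \<mu> (\<lambda>x. f x + f' x))"
    then have A[measurable]: "A \<in> sets \<mu>" by simp
    have "emeasure (density \<mu> (\<lambda>x. f x + f' x)) A = (\<integral>\<^sup>+x. (f x + f' x) * indicator A x \<partial>\<mu>)"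
      by (rule emeasure_density) simp_all
    also have "\<dots> = (\<integral>\<^sup>+x. f x * indicator A x + f' x * indicator A x \<partial>\<mu>)"
      by (simp only: distrib_right)
    also have "\<dots> = (\<integral>\<^sup>+x. f x * indicator A x \<partial>\<mu>) + (\<integral>\<^sup>+x. f' x * indicator A x \<partial>\<mu>)"
      by (rule nn_integral_add) simp_all
    also have "\<dots> = emeasure (density \<mu> f) A + emeasure (density \<mu> f') A"
      by (simp only: emeasure_density[OF fm(1) A] emeasure_density[OF fm(2) A])
    also have "\<dots> = emeasure \<mu> A"
      using A unfolding dens sm(1)[symmetric]
      by (simp only: \<mu>_def emeasure_sum_of_measures[OF sets])
    finally show "emeasure (density \<mu> (\<lambda>x. f x + f' x)) A = emeasure (density \<mu> (\<lambda>_. 1)) A"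
      by (simp add: density_1)
  qed simp
  then have sum1: "AE x in \<mu>. f x + f' x = 1" by (intro \<mu>.density_unique) auto
  \<comment> \<open>As the two densities add up to \<open>1\<close> almost everywhere, the truncation changes them on a null set only.\<close>
  define r where "r x = min 1 (enn2real (f x))" for x
  define r' where "r' x = min 1 (enn2real (f' x))" for x
  have [measurable]: "r \<in> borel_measurable \<mu>" "r' \<in> borel_measurable \<mu>"
    unfolding r_def r'_def by measurable
  have r01: "0 \<le> r x" "r x \<le> 1" "0 \<le> r' x" "r' x \<le> 1" for x by (auto simp: r_def r'_def)
  have rf: "AE x in \<mu>. f x = ennreal (r x) \<and> f' x = ennreal (r' x) \<and> enn2real (f x) = r x \<and> enn2real (f' x) = r' x \<and> r x + r' x = 1"
    using sum1
  proof (rule AE_mp, intro AE_I2 impI)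
    fix x assume s: "f x + f' x = 1"
    then have "f x \<le> 1" "f' x \<le> 1" by (metis le_iff_add, metis le_iff_add add.commute)
    then obtain a b where ab: "0 \<le> a" "0 \<le> b" "f x = ennreal a" "f' x = ennreal b"
      by (cases "f x"; cases "f' x") (auto simp: top_unique)
    then have "ennreal (a + b) = ennreal 1" using s by simp
    then have "a + b = 1" using ennreal_inj[of "a + b" 1] ab by auto
    then show "f x = ennreal (r x) \<and> f' x = ennreal (r' x) \<and> enn2real (f x) = r x \<and> enn2real (f' x) = r' x \<and> r x + r' x = 1"
      using ab by (simp add: r_def r'_def)
  qed
  have densr: "P = density \<mu> (\<lambda>x. ennreal (r x))" "P' = density \<mu> (\<lambda>x. ennreal (r' x))"
    unfolding dens[symmetric] using rf by (auto intro!: density_cong)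
  define s where "s x = sqrt (r x)" for x
  define s' where "s' x = sqrt (r' x)" for x
  have [measurable]: "s \<in> borel_measurable \<mu>" "s' \<in> borel_measurable \<mu>"
    unfolding s_def s'_def by measurable
  have s01: "0 \<le> s x" "s x \<le> 1" "0 \<le> s' x" "s' x \<le> 1" for x using r01 by (auto simp: s_def s'_def)
  have s2: "r x = (s x)\<^sup>2" "r' x = (s' x)\<^sup>2" for x using r01 by (auto simp: s_def s'_def)
  have ss1: "s x * s' x \<le> 1" for x using mult_mono[OF s01(2,4) _ s01(3), of x x] by simp
  have int_ss: "integrable \<mu> (\<lambda>x. s x * s' x)"
    using s01 ss1 by (intro \<mu>.integrable_const_bound[of _ 1]) (auto simp: abs_mult)
  have hell: "hellinger_sq P P' = ennreal (2 - 2 * (LINT x|\<mu>. s x * s' x))"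
  proof -
    have "hellinger_sq P P' = (\<integral>\<^sup>+x. ennreal (1 - 2 * (s x * s' x)) \<partial>\<mu>)"
      unfolding hellinger_sq_def Let_def \<mu>_def[symmetric] f_def[symmetric] f'_def[symmetric]
    proof (rule nn_integral_cong_AE, use rf in \<open>rule AE_mp\<close>, intro AE_I2 impI)
      fix x assume "f x = ennreal (r x) \<and> f' x = ennreal (r' x) \<and> enn2real (f x) = r x \<and> enn2real (f' x) = r' x \<and> r x + r' x = 1"
      then have *: "enn2real (f x) = r x" "enn2real (f' x) = r' x" "(s x)\<^sup>2 + (s' x)\<^sup>2 = 1"
        using s2[of x] by auto
      have "(s x - s' x)\<^sup>2 = (s x)\<^sup>2 + (s' x)\<^sup>2 - 2 * (s x * s' x)" by (simp add: power2_diff)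
      then show "ennreal ((sqrt (enn2real (f x)) - sqrt (enn2real (f' x)))\<^sup>2) = ennreal (1 - 2 * (s x * s' x))"
        using *(3) by (simp add: *(1,2) s_def[symmetric] s'_def[symmetric])
    qed
    also have "\<dots> = ennreal (LINT x|\<mu>. 1 - 2 * (s x * s' x))"
    proof (rule nn_integral_eq_integral)
      show "integrable \<mu> (\<lambda>x. 1 - 2 * (s x * s' x))" using int_ss by simp
      show "AE x in \<mu>. 0 \<le> 1 - 2 * (s x * s' x)"
        using rf
      proof (rule AE_mp, intro AE_I2 impI)
        fix x assume "f x = ennreal (r x) \<and> f' x = ennreal (r' x) \<and> enn2real (f x) = r x \<and> enn2real (f' x) = r' x \<and> r x + r' x = 1"
        then have "(s x)\<^sup>2 + (s' x)\<^sup>2 = 1" using s2[of x] by auto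
        moreover have "0 \<le> (s x - s' x)\<^sup>2" by simp
        ultimately show "0 \<le> 1 - 2 * (s x * s' x)" by (simp add: power2_diff)
      qed
    qed
    also have "(LINT x|\<mu>. 1 - 2 * (s x * s' x)) = 2 - 2 * (LINT x|\<mu>. s x * s' x)"
      using int_ss mass by simp
    finally show ?thesis .
  qed
  have "2 - 2 * (LINT x|\<mu>. s x * s' x) \<le> J / 2 + \<epsilon>" if e: "\<epsilon> > 0" for \<epsilon>
  proof -
    \<comment> \<open>Each of the two expectations exceeds the integral of \<open>s s'\<close> by at most \<open>2 d\<close>, as \<open>\<mu>\<close> has mass \<open>2\<close>.\<close>
    define d where "d = min (\<epsilon> / 4) 1"
    have d: "0 < d" "d \<le> 1" "4 * d \<le> \<epsilon>" using e by (auto simp: d_def)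
    define g where "g x = (s' x + d) / (s x + d)" for x
    have gm[measurable]: "g \<in> borel_measurable \<mu>" unfolding g_def by measurable
    have pos: "0 < s x + d" "0 < s' x + d" for x using s01[of x] d by linarith+
    have g_range: "d / 2 \<le> g x \<and> g x \<le> 1 / (d / 2)" for x
    proof
      have "d * (s x + d) \<le> d * 2" using s01[of x] d by (intro mult_left_mono) auto
      then have "d / 2 * (s x + d) \<le> s' x + d" using s01[of x] by simp
      then show "d / 2 \<le> g x" using pos[of x] by (simp add: g_def pos_le_divide_eq)
      have "d * (s' x + d) \<le> d * 2" using s01[of x] d by (intro mult_left_mono) auto
      moreover have "d * 2 \<le> 2 * (s x + d)" using s01[of x] by simp
      ultimately have "(s' x + d) * d \<le> 2 * (s x + d)" by (simp add: mult.commute)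
      then show "g x \<le> 1 / (d / 2)" using pos[of x] d by (simp add: g_def field_simps)
    qed
    have gP: "g \<in> borel_measurable P" using gm by (simp add: measurable_cong_sets[OF sm(1) refl])
    have "2 - (LINT x|P. g x) - (LINT x|P'. 1 / g x) \<le> J / 2"
      using d(1) by (intro jeffreys_close_test[OF close gP _ g_range]) simp
    moreover have "(LINT x|P. g x) \<le> (LINT x|\<mu>. s x * s' x) + 2 * d"
    proof -
      have bd: "r x * g x \<le> s x * s' x + d" "0 \<le> r x * g x" for x
      proof -
        have "r x * g x = (s x * (s' x + d)) * (s x / (s x + d))" by (simp add: g_def s2 power2_eq_square)
        also have "\<dots> \<le> (s x * (s' x + d)) * 1"
          using s01[of x] pos[of x] d by (intro mult_left_mono) auto
        also have "\<dots> \<le> s x * s' x + d"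
          using mult_right_mono[of "s x" 1 d] s01[of x] d by (simp add: distrib_left)
        finally show "r x * g x \<le> s x * s' x + d" .
        show "0 \<le> r x * g x" using r01[of x] pos[of x] by (simp add: g_def)
      qed
      have "(LINT x|P. g x) = (LINT x|\<mu>. r x * g x)"
        unfolding densr(1) using r01 by (subst integral_density) auto
      also have "\<dots> \<le> (LINT x|\<mu>. s x * s' x + d)"
      proof (rule integral_mono)
        show "integrable \<mu> (\<lambda>x. r x * g x)"
        proof (intro \<mu>.integrable_const_bound[of _ 2])
          have "\<bar>r x * g x\<bar> \<le> 2" for x using bd[of x] ss1[of x] d(2) by simp
          then show "AE x in \<mu>. norm (r x * g x) \<le> 2" by simp
        qed simp
      qed (use int_ss bd in auto)
      also have "\<dots> = (LINT x|\<mu>. s x * s' x) + 2 * d" using int_ss mass by simp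
      finally show ?thesis .
    qed
    moreover have "(LINT x|P'. 1 / g x) \<le> (LINT x|\<mu>. s x * s' x) + 2 * d"
    proof -
      have bd: "r' x * (1 / g x) \<le> s x * s' x + d" "0 \<le> r' x * (1 / g x)" for x
      proof -
        have "r' x * (1 / g x) = (s' x * (s x + d)) * (s' x / (s' x + d))" by (simp add: g_def s2 power2_eq_square)
        also have "\<dots> \<le> (s' x * (s x + d)) * 1"
          using s01[of x] pos[of x] d by (intro mult_left_mono) auto
        also have "\<dots> \<le> s x * s' x + d"
          using mult_right_mono[of "s' x" 1 d] s01[of x] d by (simp add: distrib_left mult.commute)
        finally show "r' x * (1 / g x) \<le> s x * s' x + d" .
        show "0 \<le> r' x * (1 / g x)" using r01[of x] pos[of x] by (simp add: g_def)
      qed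
      have "(LINT x|P'. 1 / g x) = (LINT x|\<mu>. r' x * (1 / g x))"
        unfolding densr(2) using r01 by (subst integral_density) auto
      also have "\<dots> \<le> (LINT x|\<mu>. s x * s' x + d)"
      proof (rule integral_mono)
        show "integrable \<mu> (\<lambda>x. r' x * (1 / g x))"
        proof (intro \<mu>.integrable_const_bound[of _ 2])
          have "\<bar>r' x * (1 / g x)\<bar> \<le> 2" for x using bd[of x] ss1[of x] d(2) by simp
          then show "AE x in \<mu>. norm (r' x * (1 / g x)) \<le> 2" by simp
        qed simp
      qed (use int_ss bd in auto)
      also have "\<dots> = (LINT x|\<mu>. s x * s' x) + 2 * d" using int_ss mass by simp
      finally show ?thesis .
    qed
    ultimately show ?thesis using d by linarith
  qed
  then have "2 - 2 * (LINT x|\<mu>. s x * s' x) \<le> J / 2" by (rule field_le_epsilon)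
  then show ?thesis unfolding hell by (rule ennreal_leI)
qed


section \<open>The two cylindrical Gaussian laws\<close>

text \<open>Under both laws the coordinates are independent, so the log likelihood ratio is the sum of the
  one-dimensional ones. Being quadratic, it has expectations that involve only the second moments
  \<open>1\<close> and \<open>Q1 u \<bullet> u\<close>; the logarithms cancel in the difference.\<close>

lemma jeffreys_close_gaussian_coordinates:
  fixes X0 :: "'h::real_inner \<Rightarrow> 'w0 \<Rightarrow> real" and X1 :: "'h \<Rightarrow> 'w1 \<Rightarrow> real"
  assumes c0: "cyl_gaussian M0 X0 Q0" and c1: "cyl_gaussian M1 X1 Q1"
    and U: "finite U"
    and o0: "\<And>u u'. u \<in> U \<Longrightarrow> u' \<in> U \<Longrightarrow> u \<noteq> u' \<Longrightarrow> Q0 u \<bullet> u' = 0"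
    and o1: "\<And>u u'. u \<in> U \<Longrightarrow> u' \<in> U \<Longrightarrow> u \<noteq> u' \<Longrightarrow> Q1 u \<bullet> u' = 0"
    and n0: "\<And>u. u \<in> U \<Longrightarrow> Q0 u \<bullet> u = 1"
    and n1: "\<And>u. u \<in> U \<Longrightarrow> 0 < Q1 u \<bullet> u"
    and J: "(\<Sum>u\<in>U. Q1 u \<bullet> u - 2 + 1 / (Q1 u \<bullet> u)) / 2 \<le> J"
  shows "jeffreys_close J (distr M0 (PiM U (\<lambda>_. borel)) (\<lambda>\<omega>. \<lambda>u\<in>U. X0 u \<omega>))
    (distr M1 (PiM U (\<lambda>_. borel)) (\<lambda>\<omega>. \<lambda>u\<in>U. X1 u \<omega>))"
proof -
  interpret M0: prob_space M0 by (rule cyl_gaussian_prob_space[OF c0])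
  interpret M1: prob_space M1 by (rule cyl_gaussian_prob_space[OF c1])
  note [measurable] = cyl_gaussian_measurable[OF c0] cyl_gaussian_measurable[OF c1]
  \<comment> \<open>The value \<open>1\<close> outside \<open>U\<close> makes every factor a probability measure.\<close>
  define \<sigma> where "\<sigma> u = (if u \<in> U then sqrt (Q1 u \<bullet> u) else 1)" for u
  have \<sigma>: "0 < \<sigma> u" for u using n1 by (simp add: \<sigma>_def)
  have \<sigma>2: "Q1 u \<bullet> u = (\<sigma> u)\<^sup>2" if "u \<in> U" for u
    using that n1[OF that] by (simp add: \<sigma>_def)
  let ?N0 = "distr M0 (PiM U (\<lambda>_. borel)) (\<lambda>\<omega>. \<lambda>u\<in>U. X0 u \<omega>)"
  let ?N1 = "distr M1 (PiM U (\<lambda>_. borel)) (\<lambda>\<omega>. \<lambda>u\<in>U. X1 u \<omega>)"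
  have Y0[measurable]: "(\<lambda>\<omega>. \<lambda>u\<in>U. X0 u \<omega>) \<in> M0 \<rightarrow>\<^sub>M PiM U (\<lambda>_. borel)"
    and Y1[measurable]: "(\<lambda>\<omega>. \<lambda>u\<in>U. X1 u \<omega>) \<in> M1 \<rightarrow>\<^sub>M PiM U (\<lambda>_. borel)"
    by (auto intro!: measurable_restrict)
  have N0: "?N0 = PiM U (\<lambda>u. normal_law 1)"
    using o0 n0 by (intro cyl_gaussian_joint_law[OF c0 U]) auto
  have N1: "?N1 = PiM U (\<lambda>u. normal_law (\<sigma> u))"
    using o1 \<sigma> \<sigma>2 by (intro cyl_gaussian_joint_law[OF c1 U]) auto
  define l where "l u x = x\<^sup>2 / 2 - x\<^sup>2 / (2 * (\<sigma> u)\<^sup>2) - ln (\<sigma> u)" for u and x :: real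
  have lm[measurable]: "l u \<in> borel_measurable borel" for u unfolding l_def by measurable
  define L where "L y = (\<Sum>u\<in>U. l u (y u))" for y
  have Lm: "L \<in> borel_measurable (PiM U (\<lambda>_. borel))" unfolding L_def by measurable
  have ld: "normal_law (\<sigma> u) = density (normal_law 1) (\<lambda>x. ennreal (exp (l u x)))" for u
    unfolding l_def by (rule normal_law_likelihood[OF \<sigma>])
  have dens: "?N1 = density ?N0 (\<lambda>y. ennreal (exp (L y)))"
  proof -
    have "?N1 = PiM U (\<lambda>u. density (normal_law 1) (\<lambda>x. ennreal (exp (l u x))))"
      unfolding N1 by (simp only: ld)
    also have "\<dots> = density (PiM U (\<lambda>u. normal_law 1)) (\<lambda>y. \<Prod>u\<in>U. ennreal (exp (l u (y u))))"
    proof (rule PiM_density_eq[OF U])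
      show "prob_space (normal_law 1)" by (rule prob_space_normal_density) simp
      show "prob_space (density (normal_law 1) (\<lambda>x. ennreal (exp (l u x))))" for u
        unfolding ld[symmetric] by (rule prob_space_normal_density[OF \<sigma>])
    qed simp
    also have "(\<lambda>y. \<Prod>u\<in>U. ennreal (exp (l u (y u)))) = (\<lambda>y. ennreal (exp (L y)))"
      using U by (simp add: L_def exp_sum prod_ennreal)
    finally show ?thesis unfolding N0 .
  qed
  have LY: "L (\<lambda>u\<in>U. x u) = (\<Sum>u\<in>U. l u (x u))" for x by (simp add: L_def)
  have l_alt: "l u x = (1 / 2 - 1 / (2 * (\<sigma> u)\<^sup>2)) * (x * x) - ln (\<sigma> u)" for u x
    by (simp add: l_def power2_eq_square algebra_simps)
  have int0: "integrable M0 (\<lambda>\<omega>. \<Sum>u\<in>U. l u (X0 u \<omega>))"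
    unfolding l_alt using cyl_gaussian_product(1)[OF c0] by auto
  have int1: "integrable M1 (\<lambda>\<omega>. \<Sum>u\<in>U. l u (X1 u \<omega>))"
    unfolding l_alt using cyl_gaussian_product(1)[OF c1] by auto
  have E0: "(LINT \<omega>|M0. (\<Sum>u\<in>U. l u (X0 u \<omega>))) = (\<Sum>u\<in>U. (1 / 2 - 1 / (2 * (\<sigma> u)\<^sup>2)) - ln (\<sigma> u))"
    unfolding l_alt using cyl_gaussian_product[OF c0] n0
    by (simp add: M0.prob_space)
  have E1: "(LINT \<omega>|M1. (\<Sum>u\<in>U. l u (X1 u \<omega>))) =
      (\<Sum>u\<in>U. (1 / 2 - 1 / (2 * (\<sigma> u)\<^sup>2)) * (\<sigma> u)\<^sup>2 - ln (\<sigma> u))"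
    unfolding l_alt using cyl_gaussian_product[OF c1] \<sigma>2
    by (simp add: M1.prob_space)
  show ?thesis
  proof (rule jeffreys_close_likelihood[OF _ _ dens])
    show "prob_space ?N0" by (rule M0.prob_space_distr[OF Y0])
    show "prob_space ?N1" by (rule M1.prob_space_distr[OF Y1])
    show "integrable ?N0 L" using int0 Lm by (simp add: integrable_distr_eq LY)
    show "integrable ?N1 L" using int1 Lm by (simp add: integrable_distr_eq LY)
    have "(LINT y|?N1. L y) - (LINT y|?N0. L y) =
        (\<Sum>u\<in>U. ((1 / 2 - 1 / (2 * (\<sigma> u)\<^sup>2)) * (\<sigma> u)\<^sup>2 - ln (\<sigma> u)) - ((1 / 2 - 1 / (2 * (\<sigma> u)\<^sup>2)) - ln (\<sigma> u)))"
      unfolding integral_distr[OF Y0 Lm] integral_distr[OF Y1 Lm] LY E0 E1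
      by (rule sum_subtractf[symmetric])
    also have "\<dots> = (\<Sum>u\<in>U. (Q1 u \<bullet> u - 2 + 1 / (Q1 u \<bullet> u)) / 2)"
    proof (rule sum.cong)
      fix u assume u: "u \<in> U"
      have "(\<sigma> u)\<^sup>2 \<noteq> 0" using \<sigma>[of u] by simp
      then show "((1 / 2 - 1 / (2 * (\<sigma> u)\<^sup>2)) * (\<sigma> u)\<^sup>2 - ln (\<sigma> u)) - ((1 / 2 - 1 / (2 * (\<sigma> u)\<^sup>2)) - ln (\<sigma> u)) =
          (Q1 u \<bullet> u - 2 + 1 / (Q1 u \<bullet> u)) / 2"
        unfolding \<sigma>2[OF u] by (simp add: field_simps)
    qed simp
    finally show "(LINT y|?N1. L y) - (LINT y|?N0. L y) \<le> J"
      using J by (simp add: sum_divide_distrib)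
  qed
qed

text \<open>With \<open>A = S0\<^sup>-\<^sup>1 S1\<close> one has \<open>A\<^sup>* (S0 u) = S1 u\<close>, so for \<open>w = S0 u\<close> and \<open>w' = S0 u'\<close> the number
  \<open>Q1 u \<bullet> u'\<close> is \<open>A A\<^sup>* w \<bullet> w'\<close> while \<open>Q0 u \<bullet> u'\<close> is \<open>w \<bullet> w'\<close>. An orthonormal basis of \<open>S0 (span F)\<close>
  that diagonalises \<open>A A\<^sup>*\<close> therefore pulls back to \<open>U\<close>.\<close>

lemma simultaneous_diagonalisation:
  fixes Q0 Q1 :: "'h::{real_inner, polish_space} \<Rightarrow> 'h"
  defines "D \<equiv> (\<lambda>x. inv_sqrt_comp Q0 Q1 x - adjoint (inv_sqrt_comp Q1 Q0) x)"
  assumes Q0: "psd_operator Q0" and Q1: "psd_operator Q1"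
    and inj: "inj Q0" "inj Q1"
    and range: "range (op_sqrt Q0) = range (op_sqrt Q1)"
    and F: "finite F"
  obtains U where "finite U"
    and "\<And>u u'. u \<in> U \<Longrightarrow> u' \<in> U \<Longrightarrow> u \<noteq> u' \<Longrightarrow> Q0 u \<bullet> u' = 0"
    and "\<And>u u'. u \<in> U \<Longrightarrow> u' \<in> U \<Longrightarrow> u \<noteq> u' \<Longrightarrow> Q1 u \<bullet> u' = 0"
    and "\<And>u. u \<in> U \<Longrightarrow> Q0 u \<bullet> u = 1"
    and "\<And>u. u \<in> U \<Longrightarrow> 0 < Q1 u \<bullet> u"
    and "\<And>v. v \<in> F \<Longrightarrow> (\<Sum>u\<in>U. (Q0 v \<bullet> u) *\<^sub>R u) = v"
    and "ennreal (\<Sum>u\<in>U. Q1 u \<bullet> u - 2 + 1 / (Q1 u \<bullet> u)) \<le> hs_norm_sq D"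
proof -
  define S0 where "S0 = op_sqrt Q0"
  define S1 where "S1 = op_sqrt Q1"
  have S0S0: "S0 (S0 x) = Q0 x" and S1S1: "S1 (S1 x) = Q1 x" for x
    unfolding S0_def S1_def using op_sqrt_works(2) Q0 Q1 by blast+
  have psd: "psd_operator S0" "psd_operator S1"
    unfolding S0_def S1_def using op_sqrt_works(1) Q0 Q1 by blast+
  then have bl0: "bounded_linear S0" and sym0: "\<And>x y. S0 x \<bullet> y = x \<bullet> S0 y"
    and bl1: "bounded_linear S1" and sym1: "\<And>x y. S1 x \<bullet> y = x \<bullet> S1 y"
    by (simp_all add: psd_operator_def)
  interpret S0: bounded_linear S0 by (rule bl0)
  interpret S1: bounded_linear S1 by (rule bl1)
  have inj0: "inj S0" using inj(1) by (metis S0S0 injI injD)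
  have inj1: "inj S1" using inj(2) by (metis S1S1 injI injD)
  have ran: "range S0 = range S1" using range by (simp add: S0_def S1_def)
  define A where "A = inv S0 \<circ> S1"
  define A' where "A' = inv S1 \<circ> S0"
  have blA: "bounded_linear A" and SA: "\<And>x. S0 (A x) = S1 x"
    unfolding A_def using bounded_linear_inv_comp[OF bl0 sym0 inj0 bl1 sym1] ran by auto
  have blA': "bounded_linear A'" and SA': "\<And>x. S1 (A' x) = S0 x"
    unfolding A'_def using bounded_linear_inv_comp[OF bl1 sym1 inj1 bl0 sym0] ran by auto
  have D: "D x = A x - adjoint A' x" for x
    by (simp add: D_def A_def A'_def inv_sqrt_comp_def S0_def S1_def)
  define T where "T x = A (adjoint A x)" for x
  have T: "bounded_linear T"
    unfolding T_def by (rule bounded_linear_compose[OF blA bounded_linear_adjoint[OF blA]])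
  have T_inner: "T x \<bullet> y = adjoint A x \<bullet> adjoint A y" for x y
    unfolding T_def by (rule adjoint_hilbert[OF blA])
  have symT: "T x \<bullet> y = x \<bullet> T y" for x y
    unfolding T_inner using T_inner[of y x] by (simp add: inner_commute)
  obtain B where B: "finite B" and spB: "span B = span (S0 ` F)" and oB: "pairwise orthogonal B"
    and nB: "\<And>e. e \<in> B \<Longrightarrow> norm e = 1"
    and TB: "\<And>e e'. e \<in> B \<Longrightarrow> e' \<in> B \<Longrightarrow> e \<noteq> e' \<Longrightarrow> T e \<bullet> e' = 0"
    by (rule orthonormal_diagonalisation[OF T symT finite_imageI[OF F, of S0]])
      (rule that)
  have "\<exists>u. S0 u = w" if "w \<in> B" for w
  proof -
    have "w \<in> span (S0 ` F)" using that spB span_base by blast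
    then show ?thesis using linear_span_image[OF S0.linear_axioms, of F] by auto
  qed
  then obtain u where u: "\<And>w. w \<in> B \<Longrightarrow> S0 (u w) = w" by metis
  define U where "U = u ` B"
  have injU: "inj_on u B" using u by (metis inj_onI)
  have ww: "w \<bullet> w = 1" if "w \<in> B" for w
    using nB[OF that] by (simp add: power2_norm_eq_inner[symmetric])
  have Q0u: "Q0 (u w) \<bullet> u w' = w \<bullet> w'" if "w \<in> B" "w' \<in> B" for w w'
    using that by (simp add: S0S0[symmetric] sym0 u)
  have adjA: "adjoint A w = S1 (u w)" if w: "w \<in> B" for w
  proof (rule vector_eq_ldot[THEN iffD1], rule allI)
    fix e
    have "e \<bullet> adjoint A w = A e \<bullet> w" by (rule adjoint_hilbert[OF blA, symmetric])
    also have "\<dots> = A e \<bullet> S0 (u w)" using u[OF w] by simp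
    also have "\<dots> = S0 (A e) \<bullet> u w" by (rule sym0[symmetric])
    also have "\<dots> = e \<bullet> S1 (u w)" by (simp add: SA sym1)
    finally show "e \<bullet> adjoint A w = e \<bullet> S1 (u w)" .
  qed
  have Q1u: "Q1 (u w) \<bullet> u w' = T w \<bullet> w'" if "w \<in> B" "w' \<in> B" for w w'
    using that by (simp add: T_inner adjA S1S1[symmetric] sym1)
  have Q1uu: "Q1 (u w) \<bullet> u w = S1 (u w) \<bullet> S1 (u w)" for w
    by (simp add: S1S1[symmetric] sym1)
  have S1u: "S1 (u w) \<noteq> 0" if w: "w \<in> B" for w
  proof
    assume "S1 (u w) = 0"
    then have "S1 (u w) = S1 0" by (simp add: S1.zero)
    then have "u w = 0" by (rule injD[OF inj1])
    then have "w = 0" using u[OF w] by (simp add: S0.zero)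
    then show False using nB[OF w] by simp
  qed
  define y where "y w = S1 (u w) - A' w" for w
  have y_D: "y w \<bullet> e = w \<bullet> D e" if w: "w \<in> B" for w e
  proof -
    have "S1 (u w) \<bullet> e = u w \<bullet> S0 (A e)" by (simp add: sym1 SA)
    also have "\<dots> = w \<bullet> A e" using u[OF w] by (simp add: sym0[symmetric])
    finally have "S1 (u w) \<bullet> e = w \<bullet> A e" .
    then show ?thesis
      by (simp add: y_def D inner_diff_left inner_diff_right adjoint_hilbert[OF blA'])
  qed
  have y_ge: "Q1 (u w) \<bullet> u w - 2 + 1 / (Q1 (u w) \<bullet> u w) \<le> (norm (y w))\<^sup>2" if w: "w \<in> B" for w
  proof -
    \<comment> \<open>This makes the mixed term of \<open>(norm (D\<^sup>* w))\<^sup>2\<close> equal to \<open>- 2\<close>.\<close>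
    have cross: "S1 (u w) \<bullet> A' w = 1"
      using ww[OF w] u[OF w] by (simp add: sym1 SA' sym0[symmetric])
    have pos: "0 < Q1 (u w) \<bullet> u w" using S1u[OF w] by (simp add: Q1uu)
    have "(S1 (u w) \<bullet> A' w)\<^sup>2 \<le> (S1 (u w) \<bullet> S1 (u w)) * (A' w \<bullet> A' w)"
      by (rule Cauchy_Schwarz_ineq)
    then have "1 / (Q1 (u w) \<bullet> u w) \<le> A' w \<bullet> A' w"
      using pos by (simp add: cross Q1uu field_simps)
    moreover have "(norm (y w))\<^sup>2 = Q1 (u w) \<bullet> u w - 2 + A' w \<bullet> A' w"
      by (simp add: y_def power2_norm_eq_inner inner_diff_left inner_diff_right cross
          inner_commute[of "A' w" "S1 (u w)"] Q1uu)
    ultimately show ?thesis by simp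
  qed
  show thesis
  proof (rule that[of U])
    show "finite U" using B by (simp add: U_def)
    show "Q0 x \<bullet> x' = 0" if x: "x \<in> U" "x' \<in> U" "x \<noteq> x'" for x x'
    proof -
      obtain w w' where w: "w \<in> B" "w' \<in> B" "x = u w" "x' = u w'" using x(1,2) by (auto simp: U_def)
      then have "w \<noteq> w'" using x(3) by blast
      then show ?thesis using w oB by (auto simp: Q0u pairwise_def orthogonal_def)
    qed
    show "Q1 x \<bullet> x' = 0" if x: "x \<in> U" "x' \<in> U" "x \<noteq> x'" for x x'
    proof -
      obtain w w' where w: "w \<in> B" "w' \<in> B" "x = u w" "x' = u w'" using x(1,2) by (auto simp: U_def)
      then have "w \<noteq> w'" using x(3) by blast
      then show ?thesis using w TB by (auto simp: Q1u)
    qed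
    show "Q0 x \<bullet> x = 1" if "x \<in> U" for x
      using that ww by (auto simp: U_def Q0u)
    show "0 < Q1 x \<bullet> x" if "x \<in> U" for x
      using that S1u by (auto simp: U_def Q1uu)
    show "(\<Sum>x\<in>U. (Q0 v \<bullet> x) *\<^sub>R x) = v" if v: "v \<in> F" for v
    proof (rule injD[OF inj0])
      have "S0 (\<Sum>x\<in>U. (Q0 v \<bullet> x) *\<^sub>R x) = (\<Sum>w\<in>B. (Q0 v \<bullet> u w) *\<^sub>R w)"
        unfolding U_def by (subst sum.reindex[OF injU]) (simp add: S0.sum S0.scaleR u)
      also have "\<dots> = (\<Sum>w\<in>B. (S0 v \<bullet> w) *\<^sub>R w)"
        by (intro sum.cong refl) (simp add: S0S0[symmetric] sym0[of "S0 v"] u)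
      also have "\<dots> = S0 v"
        using v spB by (intro orthonormal_basis_expand oB nB B) (auto intro: span_base)
      finally show "S0 (\<Sum>x\<in>U. (Q0 v \<bullet> x) *\<^sub>R x) = S0 v" .
    qed
    have "(\<Sum>x\<in>U. Q1 x \<bullet> x - 2 + 1 / (Q1 x \<bullet> x)) \<le> (\<Sum>w\<in>B. (norm (y w))\<^sup>2)"
      unfolding U_def by (subst sum.reindex[OF injU]) (auto intro!: sum_mono y_ge)
    then have "ennreal (\<Sum>x\<in>U. Q1 x \<bullet> x - 2 + 1 / (Q1 x \<bullet> x)) \<le> ennreal (\<Sum>w\<in>B. (norm (y w))\<^sup>2)"
      by (rule ennreal_leI)
    also have "\<dots> \<le> hs_norm_sq D" by (rule sum_norm_le_hs_norm_sq[OF B oB nB y_D])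
    finally show "ennreal (\<Sum>x\<in>U. Q1 x \<bullet> x - 2 + 1 / (Q1 x \<bullet> x)) \<le> hs_norm_sq D" .
  qed
qed

lemma measurable_sample_path:
  assumes "\<And>v. X v \<in> borel_measurable M"
  shows "(\<lambda>\<omega> v. X v \<omega>) \<in> M \<rightarrow>\<^sub>M PiM UNIV (\<lambda>_. borel)"
  using measurable_restrict[of UNIV "\<lambda>v \<omega>. X v \<omega>" M "\<lambda>_. borel"] assms
  by (simp add: restrict_def)

lemma process_law_marginal:
  assumes "\<And>v. X v \<in> borel_measurable M"
  shows "distr (process_law M X) (PiM F (\<lambda>_. borel)) (\<lambda>x. restrict x F) =
    distr M (PiM F (\<lambda>_. borel)) (\<lambda>\<omega>. \<lambda>v\<in>F. X v \<omega>)"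
  unfolding process_law_def distr_distr[OF restrict_measurable_PiM measurable_sample_path[OF assms]]
  by (simp only: comp_def)

text \<open>Almost surely the process is linear on the finitely many vectors involved.\<close>

lemma cyl_gaussian_marginal_push:
  assumes c: "cyl_gaussian M X Q" and "linear Q" and U: "finite U" and F: "finite F"
    and rep: "\<And>v. v \<in> F \<Longrightarrow> (\<Sum>u\<in>U. a v u *\<^sub>R u) = v"
  shows "distr M (PiM F (\<lambda>_. borel)) (\<lambda>\<omega>. \<lambda>v\<in>F. X v \<omega>) =
    distr (distr M (PiM U (\<lambda>_. borel)) (\<lambda>\<omega>. \<lambda>u\<in>U. X u \<omega>)) (PiM F (\<lambda>_. borel))
      (\<lambda>x. \<lambda>v\<in>F. \<Sum>u\<in>U. a v u * x u)"
proof -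
  note [measurable] = cyl_gaussian_measurable[OF c]
  have Y: "(\<lambda>\<omega>. \<lambda>u\<in>G. X u \<omega>) \<in> M \<rightarrow>\<^sub>M PiM G (\<lambda>_. borel)" for G
    by (auto intro!: measurable_restrict)
  have \<Phi>: "(\<lambda>x. \<lambda>v\<in>F. \<Sum>u\<in>U. a v u * x u) \<in> PiM U (\<lambda>_. borel) \<rightarrow>\<^sub>M PiM F (\<lambda>_. borel :: real measure)"
    by (intro measurable_restrict) measurable
  have "AE \<omega> in M. \<forall>v\<in>F. X v \<omega> = (\<Sum>u\<in>U. a v u * X u \<omega>)"
  proof (rule AE_finite_allI[OF F])
    fix v assume "v \<in> F"
    from cyl_gaussian_linear[OF c \<open>linear Q\<close> U, of "a v"] rep[OF this]
    show "AE \<omega> in M. X v \<omega> = (\<Sum>u\<in>U. a v u * X u \<omega>)" by simp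
  qed
  then have "AE \<omega> in M. (\<lambda>v\<in>F. X v \<omega>) =
      ((\<lambda>x. \<lambda>v\<in>F. \<Sum>u\<in>U. a v u * x u) \<circ> (\<lambda>\<omega>. \<lambda>u\<in>U. X u \<omega>)) \<omega>"
    by eventually_elim (auto simp: fun_eq_iff restrict_def)
  then show ?thesis
    unfolding distr_distr[OF \<Phi> Y]
    by (intro distr_cong_AE refl Y measurable_comp[OF Y \<Phi>]) auto
qed

theorem proposition2p3:
  fixes Q0 Q1 :: "'h::{real_inner, polish_space} \<Rightarrow> 'h"
    and M0 :: "'w0 measure" and X0 :: "'h \<Rightarrow> 'w0 \<Rightarrow> real"
    and M1 :: "'w1 measure" and X1 :: "'h \<Rightarrow> 'w1 \<Rightarrow> real"
  defines "D \<equiv> (\<lambda>x. inv_sqrt_comp Q0 Q1 x - adjoint (inv_sqrt_comp Q1 Q0) x)"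
  assumes "psd_operator Q0" and "psd_operator Q1"
    and "cyl_gaussian M0 X0 Q0" and "cyl_gaussian M1 X1 Q1"
    and "inj Q0" and "inj Q1"
    and "range (op_sqrt Q0) = range (op_sqrt Q1)"
    and "1 / 4 * hs_norm_sq D < \<infinity>"
  shows "hellinger_sq (process_law M0 X0) (process_law M1 X1) \<le> 1 / 4 * hs_norm_sq D \<and>
         equivalent_measures (process_law M0 X0) (process_law M1 X1)"
proof -
  note Q0 = \<open>psd_operator Q0\<close> and Q1 = \<open>psd_operator Q1\<close>
    and c0 = \<open>cyl_gaussian M0 X0 Q0\<close> and c1 = \<open>cyl_gaussian M1 X1 Q1\<close>
  have lin: "linear Q0" "linear Q1"
    using Q0 Q1 by (auto simp: psd_operator_def bounded_linear.linear)
  have "hs_norm_sq D \<noteq> \<top>"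
    using assms(9) by (auto simp: ennreal_mult_top)
  then obtain h where h: "0 \<le> h" "hs_norm_sq D = ennreal h" by (cases "hs_norm_sq D") auto
  let ?P0 = "process_law M0 X0" and ?P1 = "process_law M1 X1"
  note X0 = cyl_gaussian_measurable[OF c0] and X1 = cyl_gaussian_measurable[OF c1]
  have prob: "prob_space ?P0" "prob_space ?P1"
    unfolding process_law_def
    using prob_space.prob_space_distr[OF cyl_gaussian_prob_space[OF c0] measurable_sample_path[OF X0]]
      prob_space.prob_space_distr[OF cyl_gaussian_prob_space[OF c1] measurable_sample_path[OF X1]] .
  have sets: "sets ?P0 = sets (PiM UNIV (\<lambda>_. borel))" "sets ?P1 = sets (PiM UNIV (\<lambda>_. borel))"
    by (simp_all add: process_law_def)
  have close: "jeffreys_close (h / 2) ?P0 ?P1"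
  proof (rule jeffreys_close_from_marginals[OF prob sets])
    fix F :: "'h set" assume F: "finite F"
    obtain U where U: "finite U"
      and diag: "\<And>u u'. u \<in> U \<Longrightarrow> u' \<in> U \<Longrightarrow> u \<noteq> u' \<Longrightarrow> Q0 u \<bullet> u' = 0"
        "\<And>u u'. u \<in> U \<Longrightarrow> u' \<in> U \<Longrightarrow> u \<noteq> u' \<Longrightarrow> Q1 u \<bullet> u' = 0"
        "\<And>u. u \<in> U \<Longrightarrow> Q0 u \<bullet> u = 1" "\<And>u. u \<in> U \<Longrightarrow> 0 < Q1 u \<bullet> u"
      and rep: "\<And>v. v \<in> F \<Longrightarrow> (\<Sum>u\<in>U. (Q0 v \<bullet> u) *\<^sub>R u) = v"
      and bound: "ennreal (\<Sum>u\<in>U. Q1 u \<bullet> u - 2 + 1 / (Q1 u \<bullet> u)) \<le> hs_norm_sq D"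
      by (rule simultaneous_diagonalisation[OF Q0 Q1 \<open>inj Q0\<close> \<open>inj Q1\<close>
            \<open>range (op_sqrt Q0) = range (op_sqrt Q1)\<close> F, folded D_def]) (rule that)
    have "(\<Sum>u\<in>U. Q1 u \<bullet> u - 2 + 1 / (Q1 u \<bullet> u)) / 2 \<le> h / 2"
      using bound h by (simp add: ennreal_le_iff)
    from jeffreys_close_gaussian_coordinates[OF c0 c1 U diag this]
    have "jeffreys_close (h / 2) (distr M0 (PiM U (\<lambda>_. borel)) (\<lambda>\<omega>. \<lambda>u\<in>U. X0 u \<omega>))
        (distr M1 (PiM U (\<lambda>_. borel)) (\<lambda>\<omega>. \<lambda>u\<in>U. X1 u \<omega>))" .
    then show "jeffreys_close (h / 2) (distr ?P0 (PiM F (\<lambda>_. borel)) (\<lambda>x. restrict x F))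
        (distr ?P1 (PiM F (\<lambda>_. borel)) (\<lambda>x. restrict x F))"
      unfolding process_law_marginal[OF X0] process_law_marginal[OF X1]
        cyl_gaussian_marginal_push[where a = "\<lambda>v u. Q0 v \<bullet> u", OF c0 lin(1) U F rep, simplified]
        cyl_gaussian_marginal_push[where a = "\<lambda>v u. Q0 v \<bullet> u", OF c1 lin(2) U F rep, simplified]
      by (rule jeffreys_close_distr) (simp, measurable)
  qed
  have "hellinger_sq ?P0 ?P1 \<le> ennreal (h / 2 / 2)"
    using sets by (intro jeffreys_close_imp_hellinger[OF close prob]) simp
  also have "\<dots> = 1 / 4 * hs_norm_sq D"
  proof -
    have "ennreal (1 / 4) = 1 / 4" using divide_ennreal[of 1 4] by simp
    then show ?thesis using ennreal_mult'[of "1 / 4" h] h by simp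
  qed
  finally show ?thesis
    using jeffreys_close_imp_equivalent[OF close prob] sets by simp
qed

end
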